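(* Let $\alpha\in\mathbb{R}$ with $|\alpha|<1$ and $I=(0,1)$. There exist constants $\epsilon>0$ and $C>0$, with $C$ independent of $\epsilon$, such that for every $\varphi\in C^1(\mathbb{R})$ with $\|\varphi\|_{C^1(\mathbb{R})}\le\epsilon$, the system $$\begin{cases} u_t+u_{xxx}-u_{xxxxx}+uu_x=0, & (x,t)\in I\times\mathbb{R},\\ u(0,t)=\varphi(t),\quad u(1,t)=u_x(1,t)=u_x(0,t)=0, & t\in\mathbb{R},\\ u_{xx}(1,t)=\alpha u_{xx}(0,t), & t\in\mathbb{R},\end{cases}$$ admits a unique (mild) solution $u$ such that $\|u\|_X\le C\epsilon$.
   Context: $C^1(\mathbb{R})$: continuously differentiable complex-valued functions on $\mathbb{R}$, $\|\varphi\|_{C^1(\mathbb{R})}=\sup_{\mathbb{R}}|\varphi|+\sup_{\mathbb{R}}|\varphi'|$. $L^2(I)$ and $H^2(I)$ consist of complex-valued functions. $X=C_b(\mathbb{R},H^2(I))$ is the space of bounded continuous functions $\mathbb{R}\to H^2(I)$, with $\|u\|_X=\sup_{t\in\mathbb{R}}\|u(t)\|_{H^2(I)}$. $\{S(t)\}_{t\ge0}$ is the $C_0$-semigroup of contractions on $L^2(I)$ generated by the operator $v\mapsto -v_{xxx}+v_{xxxxx}$ with domain $\{v\in H^5(I): v(0)=v(1)=v_x(0)=v_x(1)=0,\ v_{xx}(1)=\alpha v_{xx}(0)\}$. Notion of solution. Put $A(x)=\frac{\alpha-1}{\alpha+1}x^2+\frac{2}{\alpha+1}x-1$, $a(x,t)=-A(x)\varphi(t)$,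 $b(x,t)=-A'(x)\varphi(t)$, $f(x,t)=A(x)\varphi'(t)-A(x)A'(x)\varphi(t)^2$. A function $u\in X$ is a (mild) solution of the system if $y(x,t)=u(x,t)+A(x)\varphi(t)$ satisfies $$y(t)=S(t-r)y(r)+\int_r^t S(t-s)\,(-yy_x-ay_x-by+f)(s)\,ds\qquad\text{for all } r\in\mathbb{R},\ t\ge r.$$ The boundary conditions are understood only through this integral equation. *)

theory Defs
  imports "HOL-Analysis.Analysis"
begin

section \<open>The space of square-integrable functions on the unit interval\<close>

definition MI :: "real measure" where
  "MI = restrict_space lborel {0<..<1}"

definition sq_integrable :: "(real \<Rightarrow> complex) \<Rightarrow> bool" where
  "sq_integrable f \<longleftrightarrow> f \<in> borel_measurable MI \<and> integrable MI (\<lambda>x. (norm (f x))\<^sup>2)"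

lemma space_MI [simp]: "space MI = {0<..<1}"
  by (simp add: MI_def space_restrict_space)

lemma finite_measure_MI: "finite_measure MI"
  by (rule finite_measureI) (simp add: MI_def emeasure_restrict_space space_restrict_space)

lemma sq_integrable_zero: "sq_integrable (\<lambda>x. 0)"
  by (simp add: sq_integrable_def)

lemma sq_integrable_cmult: "sq_integrable f \<Longrightarrow> sq_integrable (\<lambda>x. c * f x)"
  by (auto simp: sq_integrable_def norm_mult power_mult_distrib)

lemma sq_integrable_scaleR: "sq_integrable f \<Longrightarrow> sq_integrable (\<lambda>x. c *\<^sub>R f x)"
  by (auto simp: sq_integrable_def power_mult_distrib)

lemma sq_integrable_uminus: "sq_integrable f \<Longrightarrow> sq_integrable (\<lambda>x. - f x)"
  by (auto simp: sq_integrable_def)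

lemma integrable_mult_norms:
  assumes "sq_integrable f" "sq_integrable g"
  shows "integrable MI (\<lambda>x. norm (f x) * norm (g x))"
proof (rule Bochner_Integration.integrable_bound)
  show "integrable MI (\<lambda>x. (norm (f x))\<^sup>2 + (norm (g x))\<^sup>2)"
    using assms by (auto simp: sq_integrable_def)
  show "(\<lambda>x. norm (f x) * norm (g x)) \<in> borel_measurable MI"
    using assms by (auto simp: sq_integrable_def)
  have "norm (norm (f x) * norm (g x)) \<le> norm ((norm (f x))\<^sup>2 + (norm (g x))\<^sup>2)" for x
  proof -
    have "2 * (norm (f x) * norm (g x)) \<le> (norm (f x))\<^sup>2 + (norm (g x))\<^sup>2"
      using sum_squares_bound[of "norm (f x)" "norm (g x)"] by (simp add: mult.assoc)
    moreover have "0 \<le> norm (f x) * norm (g x)" by simp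
    moreover have "norm (f x) * norm (g x) \<le> 2 * (norm (f x) * norm (g x))" by simp
    ultimately have "norm (f x) * norm (g x) \<le> (norm (f x))\<^sup>2 + (norm (g x))\<^sup>2"
      by linarith
    then show ?thesis by simp
  qed
  then show "AE x in MI. norm (norm (f x) * norm (g x)) \<le> norm ((norm (f x))\<^sup>2 + (norm (g x))\<^sup>2)"
    by simp
qed

lemma sq_integrable_add:
  assumes "sq_integrable f" "sq_integrable g"
  shows "sq_integrable (\<lambda>x. f x + g x)"
  unfolding sq_integrable_def
proof
  show m: "(\<lambda>x. f x + g x) \<in> borel_measurable MI"
    using assms by (auto simp: sq_integrable_def)
  show "integrable MI (\<lambda>x. (norm (f x + g x))\<^sup>2)"
  proof (rule Bochner_Integration.integrable_bound)
    show "integrable MI (\<lambda>x. (norm (f x))\<^sup>2 + (norm (g x))\<^sup>2 + 2 * (norm (f x) * norm (g x)))"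
      using assms integrable_mult_norms[OF assms] by (auto simp: sq_integrable_def)
    show "(\<lambda>x. (norm (f x + g x))\<^sup>2) \<in> borel_measurable MI"
      using m by measurable
    have "(norm (f x + g x))\<^sup>2 \<le> (norm (f x) + norm (g x))\<^sup>2" for x
      by (intro power_mono norm_triangle_ineq) auto
    then show "AE x in MI. norm ((norm (f x + g x))\<^sup>2)
        \<le> norm ((norm (f x))\<^sup>2 + (norm (g x))\<^sup>2 + 2 * (norm (f x) * norm (g x)))"
      by (auto simp: power2_sum mult.assoc)
  qed
qed

definition L2_eq :: "(real \<Rightarrow> complex) \<Rightarrow> (real \<Rightarrow> complex) \<Rightarrow> bool" where
  "L2_eq f g \<longleftrightarrow> sq_integrable f \<and> sq_integrable g \<and> (AE x in MI. f x = g x)"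

lemma part_equivp_L2_eq: "part_equivp L2_eq"
proof (rule part_equivpI)
  show "\<exists>f. L2_eq f f"
    by (rule exI[of _ "\<lambda>x. 0"]) (simp add: L2_eq_def sq_integrable_zero)
  show "symp L2_eq"
    by (rule sympI) (auto simp: L2_eq_def elim: AE_mp)
  show "transp L2_eq"
    by (rule transpI) (auto simp: L2_eq_def)
qed

text \<open>\<open>L\<^sup>2(I)\<close> for \<open>I = (0,1)\<close>: square-integrable complex-valued functions modulo equality almost
  everywhere.  Values of representatives outside \<open>(0,1)\<close> are irrelevant.\<close>

quotient_type L2I = "real \<Rightarrow> complex" / partial: L2_eq
  morphisms rep_L2 abs_L2
  by (rule part_equivp_L2_eq)

definition L2_norm_fun :: "(real \<Rightarrow> complex) \<Rightarrow> real" where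
  "L2_norm_fun f = sqrt (LINT x|MI. (norm (f x))\<^sup>2)"

lemma L2_norm_fun_nonneg: "0 \<le> L2_norm_fun f"
  by (simp add: L2_norm_fun_def)

lemma L2_norm_fun_cong:
  assumes "L2_eq f g" shows "L2_norm_fun f = L2_norm_fun g"
  unfolding L2_norm_fun_def using assms
  by (auto simp: L2_eq_def sq_integrable_def intro!: arg_cong[of _ _ sqrt] integral_cong_AE)

lemma L2_norm_fun_eq_0:
  assumes "sq_integrable f"
  shows "L2_norm_fun f = 0 \<longleftrightarrow> (AE x in MI. f x = 0)"
proof -
  have "L2_norm_fun f = 0 \<longleftrightarrow> (LINT x|MI. (norm (f x))\<^sup>2) = 0"
    by (simp add: L2_norm_fun_def)
  also have "\<dots> \<longleftrightarrow> (AE x in MI. (norm (f x))\<^sup>2 = 0)"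
    using assms by (intro integral_nonneg_eq_0_iff_AE) (auto simp: sq_integrable_def)
  finally show ?thesis by simp
qed

lemma L2_norm_fun_scaleR: "L2_norm_fun (\<lambda>x. c *\<^sub>R f x) = \<bar>c\<bar> * L2_norm_fun f"
  by (simp add: L2_norm_fun_def power_mult_distrib real_sqrt_mult)

lemma L2_cauchy_schwarz:
  assumes "sq_integrable f" "sq_integrable g"
  shows "(LINT x|MI. norm (f x) * norm (g x)) \<le> L2_norm_fun f * L2_norm_fun g"
proof -
  let ?a = "L2_norm_fun f" and ?b = "L2_norm_fun g"
  let ?c = "LINT x|MI. norm (f x) * norm (g x)"
  have i: "integrable MI (\<lambda>x. (norm (f x))\<^sup>2)" "integrable MI (\<lambda>x. (norm (g x))\<^sup>2)"
    "integrable MI (\<lambda>x. norm (f x) * norm (g x))"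
    using assms integrable_mult_norms[OF assms] by (auto simp: sq_integrable_def)
  have a2: "?a\<^sup>2 = (LINT x|MI. (norm (f x))\<^sup>2)" and b2: "?b\<^sup>2 = (LINT x|MI. (norm (g x))\<^sup>2)"
    by (simp_all add: L2_norm_fun_def)
  have key: "2 * s * t * ?c \<le> s\<^sup>2 * ?a\<^sup>2 + t\<^sup>2 * ?b\<^sup>2" for s t
  proof -
    have "0 \<le> (LINT x|MI. (s * norm (f x) - t * norm (g x))\<^sup>2)"
      by simp
    also have "\<dots> = (LINT x|MI. s\<^sup>2 * (norm (f x))\<^sup>2 + t\<^sup>2 * (norm (g x))\<^sup>2
        - 2 * s * t * (norm (f x) * norm (g x)))"
      by (rule Bochner_Integration.integral_cong) (auto simp: power2_diff power_mult_distrib)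
    also have "\<dots> = s\<^sup>2 * ?a\<^sup>2 + t\<^sup>2 * ?b\<^sup>2 - 2 * s * t * ?c"
      using i by (simp add: a2 b2)
    finally show ?thesis by simp
  qed
  show ?thesis
  proof (cases "?a = 0 \<or> ?b = 0")
    case True
    then have "AE x in MI. norm (f x) * norm (g x) = 0"
      using L2_norm_fun_eq_0[OF assms(1)] L2_norm_fun_eq_0[OF assms(2)]
      by (auto elim: AE_mp)
    then have "?c = 0"
      by (intro integral_eq_zero_AE)
    with True show ?thesis by auto
  next
    case False
    then have pos: "0 < ?a * ?b"
      using L2_norm_fun_nonneg[of f] L2_norm_fun_nonneg[of g] by (simp add: less_le)
    have "2 * ?b * ?a * ?c \<le> 2 * (?a * ?b) * (?a * ?b)"
      using key[of ?b ?a] by (simp add: power2_eq_square algebra_simps)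
    then have "(?a * ?b) * ?c \<le> (?a * ?b) * (?a * ?b)"
      by (simp add: algebra_simps)
    then show ?thesis
      using pos mult_le_cancel_left_pos by blast
  qed
qed

lemma L2_norm_fun_triangle:
  assumes "sq_integrable f" "sq_integrable g"
  shows "L2_norm_fun (\<lambda>x. f x + g x) \<le> L2_norm_fun f + L2_norm_fun g"
proof -
  have i: "integrable MI (\<lambda>x. (norm (f x))\<^sup>2)" "integrable MI (\<lambda>x. (norm (g x))\<^sup>2)"
    "integrable MI (\<lambda>x. norm (f x) * norm (g x))"
    "integrable MI (\<lambda>x. (norm (f x + g x))\<^sup>2)"
    using assms integrable_mult_norms[OF assms] sq_integrable_add[OF assms]
    by (auto simp: sq_integrable_def)
  have a2: "(L2_norm_fun f)\<^sup>2 = (LINT x|MI. (norm (f x))\<^sup>2)"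
    and b2: "(L2_norm_fun g)\<^sup>2 = (LINT x|MI. (norm (g x))\<^sup>2)"
    by (simp_all add: L2_norm_fun_def)
  have "(L2_norm_fun (\<lambda>x. f x + g x))\<^sup>2 = (LINT x|MI. (norm (f x + g x))\<^sup>2)"
    by (simp add: L2_norm_fun_def)
  also have "\<dots> \<le> (LINT x|MI. (norm (f x))\<^sup>2 + (norm (g x))\<^sup>2 + 2 * (norm (f x) * norm (g x)))"
  proof (rule integral_mono)
    fix x
    have "(norm (f x + g x))\<^sup>2 \<le> (norm (f x) + norm (g x))\<^sup>2"
      by (intro power_mono norm_triangle_ineq) auto
    then show "(norm (f x + g x))\<^sup>2
        \<le> (norm (f x))\<^sup>2 + (norm (g x))\<^sup>2 + 2 * (norm (f x) * norm (g x))"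
      by (simp add: power2_sum)
  qed (use i in auto)
  also have "\<dots> = (L2_norm_fun f)\<^sup>2 + (L2_norm_fun g)\<^sup>2
      + 2 * (LINT x|MI. norm (f x) * norm (g x))"
    using i by (simp add: a2 b2)
  also have "\<dots> \<le> (L2_norm_fun f + L2_norm_fun g)\<^sup>2"
    using L2_cauchy_schwarz[OF assms] by (simp add: power2_sum)
  finally show ?thesis
    by (rule power2_le_imp_le) (simp add: L2_norm_fun_nonneg)
qed

instantiation L2I :: real_normed_vector
begin

lift_definition zero_L2I :: L2I is "\<lambda>x. 0"
  by (simp add: L2_eq_def sq_integrable_zero)

lift_definition plus_L2I :: "L2I \<Rightarrow> L2I \<Rightarrow> L2I" is "\<lambda>f g x. f x + g x"
  by (auto simp: L2_eq_def sq_integrable_add elim: AE_mp)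

lift_definition uminus_L2I :: "L2I \<Rightarrow> L2I" is "\<lambda>f x. - f x"
  by (auto simp: L2_eq_def sq_integrable_uminus elim: AE_mp)

lift_definition scaleR_L2I :: "real \<Rightarrow> L2I \<Rightarrow> L2I" is "\<lambda>c f x. c *\<^sub>R f x"
  by (auto simp: L2_eq_def intro!: sq_integrable_scaleR elim: AE_mp)

lift_definition norm_L2I :: "L2I \<Rightarrow> real" is L2_norm_fun
  by (rule L2_norm_fun_cong)

definition minus_L2I :: "L2I \<Rightarrow> L2I \<Rightarrow> L2I" where
  "minus_L2I u v = u + - v"

definition dist_L2I :: "L2I \<Rightarrow> L2I \<Rightarrow> real" where
  "dist_L2I u v = norm (u - v)"

definition sgn_L2I :: "L2I \<Rightarrow> L2I" where
  "sgn_L2I u = inverse (norm u) *\<^sub>R u"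

definition uniformity_L2I :: "(L2I \<times> L2I) filter" where
  "uniformity_L2I = (INF e\<in>{0<..}. principal {(u, v). dist u v < e})"

definition open_L2I :: "L2I set \<Rightarrow> bool" where
  "open_L2I U \<longleftrightarrow> (\<forall>u\<in>U. \<forall>\<^sub>F (u', v) in uniformity. u' = u \<longrightarrow> v \<in> U)"

instance
proof
  fix u v w :: L2I and a b :: real and U :: "L2I set"
  show "u + v + w = u + (v + w)"
    by transfer (auto simp: L2_eq_def add.assoc intro!: sq_integrable_add)
  show "u + v = v + u"
    by transfer (auto simp: L2_eq_def add.commute intro!: sq_integrable_add)
  show "0 + u = u"
    by transfer (auto simp: L2_eq_def)
  show "- u + u = 0"
    by transfer (auto simp: L2_eq_def sq_integrable_zero)
  show "u - v = u + - v"
    by (rule minus_L2I_def)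
  show "a *\<^sub>R (u + v) = a *\<^sub>R u + a *\<^sub>R v"
    by transfer (auto simp: L2_eq_def scaleR_right_distrib
        intro!: sq_integrable_add sq_integrable_scaleR simp del: scaleR_conv_of_real)
  show "(a + b) *\<^sub>R u = a *\<^sub>R u + b *\<^sub>R u"
    by transfer (auto simp: L2_eq_def scaleR_left_distrib simp del: scaleR_conv_of_real
        intro!: sq_integrable_add sq_integrable_scaleR)
  show "a *\<^sub>R b *\<^sub>R u = (a * b) *\<^sub>R u"
    by transfer (auto simp: L2_eq_def intro!: sq_integrable_scaleR)
  show "1 *\<^sub>R u = u"
    by transfer (auto simp: L2_eq_def)
  show "dist u v = norm (u - v)"
    by (rule dist_L2I_def)
  show "sgn u = inverse (norm u) *\<^sub>R u"
    by (rule sgn_L2I_def)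
  show "uniformity = (INF e\<in>{0<..}. principal {(u, v::L2I). dist u v < e})"
    by (rule uniformity_L2I_def)
  show "open U \<longleftrightarrow> (\<forall>u\<in>U. \<forall>\<^sub>F (u', v) in uniformity. u' = u \<longrightarrow> v \<in> U)"
    by (rule open_L2I_def)
  show "norm u = 0 \<longleftrightarrow> u = 0"
    by transfer (auto simp: L2_eq_def L2_norm_fun_eq_0 sq_integrable_zero)
  show "norm (u + v) \<le> norm u + norm v"
    by transfer (auto simp: L2_eq_def intro: L2_norm_fun_triangle)
  show "norm (a *\<^sub>R u) = \<bar>a\<bar> * norm u"
    by transfer (rule L2_norm_fun_scaleR)
qed

end


lift_definition scaleC_L2 :: "complex \<Rightarrow> L2I \<Rightarrow> L2I" is "\<lambda>c f x. c * f x"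
  by (auto simp: L2_eq_def intro!: sq_integrable_cmult elim: AE_mp)

text \<open>The class of a function; only meaningful for square-integrable functions.\<close>

definition toL2 :: "(real \<Rightarrow> complex) \<Rightarrow> L2I" where
  "toL2 f = (if sq_integrable f then abs_L2 f else 0)"

lemma sq_integrable_rep [simp]: "sq_integrable (rep_L2 u)"
  using Quotient_rep_reflp[OF Quotient_L2I, of u] by (simp add: L2_eq_def)

lemma toL2_rep [simp]: "toL2 (rep_L2 u) = u"
  using Quotient_abs_rep[OF Quotient_L2I, of u] by (simp add: toL2_def)

lemma AE_rep_toL2:
  assumes "sq_integrable f" shows "AE x in MI. rep_L2 (toL2 f) x = f x"
proof -
  have "L2_eq f f" using assms by (simp add: L2_eq_def)
  then have "L2_eq (rep_L2 (abs_L2 f)) f"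
    using Quotient_rep_abs[OF Quotient_L2I] by blast
  then show ?thesis using assms by (simp add: L2_eq_def toL2_def)
qed

lemma L2I_eq_iff: "u = v \<longleftrightarrow> (AE x in MI. rep_L2 u x = rep_L2 v x)"
  using Quotient_rel_rep[OF Quotient_L2I, of u v] sq_integrable_rep
  unfolding L2_eq_def by blast

lemma rep_add: "AE x in MI. rep_L2 (u + v) x = rep_L2 u x + rep_L2 v x"
proof -
  have "u + v = toL2 (\<lambda>x. rep_L2 u x + rep_L2 v x)"
    unfolding plus_L2I_def by (simp add: toL2_def sq_integrable_add)
  then show ?thesis
    using AE_rep_toL2[of "\<lambda>x. rep_L2 u x + rep_L2 v x"] by (simp add: sq_integrable_add)
qed

lemma rep_scaleR: "AE x in MI. rep_L2 (c *\<^sub>R u) x = c *\<^sub>R rep_L2 u x"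
proof -
  have *: "sq_integrable (\<lambda>x. c *\<^sub>R rep_L2 u x)" by (rule sq_integrable_scaleR) simp
  then have "c *\<^sub>R u = toL2 (\<lambda>x. c *\<^sub>R rep_L2 u x)"
    unfolding scaleR_L2I_def by (simp add: toL2_def)
  then show ?thesis
    using AE_rep_toL2[OF *] by simp
qed

section \<open>Weak derivatives and Sobolev spaces\<close>

text \<open>Real-valued test functions suffice, since a complex-valued one is a combination of two of them.\<close>

definition test_fun :: "(real \<Rightarrow> real) \<Rightarrow> bool" where
  "test_fun \<psi> \<longleftrightarrow> (\<forall>n x. (deriv ^^ n) \<psi> differentiable at x) \<and>
     (\<exists>K. compact K \<and> K \<subseteq> {0<..<1} \<and> (\<forall>x. x \<notin> K \<longrightarrow> \<psi> x = 0))"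

definition weak_deriv :: "nat \<Rightarrow> L2I \<Rightarrow> L2I \<Rightarrow> bool" where
  "weak_deriv j u w \<longleftrightarrow> (\<forall>\<psi>. test_fun \<psi> \<longrightarrow>
     (LINT x|MI. rep_L2 u x * of_real ((deriv ^^ j) \<psi> x)) =
     (-1) ^ j * (LINT x|MI. rep_L2 w x * of_real (\<psi> x)))"

definition wderiv :: "nat \<Rightarrow> L2I \<Rightarrow> L2I" where
  "wderiv j u = (THE w. weak_deriv j u w)"

definition sobolev :: "nat \<Rightarrow> L2I set" where
  "sobolev k = {u. \<forall>j\<le>k. \<exists>w. weak_deriv j u w}"

subsection \<open>Uniqueness of weak derivatives\<close>

definition flatk :: "nat \<Rightarrow> real \<Rightarrow> real" where
  "flatk k s = (if s > 0 then (1 / s) ^ k * exp (- (1 / s)) else 0)"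

lemma flatk_tendsto_0: "(flatk k \<longlongrightarrow> 0) (at_right 0)"
proof -
  have "((\<lambda>x::real. inverse x ^ k / exp (inverse x)) \<longlongrightarrow> 0) (at_right 0)"
    by (rule filterlim_compose[OF tendsto_power_div_exp_0 filterlim_inverse_at_top_right])
  moreover have "\<forall>\<^sub>F x in at_right 0. inverse x ^ k / exp (inverse x) = flatk k x"
    by (auto simp: eventually_at_right_less flatk_def exp_minus field_simps
        intro!: eventually_mono[OF eventually_at_right_less])
  ultimately show ?thesis
    by (rule Lim_transform_eventually)
qed

lemma DERIV_flatk:
  "(flatk k has_real_derivative (flatk (k + 2) s - real k * flatk (Suc k) s)) (at s)"
proof -
  consider "s > 0" | "s < 0" | "s = 0" by linarith
  then show ?thesis
  proof cases
    case 1
    have pow: "(1 / s) ^ (k - 1) * (1 / s)\<^sup>2 * real k = real k * (1 / s) ^ Suc k"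
      by (cases k) (simp_all add: power2_eq_square)
    have D: "((\<lambda>s::real. 1 / s) has_real_derivative - ((1 / s)\<^sup>2)) (at s)"
      using 1 by (auto intro!: derivative_eq_intros simp: power2_eq_square)
    have "((\<lambda>s. (1 / s) ^ k * exp (- (1 / s))) has_real_derivative
        real k * (- ((1 / s)\<^sup>2) * (1 / s) ^ (k - Suc 0)) * exp (- (1 / s))
        + exp (- (1 / s)) * (- (- ((1 / s)\<^sup>2))) * (1 / s) ^ k) (at s)"
      by (intro DERIV_mult DERIV_power DERIV_fun_exp DERIV_minus D)
    also have "real k * (- ((1 / s)\<^sup>2) * (1 / s) ^ (k - Suc 0)) * exp (- (1 / s))
        + exp (- (1 / s)) * (- (- ((1 / s)\<^sup>2))) * (1 / s) ^ k
        = (1 / s) ^ (k + 2) * exp (- (1 / s))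
          - ((1 / s) ^ (k - 1) * (1 / s)\<^sup>2 * real k) * exp (- (1 / s))"
      by (simp only: power_add) (simp add: algebra_simps)
    also have "\<dots> = flatk (k + 2) s - real k * flatk (Suc k) s"
      using 1 by (simp only: pow) (simp add: flatk_def)
    finally have "((\<lambda>s. (1 / s) ^ k * exp (- (1 / s))) has_real_derivative
        (flatk (k + 2) s - real k * flatk (Suc k) s)) (at s)" .
    moreover have "\<forall>\<^sub>F x in nhds s. (1 / x) ^ k * exp (- (1 / x)) = flatk k x"
      using 1 by (auto simp: eventually_nhds flatk_def intro!: exI[of _ "{0<..}"])
    ultimately show ?thesis
      using 1 by (subst DERIV_cong_ev[OF refl _ refl, of _ "\<lambda>s. (1 / s) ^ k * exp (- (1 / s))"])
        (auto elim: eventually_mono)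
  next
    case 2
    have "\<forall>\<^sub>F x in nhds s. flatk k x = 0"
      using 2 by (auto simp: eventually_nhds flatk_def intro!: exI[of _ "{..<0}"])
    then show ?thesis
      using 2 by (subst DERIV_cong_ev[OF refl _ refl, of _ "\<lambda>s. 0"]) (auto simp: flatk_def)
  next
    case 3
    have "((\<lambda>y. flatk k y / y) \<longlongrightarrow> 0) (at_right 0)"
    proof (rule Lim_transform_eventually[OF flatk_tendsto_0[of "Suc k"]])
      show "\<forall>\<^sub>F x in at_right 0. flatk (Suc k) x = flatk k x / x"
        by (auto simp: flatk_def intro!: eventually_mono[OF eventually_at_right_less])
    qed
    moreover have "((\<lambda>y. flatk k y / y) \<longlongrightarrow> 0) (at_left 0)"
      by (rule Lim_transform_eventually[OF tendsto_const])
        (auto simp: flatk_def eventually_at_filter)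
    ultimately have "((\<lambda>y. flatk k y / y) \<longlongrightarrow> 0) (at 0)"
      by (simp add: filterlim_split_at)
    then show ?thesis
      using 3 by (simp add: has_field_derivative_iff flatk_def)
  qed
qed

inductive bump_span :: "real \<Rightarrow> real \<Rightarrow> real \<Rightarrow> (real \<Rightarrow> real) \<Rightarrow> bool" for c a b where
  base: "bump_span c a b (\<lambda>x. flatk k (c * (x - a)) * flatk l (c * (b - x)))"
| add: "bump_span c a b f \<Longrightarrow> bump_span c a b g \<Longrightarrow> bump_span c a b (\<lambda>x. f x + g x)"
| scale: "bump_span c a b f \<Longrightarrow> bump_span c a b (\<lambda>x. r * f x)"

lemma bump_span_deriv:
  "bump_span c a b f \<Longrightarrow> \<exists>f'. bump_span c a b f' \<and> (\<forall>x. (f has_real_derivative f' x) (at x))"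
proof (induction rule: bump_span.induct)
  case (base k l)
  let ?B = "\<lambda>k l x. flatk k (c * (x - a)) * flatk l (c * (b - x))"
  let ?g = "\<lambda>x. (c * ?B (k + 2) l x + (- c * real k) * ?B (Suc k) l x)
      + ((- c) * ?B k (l + 2) x + (c * real l) * ?B k (Suc l) x)"
  have "bump_span c a b ?g"
    by (intro bump_span.intros)
  moreover have "(?B k l has_real_derivative ?g x) (at x)" for x
    by (rule DERIV_cong)
      (auto intro!: derivative_eq_intros DERIV_chain2[OF DERIV_flatk] simp: algebra_simps)
  ultimately show ?case by blast
next
  case (add f g)
  then obtain f' g' where "bump_span c a b f'" "bump_span c a b g'"
    "\<And>x. (f has_real_derivative f' x) (at x)" "\<And>x. (g has_real_derivative g' x) (at x)"
    by blast
  then show ?case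
    by (intro exI[of _ "\<lambda>x. f' x + g' x"]) (auto intro: bump_span.add DERIV_add)
next
  case (scale f r)
  then obtain f' where "bump_span c a b f'" "\<And>x. (f has_real_derivative f' x) (at x)"
    by blast
  then show ?case
    by (intro exI[of _ "\<lambda>x. r * f' x"]) (auto intro: bump_span.scale DERIV_cmult)
qed

lemma bump_span_deriv_funpow:
  assumes "bump_span c a b f" shows "bump_span c a b ((deriv ^^ n) f)"
proof (induction n)
  case (Suc n)
  obtain f' where f': "bump_span c a b f'"
    "\<And>x. ((deriv ^^ n) f has_real_derivative f' x) (at x)"
    using bump_span_deriv[OF Suc] by blast
  then have "deriv ((deriv ^^ n) f) = f'"
    by (intro ext DERIV_imp_deriv)
  with f' show ?case by simp
qed (use assms in simp)

definition bump :: "real \<Rightarrow> real \<Rightarrow> real \<Rightarrow> real \<Rightarrow> real" where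
  "bump c a b x = flatk 0 (c * (x - a)) * flatk 0 (c * (b - x))"

lemma test_fun_bump:
  assumes "0 < c" "0 < a" "b < 1"
  shows "test_fun (bump c a b)"
  unfolding test_fun_def
proof (intro conjI allI exI[of _ "{a..b}"] impI)
  have *: "bump_span c a b (bump c a b)"
    unfolding bump_def by (rule bump_span.base)
  show "(deriv ^^ n) (bump c a b) differentiable at x" for n x
    using bump_span_deriv[OF bump_span_deriv_funpow[OF *, of n]]
    by (auto simp: real_differentiable_def)
  show "bump c a b x = 0" if "x \<notin> {a..b}" for x
    using that assms by (auto simp: bump_def flatk_def zero_less_mult_iff)
qed (use assms in auto)

lemma bump_le_1: "\<bar>bump c a b x\<bar> \<le> 1"
  by (auto simp: bump_def flatk_def abs_mult intro!: mult_le_one)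

lemma bump_tendsto:
  "(\<lambda>n. bump (real (Suc n)) (a + 1 / real (Suc n)) (b - 1 / real (Suc n)) x)
     \<longlonglongrightarrow> indicator {a<..<b} x"
proof -
  have eq: "flatk 0 (real (Suc n) * (d - 1 / real (Suc n))) = flatk 0 (real (Suc n) * d - 1)"
    for d n by (simp add: right_diff_distrib)
  have lim1: "(\<lambda>n. flatk 0 (real (Suc n) * d - 1)) \<longlonglongrightarrow> 1" if "d > 0" for d
  proof -
    have top: "filterlim (\<lambda>n. real (Suc n) * d - 1) at_top sequentially"
    proof -
      have "filterlim (\<lambda>n. real (Suc n) * d) at_top sequentially"
        by (intro filterlim_at_top_mult_tendsto_pos[OF tendsto_const that]
            filterlim_compose[OF filterlim_real_sequentially] filterlim_Suc)
      then have "filterlim (\<lambda>n. -1 + real (Suc n) * d) at_top sequentially"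
        by (rule filterlim_tendsto_add_at_top[OF tendsto_const])
      then show ?thesis by (simp only: diff_conv_add_uminus add.commute)
    qed
    have "((\<lambda>y::real. exp (- inverse y)) \<longlongrightarrow> exp (- 0)) at_top"
      by (intro tendsto_intros tendsto_inverse_0_at_top filterlim_ident)
    then have "((\<lambda>y::real. exp (- (1 / y))) \<longlongrightarrow> 1) at_top"
      by (simp add: inverse_eq_divide)
    from filterlim_compose[OF this top]
    have "(\<lambda>n. exp (- (1 / (real (Suc n) * d - 1)))) \<longlonglongrightarrow> 1" .
    moreover have "\<forall>\<^sub>F n in sequentially.
        exp (- (1 / (real (Suc n) * d - 1))) = flatk 0 (real (Suc n) * d - 1)"
      using top[unfolded filterlim_at_top_dense, rule_format, of 0]
      by (auto simp: flatk_def elim!: eventually_mono)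
    ultimately show ?thesis
      by (rule Lim_transform_eventually)
  qed
  have lim0: "(\<lambda>n. flatk 0 (real (Suc n) * d - 1)) = (\<lambda>n. 0)" if "d \<le> 0" for d
  proof
    fix n
    have "real (Suc n) * d \<le> 0" using that by (simp add: mult_nonneg_nonpos)
    then show "flatk 0 (real (Suc n) * d - 1) = 0" by (simp add: flatk_def)
  qed
  have "bump (real (Suc n)) (a + 1 / real (Suc n)) (b - 1 / real (Suc n)) x
      = flatk 0 (real (Suc n) * (x - a) - 1) * flatk 0 (real (Suc n) * (b - x) - 1)" for n
    using eq[of n "x - a"] eq[of n "b - x"] by (simp add: bump_def algebra_simps)
  moreover have "(\<lambda>n. flatk 0 (real (Suc n) * (x - a) - 1) * flatk 0 (real (Suc n) * (b - x) - 1))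
      \<longlonglongrightarrow> indicator {a<..<b} x"
  proof (cases "a < x \<and> x < b")
    case True
    then show ?thesis
      using tendsto_mult[OF lim1[of "x - a"] lim1[of "b - x"]] by simp
  next
    case False
    then have "x - a \<le> 0 \<or> b - x \<le> 0" by auto
    then have "(\<lambda>n. flatk 0 (real (Suc n) * (x - a) - 1) * flatk 0 (real (Suc n) * (b - x) - 1))
        = (\<lambda>n. 0)"
      using lim0[of "x - a"] lim0[of "b - x"] by (auto simp: fun_eq_iff)
    with False show ?thesis by simp
  qed
  ultimately show ?thesis by simp
qed

lemma borel_measurable_flatk [measurable]: "flatk k \<in> borel_measurable borel"
proof (rule borel_measurable_continuous_onI)
  have "isCont (flatk k) x" for x
    by (rule DERIV_isCont[OF DERIV_flatk])
  then show "continuous_on UNIV (flatk k)"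
    by (simp add: continuous_on_eq_continuous_at)
qed

lemma borel_measurable_bump [measurable]: "bump c a b \<in> borel_measurable borel"
  unfolding bump_def[abs_def] by measurable

lemma du_Bois_Reymond:
  fixes h :: "real \<Rightarrow> complex"
  assumes h: "integrable MI h"
    and orth: "\<And>\<psi>. test_fun \<psi> \<Longrightarrow> (LINT x|MI. h x * of_real (\<psi> x)) = 0"
  shows "AE x in MI. h x = 0"
proof -
  define g where "g x = indicator {0<..<1} x *\<^sub>R h x" for x :: real
  have g: "integrable lborel g"
    using h unfolding g_def MI_def by (subst (asm) integrable_restrict_space) auto
  have [measurable]: "g \<in> borel_measurable borel"
    using borel_measurable_integrable[OF g] by simp
  have gi: "integrable lborel (\<lambda>x. indicator A x *\<^sub>R g x)" if "A \<in> sets borel" for A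
    using that g by (intro integrable_mult_indicator) auto
  have orth': "(LINT x|lborel. g x * of_real (\<psi> x)) = 0" if "test_fun \<psi>" for \<psi>
    using orth[OF that] unfolding g_def MI_def by (subst (asm) integral_restrict_space) auto
  have ivl01: "(LINT x|lborel. indicator {a<..<b} x *\<^sub>R g x) = 0" if "0 \<le> a" "b \<le> 1" for a b
  proof -
    let ?\<psi> = "\<lambda>n. bump (real (Suc n)) (a + 1 / real (Suc n)) (b - 1 / real (Suc n))"
    have "(\<lambda>n. LINT x|lborel. g x * of_real (?\<psi> n x))
        \<longlonglongrightarrow> (LINT x|lborel. g x * of_real (indicator {a<..<b} x))"
    proof (rule integral_dominated_convergence[where w = "\<lambda>x. norm (g x)"])
      show "AE x in lborel. (\<lambda>n. g x * of_real (?\<psi> n x)) \<longlonglongrightarrow> g x * of_real (indicator {a<..<b} x)"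
        by (intro AE_I2 tendsto_mult tendsto_const tendsto_of_real bump_tendsto)
      show "AE x in lborel. norm (g x * of_real (?\<psi> n x)) \<le> norm (g x)" for n
        using bump_le_1 by (auto simp: norm_mult intro!: mult_left_le)
    qed (use g in auto)
    moreover have "(LINT x|lborel. g x * of_real (?\<psi> n x)) = 0" for n
    proof (intro orth' test_fun_bump)
      have "0 < 1 / real (Suc n)" by simp
      then show "0 < a + 1 / real (Suc n)" "b - 1 / real (Suc n) < 1"
        using that by linarith+
    qed simp
    ultimately have "(LINT x|lborel. g x * of_real (indicator {a<..<b} x)) = 0"
      by (simp add: LIMSEQ_const_iff)
    also have "(\<lambda>x. g x * of_real (indicator {a<..<b} x)) = (\<lambda>x. indicator {a<..<b} x *\<^sub>R g x)"
      by (auto simp: fun_eq_iff indicator_def)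
    finally show ?thesis .
  qed
  have ivl: "(LINT x|lborel. indicator {a<..<b} x *\<^sub>R g x) = 0" for a b
  proof -
    have "(\<lambda>x. indicator {a<..<b} x *\<^sub>R g x) = (\<lambda>x. indicator {max a 0<..<min b 1} x *\<^sub>R g x)"
      by (auto simp: fun_eq_iff g_def indicator_def)
    then show ?thesis
      using ivl01[of "max a 0" "min b 1"] by simp
  qed
  have tot: "(LINT x|lborel. g x) = 0"
  proof -
    have "(LINT x|lborel. g x) = (LINT x|lborel. indicator {0<..<1} x *\<^sub>R g x)"
      by (rule Bochner_Integration.integral_cong) (auto simp: g_def indicator_def)
    then show ?thesis
      using ivl01[of 0 1] by simp
  qed
  have "(LINT x|lborel. indicator A x *\<^sub>R g x) = 0" if "A \<in> sets borel" for A
    using that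
  proof (induction rule: borel_set_induct)
    case (interval a b)
    have "(LINT x|lborel. indicator {a..b} x *\<^sub>R g x)
        = (LINT x|lborel. indicator {a<..<b} x *\<^sub>R g x)"
    proof (rule integral_cong_AE)
      show "AE x in lborel. indicator {a..b} x *\<^sub>R g x = indicator {a<..<b} x *\<^sub>R g x"
        using AE_lborel_singleton[of a] AE_lborel_singleton[of b]
        by eventually_elim (auto simp: indicator_def)
    qed measurable
    then show ?case using ivl by simp
  next
    case (compl A)
    have "(LINT x|lborel. indicator (- A) x *\<^sub>R g x)
        = (LINT x|lborel. g x - indicator A x *\<^sub>R g x)"
      by (rule Bochner_Integration.integral_cong) (auto simp: indicator_def)
    also have "\<dots> = (LINT x|lborel. g x) - (LINT x|lborel. indicator A x *\<^sub>R g x)"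
      by (rule Bochner_Integration.integral_diff[OF g gi[OF compl(1)]])
    finally show ?case
      using compl(2) tot by simp
  next
    case (union A)
    have "(\<Union>i. A i) \<in> sets borel" using union(2) by blast
    from gi[OF this] have "(LINT x:(\<Union>i. A i)|lborel. g x) = (\<Sum>i. (LINT x:(A i)|lborel. g x))"
      using union(1,2)
      by (intro lebesgue_integral_countable_add)
        (auto simp: set_integrable_def disjoint_family_on_def)
    then show ?case
      using union(3) by (simp add: set_lebesgue_integral_def)
  qed simp
  then have "AE x in lborel. g x = 0"
    using g by (intro sigma_finite_measure.density_zero[OF lborel.sigma_finite_measure_axioms])
      (auto simp: set_lebesgue_integral_def)
  then show ?thesis
    unfolding MI_def by (subst AE_restrict_space_iff) (auto simp: g_def elim!: AE_mp)
qed

lemma integrable_sq_integrable: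
  assumes "sq_integrable f" shows "integrable MI f"
proof -
  interpret finite_measure MI by (rule finite_measure_MI)
  have "integrable MI (\<lambda>x. norm (f x) * norm (1::complex))"
    by (rule integrable_mult_norms[OF assms]) (simp add: sq_integrable_def)
  then show ?thesis
    using assms by (simp add: sq_integrable_def integrable_norm_iff)
qed

lemma integrable_mult_test:
  assumes "sq_integrable f" "test_fun \<psi>"
  shows "integrable MI (\<lambda>x. f x * of_real ((deriv ^^ j) \<psi> x))"
proof -
  have c: "continuous_on UNIV ((deriv ^^ j) \<psi>)"
    using assms(2) by (auto simp: test_fun_def continuous_on_eq_continuous_at
        intro: differentiable_imp_continuous_within)
  then have "(deriv ^^ j) \<psi> \<in> borel_measurable lborel"
    using borel_measurable_continuous_onI measurable_lborel2 by blast
  then have m: "(deriv ^^ j) \<psi> \<in> borel_measurable MI"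
    unfolding MI_def by (rule measurable_restrict_space1)
  have "compact ((deriv ^^ j) \<psi> ` {0..1})"
    by (intro compact_continuous_image continuous_on_subset[OF c]) auto
  then obtain B where B: "\<And>x. x \<in> {0..1} \<Longrightarrow> norm ((deriv ^^ j) \<psi> x) \<le> B"
    by (meson bounded_iff compact_imp_bounded imageI)
  have f: "integrable MI f" using assms(1) by (rule integrable_sq_integrable)
  show ?thesis
  proof (rule Bochner_Integration.integrable_bound)
    show "integrable MI (\<lambda>x. B * norm (f x))"
      using f by simp
    show "(\<lambda>x. f x * of_real ((deriv ^^ j) \<psi> x)) \<in> borel_measurable MI"
      by (intro borel_measurable_times borel_measurable_integrable[OF f] measurable_compose[OF m]
          borel_measurable_continuous_onI continuous_intros)
    have "norm (f x * of_real ((deriv ^^ j) \<psi> x)) \<le> norm (B * norm (f x))" if "x \<in> {0<..<1}" for x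
    proof -
      have "norm (f x * of_real ((deriv ^^ j) \<psi> x)) \<le> norm (f x) * B"
        using B[of x] that by (auto simp: norm_mult intro!: mult_left_mono)
      also have "\<dots> \<le> norm (B * norm (f x))"
        by (simp add: mult.commute)
      finally show ?thesis .
    qed
    then show "AE x in MI. norm (f x * of_real ((deriv ^^ j) \<psi> x)) \<le> norm (B * norm (f x))"
      by (intro AE_I2) auto
  qed
qed

lemma integral_rep_add:
  assumes "test_fun \<psi>"
  shows "(LINT x|MI. rep_L2 (u + v) x * of_real ((deriv ^^ j) \<psi> x))
    = (LINT x|MI. rep_L2 u x * of_real ((deriv ^^ j) \<psi> x))
      + (LINT x|MI. rep_L2 v x * of_real ((deriv ^^ j) \<psi> x))"
proof -
  note i = integrable_mult_test[OF sq_integrable_rep assms, of _ j]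
  have "(LINT x|MI. rep_L2 (u + v) x * of_real ((deriv ^^ j) \<psi> x))
      = (LINT x|MI. rep_L2 u x * of_real ((deriv ^^ j) \<psi> x) + rep_L2 v x * of_real ((deriv ^^ j) \<psi> x))"
    using rep_add[of u v] borel_measurable_integrable[OF i]
    by (intro integral_cong_AE) (auto elim!: AE_mp simp: algebra_simps)
  then show ?thesis using i by simp
qed

lemma integral_rep_scaleR:
  assumes "test_fun \<psi>"
  shows "(LINT x|MI. rep_L2 (c *\<^sub>R u) x * of_real ((deriv ^^ j) \<psi> x))
    = c *\<^sub>R (LINT x|MI. rep_L2 u x * of_real ((deriv ^^ j) \<psi> x))"
proof -
  note i = integrable_mult_test[OF sq_integrable_rep assms, of _ j]
  have "(LINT x|MI. rep_L2 (c *\<^sub>R u) x * of_real ((deriv ^^ j) \<psi> x))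
      = (LINT x|MI. c *\<^sub>R (rep_L2 u x * of_real ((deriv ^^ j) \<psi> x)))"
    using rep_scaleR[of c u] borel_measurable_integrable[OF i]
    by (intro integral_cong_AE) (auto elim!: AE_mp simp: algebra_simps)
  then show ?thesis by simp
qed

lemma weak_deriv_unique:
  assumes "weak_deriv j u w" "weak_deriv j u w'" shows "w = w'"
proof -
  let ?h = "\<lambda>x. rep_L2 w x - rep_L2 w' x"
  have h: "integrable MI ?h"
    by (intro Bochner_Integration.integrable_diff integrable_sq_integrable) auto
  have "AE x in MI. ?h x = 0"
  proof (rule du_Bois_Reymond[OF h])
    fix \<psi> assume t: "test_fun \<psi>"
    note i = integrable_mult_test[OF sq_integrable_rep t, of _ 0, simplified]
    have "(-1) ^ j * (LINT x|MI. rep_L2 w x * of_real (\<psi> x))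
        = ((-1) ^ j * (LINT x|MI. rep_L2 w' x * of_real (\<psi> x)) :: complex)"
      using assms t by (auto simp: weak_deriv_def)
    then have "(LINT x|MI. rep_L2 w x * of_real (\<psi> x)) = (LINT x|MI. rep_L2 w' x * of_real (\<psi> x))"
      by simp
    then show "(LINT x|MI. ?h x * of_real (\<psi> x)) = 0"
      using i by (simp add: left_diff_distrib)
  qed
  then show ?thesis
    by (subst L2I_eq_iff) simp
qed

lemma wderiv_eq: "weak_deriv j u w \<Longrightarrow> wderiv j u = w"
  unfolding wderiv_def using weak_deriv_unique by blast

lemma weak_deriv_wderiv: "u \<in> sobolev k \<Longrightarrow> j \<le> k \<Longrightarrow> weak_deriv j u (wderiv j u)"
  unfolding sobolev_def using wderiv_eq by fastforce

lemma weak_deriv_add: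
  "weak_deriv j u w \<Longrightarrow> weak_deriv j u' w' \<Longrightarrow> weak_deriv j (u + u') (w + w')"
  unfolding weak_deriv_def
  using integral_rep_add[of _ _ _ j] integral_rep_add[of _ _ _ 0]
  by (simp add: distrib_left)

lemma weak_deriv_scaleR: "weak_deriv j u w \<Longrightarrow> weak_deriv j (c *\<^sub>R u) (c *\<^sub>R w)"
  unfolding weak_deriv_def
  using integral_rep_scaleR[of _ _ _ j] integral_rep_scaleR[of _ _ _ 0]
  by simp

lemma weak_deriv_zero: "weak_deriv j 0 0"
  unfolding weak_deriv_def
  using integral_rep_scaleR[of _ 0 0 j] integral_rep_scaleR[of _ 0 0 0]
  by simp

lemma weak_deriv_0: "weak_deriv 0 u u"
  by (simp add: weak_deriv_def)

lemma wderiv_0 [simp]: "wderiv 0 u = u"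
  by (rule wderiv_eq[OF weak_deriv_0])

lemma sobolev_add: "u \<in> sobolev k \<Longrightarrow> v \<in> sobolev k \<Longrightarrow> u + v \<in> sobolev k"
  unfolding sobolev_def using weak_deriv_add by blast

lemma sobolev_scaleR: "u \<in> sobolev k \<Longrightarrow> c *\<^sub>R u \<in> sobolev k"
  unfolding sobolev_def using weak_deriv_scaleR by blast

lemma sobolev_zero: "0 \<in> sobolev k"
  unfolding sobolev_def using weak_deriv_zero by blast

lemma wderiv_add:
  "u \<in> sobolev k \<Longrightarrow> v \<in> sobolev k \<Longrightarrow> j \<le> k \<Longrightarrow> wderiv j (u + v) = wderiv j u + wderiv j v"
  by (intro wderiv_eq weak_deriv_add weak_deriv_wderiv)

lemma wderiv_scaleR: "u \<in> sobolev k \<Longrightarrow> j \<le> k \<Longrightarrow> wderiv j (c *\<^sub>R u) = c *\<^sub>R wderiv j u"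
  by (intro wderiv_eq weak_deriv_scaleR weak_deriv_wderiv)

subsection \<open>The space \<open>H\<^sup>2(I)\<close>\<close>

typedef H2I = "sobolev 2"
  morphisms of_H2 Abs_H2
  using sobolev_zero by blast

setup_lifting type_definition_H2I

instantiation H2I :: real_normed_vector
begin

lift_definition zero_H2I :: H2I is 0
  by (rule sobolev_zero)

lift_definition plus_H2I :: "H2I \<Rightarrow> H2I \<Rightarrow> H2I" is "(+)"
  by (rule sobolev_add)

lift_definition scaleR_H2I :: "real \<Rightarrow> H2I \<Rightarrow> H2I" is "(*\<^sub>R)"
  by (rule sobolev_scaleR)

lift_definition norm_H2I :: "H2I \<Rightarrow> real" is
  "\<lambda>u. sqrt (\<Sum>j\<le>2. (norm (wderiv j u))\<^sup>2)" .

definition uminus_H2I :: "H2I \<Rightarrow> H2I" where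
  "uminus_H2I u = (-1) *\<^sub>R u"

definition minus_H2I :: "H2I \<Rightarrow> H2I \<Rightarrow> H2I" where
  "minus_H2I u v = u + - v"

definition dist_H2I :: "H2I \<Rightarrow> H2I \<Rightarrow> real" where
  "dist_H2I u v = norm (u - v)"

definition sgn_H2I :: "H2I \<Rightarrow> H2I" where
  "sgn_H2I u = inverse (norm u) *\<^sub>R u"

definition uniformity_H2I :: "(H2I \<times> H2I) filter" where
  "uniformity_H2I = (INF e\<in>{0<..}. principal {(u, v). dist u v < e})"

definition open_H2I :: "H2I set \<Rightarrow> bool" where
  "open_H2I U \<longleftrightarrow> (\<forall>u\<in>U. \<forall>\<^sub>F (u', v) in uniformity. u' = u \<longrightarrow> v \<in> U)"

instance
proof
  fix u v w :: H2I and a b :: real and U :: "H2I set"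
  show "u + v + w = u + (v + w)" by transfer (rule add.assoc)
  show "u + v = v + u" by transfer (rule add.commute)
  show "0 + u = u" by transfer simp
  show "- u + u = 0" unfolding uminus_H2I_def by transfer simp
  show "u - v = u + - v" by (rule minus_H2I_def)
  show "a *\<^sub>R (u + v) = a *\<^sub>R u + a *\<^sub>R v" by transfer (rule scaleR_right_distrib)
  show "(a + b) *\<^sub>R u = a *\<^sub>R u + b *\<^sub>R u" by transfer (rule scaleR_left_distrib)
  show "a *\<^sub>R b *\<^sub>R u = (a * b) *\<^sub>R u" by transfer simp
  show "1 *\<^sub>R u = u" by transfer simp
  show "dist u v = norm (u - v)" by (rule dist_H2I_def)
  show "sgn u = inverse (norm u) *\<^sub>R u" by (rule sgn_H2I_def)
  show "uniformity = (INF e\<in>{0<..}. principal {(u, v::H2I). dist u v < e})"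
    by (rule uniformity_H2I_def)
  show "open U \<longleftrightarrow> (\<forall>u\<in>U. \<forall>\<^sub>F (u', v) in uniformity. u' = u \<longrightarrow> v \<in> U)"
    by (rule open_H2I_def)
  show "norm u = 0 \<longleftrightarrow> u = 0"
  proof (transfer, intro iffI)
    fix u :: L2I
    assume "sqrt (\<Sum>j\<le>2. (norm (wderiv j u))\<^sup>2) = 0"
    then have "\<forall>j\<in>{..2}. (norm (wderiv j u))\<^sup>2 = 0"
      by (subst (asm) real_sqrt_eq_zero_cancel_iff, subst (asm) sum_nonneg_eq_0_iff) auto
    then have "(norm (wderiv 0 u))\<^sup>2 = 0" by blast
    then show "u = 0" by simp
  next
    fix u :: L2I
    assume "u = 0"
    then show "sqrt (\<Sum>j\<le>2. (norm (wderiv j u))\<^sup>2) = 0"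
      by (simp add: wderiv_eq[OF weak_deriv_zero])
  qed
  show "norm (u + v) \<le> norm u + norm v"
  proof transfer
    fix u v :: L2I
    assume uv: "u \<in> sobolev 2" "v \<in> sobolev 2"
    have "L2_set (\<lambda>j. norm (wderiv j (u + v))) {..2}
        \<le> L2_set (\<lambda>j. norm (wderiv j u) + norm (wderiv j v)) {..2}"
      using uv by (intro L2_set_mono) (auto simp: wderiv_add norm_triangle_ineq)
    also have "\<dots> \<le> L2_set (\<lambda>j. norm (wderiv j u)) {..2} + L2_set (\<lambda>j. norm (wderiv j v)) {..2}"
      by (rule L2_set_triangle_ineq)
    finally show "sqrt (\<Sum>j\<le>2. (norm (wderiv j (u + v)))\<^sup>2)
        \<le> sqrt (\<Sum>j\<le>2. (norm (wderiv j u))\<^sup>2) + sqrt (\<Sum>j\<le>2. (norm (wderiv j v))\<^sup>2)"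
      by (simp add: L2_set_def)
  qed
  show "norm (a *\<^sub>R u) = \<bar>a\<bar> * norm u"
  proof transfer
    fix a :: real and u :: L2I
    assume u: "u \<in> sobolev 2"
    have "L2_set (\<lambda>j. norm (wderiv j (a *\<^sub>R u))) {..2} = L2_set (\<lambda>j. \<bar>a\<bar> * norm (wderiv j u)) {..2}"
      using u by (intro L2_set_cong) (auto simp: wderiv_scaleR)
    also have "\<dots> = \<bar>a\<bar> * L2_set (\<lambda>j. norm (wderiv j u)) {..2}"
      by (simp add: L2_set_right_distrib)
    finally show "sqrt (\<Sum>j\<le>2. (norm (wderiv j (a *\<^sub>R u)))\<^sup>2)
        = \<bar>a\<bar> * sqrt (\<Sum>j\<le>2. (norm (wderiv j u))\<^sup>2)"
      by (simp add: L2_set_def)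
  qed
qed

end

section \<open>The generator and its semigroup\<close>

text \<open>The value at \<open>x \<in> [0,1]\<close> of the continuous representative on \<open>[0,1]\<close>; only meaningful for
  classes that have one, in particular for the elements of \<open>H\<^sup>1(I)\<close>.\<close>

definition pt_val :: "L2I \<Rightarrow> real \<Rightarrow> complex" where
  "pt_val v x = (THE c. \<exists>V. continuous_on {0..1} V \<and> toL2 V = v \<and> V x = c)"

lemma sq_integrable_continuous:
  assumes V: "continuous_on {0..1} V" shows "sq_integrable V"
proof -
  have "(\<lambda>x. indicator {0<..<1} x *\<^sub>R V x) \<in> borel_measurable borel"
    by (intro borel_measurable_continuous_on_indicator continuous_on_subset[OF V]) auto
  then have m: "V \<in> borel_measurable MI"
    unfolding MI_def by (subst borel_measurable_restrict_space_iff) auto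
  have "compact (V ` {0..1})"
    by (intro compact_continuous_image V) auto
  then obtain B where B: "\<And>x. x \<in> {0..1} \<Longrightarrow> norm (V x) \<le> B"
    by (meson bounded_iff compact_imp_bounded imageI)
  have "integrable MI (\<lambda>x. (norm (V x))\<^sup>2)"
    using B m
    by (intro finite_measure.integrable_const_bound[OF finite_measure_MI, where B = "B\<^sup>2"])
      (auto intro!: AE_I2 power_mono)
  with m show ?thesis by (simp add: sq_integrable_def)
qed

lemma continuous_toL2_eq:
  assumes V: "continuous_on {0..1} V" and W: "continuous_on {0..1} W"
    and eq: "toL2 V = toL2 W" and x: "x \<in> {0..1}"
  shows "V x = W x"
proof -
  have "AE x in MI. V x = W x"
    using AE_rep_toL2[OF sq_integrable_continuous[OF V]]
      AE_rep_toL2[OF sq_integrable_continuous[OF W]] unfolding eq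
    by eventually_elim simp
  then have ae: "AE x in lborel. x \<in> {0<..<1} \<longrightarrow> V x = W x"
    unfolding MI_def by (subst (asm) AE_restrict_space_iff) auto
  let ?U = "{x \<in> {0<..<1}. V x - W x \<in> - {0}}"
  have c: "continuous_on {0<..<1} (\<lambda>x. V x - W x)"
    by (intro continuous_on_diff continuous_on_subset[OF V] continuous_on_subset[OF W]) auto
  have "open ?U"
    using continuous_on_open_vimage[OF open_greaterThanLessThan, THEN iffD1, OF c, rule_format, of "- {0}"]
    by (simp add: vimage_def Int_def conj_commute open_Compl)
  have "?U = {}"
  proof (rule ccontr)
    assume "?U \<noteq> {}"
    with \<open>open ?U\<close> have *: "\<not> negligible ?U" by (rule open_not_negligible)
    have "?U \<in> sets borel"
      using \<open>open ?U\<close> by (rule borel_open)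
    then have U: "?U \<in> sets lebesgue" by simp
    have "AE x in lebesgue. x \<notin> ?U"
      using AE_completion[OF ae] by eventually_elim auto
    then have "?U \<in> null_sets lebesgue"
      by (rule AE_iff_null_sets[OF U, THEN iffD2])
    then have "negligible ?U" by (rule negligible_iff_null_sets[THEN iffD2])
    with * show False by (rule notE)
  qed
  then have eq01: "V y = W y" if "y \<in> {0<..<1}" for y
    using that by auto
  have cl: "closure {0<..<1} = {0..1::real}" by simp
  have "V x - W x = 0"
  proof (rule continuous_constant_on_closure[of "{0<..<1}" "\<lambda>x. V x - W x" 0 x])
    show "continuous_on (closure {0<..<1}) (\<lambda>x. V x - W x)"
      unfolding cl by (rule continuous_on_diff[OF V W])
    show "V y - W y = 0" if "y \<in> {0<..<1}" for y
      using eq01[OF that] by simp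
    show "x \<in> closure {0<..<1}"
      unfolding cl by (rule x)
  qed
  then show ?thesis by simp
qed

lemma pt_val_toL2: "continuous_on {0..1} V \<Longrightarrow> x \<in> {0..1} \<Longrightarrow> pt_val (toL2 V) x = V x"
  unfolding pt_val_def using continuous_toL2_eq by (intro the_equality) blast+

text \<open>Unbounded operators are represented by their graphs, so that the domain is part of the data.\<close>

definition kawahara_op :: "real \<Rightarrow> (L2I \<times> L2I) set" where
  "kawahara_op \<alpha> = {(v, w). v \<in> sobolev 5 \<and>
     pt_val v 0 = 0 \<and> pt_val v 1 = 0 \<and>
     pt_val (wderiv 1 v) 0 = 0 \<and> pt_val (wderiv 1 v) 1 = 0 \<and>
     pt_val (wderiv 2 v) 1 = of_real \<alpha> * pt_val (wderiv 2 v) 0 \<and>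
     w = - wderiv 3 v + wderiv 5 v}"

text \<open>Operators are indexed by all reals, but only the times \<open>t \<ge> 0\<close> are constrained or used.\<close>

definition C0_contraction_semigroup :: "(real \<Rightarrow> L2I \<Rightarrow> L2I) \<Rightarrow> bool" where
  "C0_contraction_semigroup S \<longleftrightarrow>
     (\<forall>t\<ge>0. (\<forall>v w. S t (v + w) = S t v + S t w) \<and>
        (\<forall>c v. S t (scaleC_L2 c v) = scaleC_L2 c (S t v)) \<and>
        (\<forall>v. norm (S t v) \<le> norm v)) \<and>
     (\<forall>v. S 0 v = v) \<and>
     (\<forall>t\<ge>0. \<forall>s\<ge>0. \<forall>v. S (t + s) v = S t (S s v)) \<and>
     (\<forall>v. ((\<lambda>t. S t v) \<longlongrightarrow> v) (at_right 0))"

definition generator :: "(real \<Rightarrow> L2I \<Rightarrow> L2I) \<Rightarrow> (L2I \<times> L2I) set" where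
  "generator S = {(v, w). ((\<lambda>h. (1 / h) *\<^sub>R (S h v - v)) \<longlongrightarrow> w) (at_right 0)}"

section \<open>Mild solutions\<close>

definition profA :: "real \<Rightarrow> real \<Rightarrow> real" where
  "profA \<alpha> x = (\<alpha> - 1) / (\<alpha> + 1) * x\<^sup>2 + 2 / (\<alpha> + 1) * x - 1"

definition coef_a :: "real \<Rightarrow> (real \<Rightarrow> complex) \<Rightarrow> real \<Rightarrow> real \<Rightarrow> complex" where
  "coef_a \<alpha> \<phi> x t = - of_real (profA \<alpha> x) * \<phi> t"

definition coef_b :: "real \<Rightarrow> (real \<Rightarrow> complex) \<Rightarrow> real \<Rightarrow> real \<Rightarrow> complex" where
  "coef_b \<alpha> \<phi> x t = - of_real (deriv (profA \<alpha>) x) * \<phi> t"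

definition source_f :: "real \<Rightarrow> (real \<Rightarrow> complex) \<Rightarrow> real \<Rightarrow> real \<Rightarrow> complex" where
  "source_f \<alpha> \<phi> x t = of_real (profA \<alpha> x) * vector_derivative \<phi> (at t)
     - of_real (profA \<alpha> x) * of_real (deriv (profA \<alpha>) x) * (\<phi> t)\<^sup>2"

text \<open>The function \<open>y = u + A \<phi>\<close>, as a curve in \<open>L\<^sup>2(I)\<close>.\<close>

definition shifted :: "real \<Rightarrow> (real \<Rightarrow> complex) \<Rightarrow> (real \<Rightarrow>\<^sub>C H2I) \<Rightarrow> real \<Rightarrow> L2I" where
  "shifted \<alpha> \<phi> u t = of_H2 (apply_bcontfun u t) + toL2 (\<lambda>x. of_real (profA \<alpha> x) * \<phi> t)"

definition forcing :: "real \<Rightarrow> (real \<Rightarrow> complex) \<Rightarrow> (real \<Rightarrow> L2I) \<Rightarrow> real \<Rightarrow> L2I" where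
  "forcing \<alpha> \<phi> y s = toL2 (\<lambda>x.
     - (rep_L2 (y s) x * rep_L2 (wderiv 1 (y s)) x)
     - coef_a \<alpha> \<phi> x s * rep_L2 (wderiv 1 (y s)) x
     - coef_b \<alpha> \<phi> x s * rep_L2 (y s) x
     + source_f \<alpha> \<phi> x s)"

text \<open>The integrand is norm-continuous in \<open>s\<close> for \<open>\<phi>\<close> of class \<open>C\<^sup>1\<close>, so the gauge integral
  is the usual Riemann integral of a continuous \<open>L\<^sup>2(I)\<close>-valued function.\<close>

definition mild_solution ::
  "(real \<Rightarrow> L2I \<Rightarrow> L2I) \<Rightarrow> real \<Rightarrow> (real \<Rightarrow> complex) \<Rightarrow> (real \<Rightarrow>\<^sub>C H2I) \<Rightarrow> bool" where
  "mild_solution S \<alpha> \<phi> u \<longleftrightarrow>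
     (let y = shifted \<alpha> \<phi> u in
      \<forall>r t. r \<le> t \<longrightarrow>
        (\<lambda>s. S (t - s) (forcing \<alpha> \<phi> y s)) integrable_on {r..t} \<and>
        y t = S (t - r) (y r) + integral {r..t} (\<lambda>s. S (t - s) (forcing \<alpha> \<phi> y s)))"

text \<open>Extended-real valued, since a \<open>C\<^sup>1\<close> function on the line may be unbounded.\<close>

definition C1_norm :: "(real \<Rightarrow> complex) \<Rightarrow> ereal" where
  "C1_norm \<phi> = (SUP t. ereal (norm (\<phi> t))) + (SUP t. ereal (norm (vector_derivative \<phi> (at t))))"

end

theory Submission
  imports Defs
begin

text \<open>
  Energy estimates with the weight \<open>\<rho>(x) = (1 - \<alpha>\<^sup>2)\<^sup>-\<^sup>1 + x\<close> give
  \<open>d/dt V(w) \<le> - 5 \<parallel>w\<^sub>x\<^sub>x\<parallel>\<^sup>2\<close> for \<open>V(w) = \<integral> \<rho> |w|\<^sup>2\<close> along the semigroup, hence exponential decay.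
  Applied to both \<open>w\<close> and \<open>A w\<close>, with \<open>A\<close> the generator, and combined with the interpolation inequality
  \<open>\<mu>\<^sup>2 \<parallel>A w\<parallel>\<^sup>2 \<le> \<mu>\<^sup>3 \<parallel>(A w)\<^sub>x\<^sub>x\<parallel>\<^sup>2 + C \<parallel>w\<^sub>x\<^sub>x\<parallel>\<^sup>2\<close>, they show that \<open>t\<^sup>3 V(A w) + b V(w)\<close> decreases on
  \<open>[0,1]\<close>, so \<open>\<parallel>A S(t) v\<parallel> \<le> C t\<^sup>-\<^sup>3\<^sup>/\<^sup>2 \<parallel>v\<parallel>\<close>.  Since the dissipation also bounds \<open>\<parallel>w\<^sub>x\<^sub>x\<parallel>\<^sup>2\<close> by
  \<open>C \<parallel>A w\<parallel> \<parallel>w\<parallel>\<close>, the norm of \<open>S(t)\<close> from \<open>L\<^sup>2(I)\<close> to \<open>H\<^sup>2(I)\<close> is \<open>O(t\<^sup>-\<^sup>3\<^sup>/\<^sup>4)\<close>, which is integrable, and the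
  bounded solutions of the integral equation on the whole line are exactly the fixed points of
  \<open>y \<mapsto> \<integral>\<^sub>0\<^sup>\<infinity> S(\<sigma>) F(y)(t - \<sigma>) d\<sigma>\<close>.  For small data this map is a contraction.
\<close>

section \<open>The space \<open>L\<^sup>2(I)\<close>\<close>

text \<open>The space X asks for an H^2 bound on y(t) at every time, while the energy identity
  controls y_xx only in L^2 over time; hence the need for a smoothing estimate that is pointwise in
  time and has an integrable singularity. No analyticity of the semigroup is assumed. What replaces
  it is that A w is itself a third derivative: with H = w_xx - w it equals H_xxx. The interpolation
  used for H is cruder than scaling allows, but any exponent below 1 would do in place of 3/4.

  The weight acts through its slope: without it the two dispersive terms contribute boundary values
  only. Its constant part K is tuned to the condition u_xx(1) = \<alpha> u_xx(0): the boundary form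
  is (K + 1) \<alpha>^2 - K, which for K = 1/(1 - \<alpha>^2) equals \<alpha>^2 - 1.

  All integrations by parts are classical. This costs one more step in the domain of the generator,
  for w and for A w, so the estimates are proved on the domain of A^3 and extended by
  density.\<close>

lemma rep_L2_measurable [measurable]: "rep_L2 u \<in> borel_measurable MI"
  using sq_integrable_rep[of u] unfolding sq_integrable_def by blast

lemma integrable_rep_sq: "integrable MI (\<lambda>x. (norm (rep_L2 u x))\<^sup>2)"
  using sq_integrable_rep[of u] unfolding sq_integrable_def by blast

lemma norm_L2I_eq: "norm u = L2_norm_fun (rep_L2 u)"
  by (simp add: norm_L2I_def)

lemma norm_L2I_sq: "(norm u)\<^sup>2 = (LINT x|MI. (norm (rep_L2 u x))\<^sup>2)"
  by (simp add: norm_L2I_eq L2_norm_fun_def)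

lemma toL2_eq_iff:
  assumes "sq_integrable f"
  shows "toL2 f = u \<longleftrightarrow> (AE x in MI. rep_L2 u x = f x)"
  unfolding L2I_eq_iff using AE_rep_toL2[OF assms] by (auto elim: AE_mp)

lemma toL2_cong_AE:
  assumes "sq_integrable f" "sq_integrable g" "AE x in MI. f x = g x"
  shows "toL2 f = toL2 g"
  unfolding toL2_eq_iff[OF assms(1)] using AE_rep_toL2[OF assms(2)] assms(3)
  by (auto elim: AE_mp)

text \<open>No integrability is assumed: \<open>sq_integrable\<close> only sees values in (0,1), and
  where it fails \<open>toL2\<close> takes its default value 0 on both sides.\<close>

lemma toL2_cong: "(\<And>x. 0 < x \<Longrightarrow> x < 1 \<Longrightarrow> f x = g x) \<Longrightarrow> toL2 f = toL2 g"
proof -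
  assume eq: "\<And>x. 0 < x \<Longrightarrow> x < 1 \<Longrightarrow> f x = g x"
  have "f \<in> borel_measurable MI \<longleftrightarrow> g \<in> borel_measurable MI"
    by (intro measurable_cong) (auto simp: eq)
  moreover have "integrable MI (\<lambda>x. (norm (f x))\<^sup>2) \<longleftrightarrow> integrable MI (\<lambda>x. (norm (g x))\<^sup>2)"
    by (intro Bochner_Integration.integrable_cong) (auto simp: eq)
  ultimately have "sq_integrable f \<longleftrightarrow> sq_integrable g"
    by (simp add: sq_integrable_def)
  then show ?thesis
    by (cases "sq_integrable f") (auto simp: toL2_def eq intro!: toL2_cong_AE[unfolded toL2_def, of f g, simplified])
qed

lemma norm_toL2: "sq_integrable f \<Longrightarrow> norm (toL2 f) = L2_norm_fun f"
  unfolding norm_L2I_eq using AE_rep_toL2[of f]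
  by (intro L2_norm_fun_cong) (simp add: L2_eq_def)

lemma toL2_add:
  assumes "sq_integrable f" "sq_integrable g"
  shows "toL2 (\<lambda>x. f x + g x) = toL2 f + toL2 g"
  unfolding toL2_eq_iff[OF sq_integrable_add[OF assms]]
  using rep_add[of "toL2 f" "toL2 g"] AE_rep_toL2[OF assms(1)] AE_rep_toL2[OF assms(2)]
  by eventually_elim simp

lemma toL2_scaleR:
  assumes "sq_integrable f"
  shows "toL2 (\<lambda>x. c *\<^sub>R f x) = c *\<^sub>R toL2 f"
  unfolding toL2_eq_iff[OF sq_integrable_scaleR[OF assms]]
  using rep_scaleR[of c "toL2 f"] AE_rep_toL2[OF assms]
  by eventually_elim simp

lemma toL2_uminus: "sq_integrable f \<Longrightarrow> toL2 (\<lambda>x. - f x) = - toL2 f"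
  using toL2_scaleR[of f "-1"] by simp

lemma sq_integrable_diff:
  "sq_integrable f \<Longrightarrow> sq_integrable g \<Longrightarrow> sq_integrable (\<lambda>x. f x - g x)"
  using sq_integrable_add[of f "\<lambda>x. - g x"] sq_integrable_uminus[of g] by simp

lemma toL2_diff:
  assumes "sq_integrable f" "sq_integrable g"
  shows "toL2 (\<lambda>x. f x - g x) = toL2 f - toL2 g"
  using toL2_add[OF assms(1) sq_integrable_uminus[OF assms(2)]] toL2_uminus[OF assms(2)] by simp

lemma scaleC_eq_toL2: "scaleC_L2 c u = toL2 (\<lambda>x. c * rep_L2 u x)"
  unfolding scaleC_L2_def by (simp add: toL2_def sq_integrable_cmult)

lemma toL2_cmult:
  assumes "sq_integrable f"
  shows "toL2 (\<lambda>x. c * f x) = scaleC_L2 c (toL2 f)"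
  unfolding scaleC_eq_toL2
  by (intro toL2_cong_AE sq_integrable_cmult assms sq_integrable_rep)
    (use AE_rep_toL2[OF assms] in eventually_elim, simp)

lemma scaleC_of_real: "scaleC_L2 (of_real c) u = c *\<^sub>R u"
proof -
  have "scaleC_L2 (of_real c) u = toL2 (\<lambda>x. c *\<^sub>R rep_L2 u x)"
    unfolding scaleC_eq_toL2 by (simp add: scaleR_conv_of_real)
  then show ?thesis by (simp add: toL2_scaleR)
qed

lemma sq_integrable_bound:
  assumes "f \<in> borel_measurable MI" "sq_integrable g" "AE x in MI. norm (f x) \<le> norm (g x)"
  shows "sq_integrable f"
  unfolding sq_integrable_def
proof
  show "integrable MI (\<lambda>x. (norm (f x))\<^sup>2)"
    by (rule Bochner_Integration.integrable_bound[where f = "\<lambda>x. (norm (g x))\<^sup>2"])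
      (use assms in \<open>auto simp: sq_integrable_def power_mono elim!: AE_mp\<close>)
qed (use assms in auto)

lemma L2_norm_fun_mono:
  assumes "sq_integrable f" "sq_integrable g" "AE x in MI. norm (f x) \<le> norm (g x)"
  shows "L2_norm_fun f \<le> L2_norm_fun g"
  unfolding L2_norm_fun_def using assms
  by (intro real_sqrt_le_mono integral_mono_AE)
    (auto simp: sq_integrable_def power_mono elim!: AE_mp)

lemma L2_norm_fun_cmult: "L2_norm_fun (\<lambda>x. c * f x) = norm c * L2_norm_fun f"
  by (simp add: L2_norm_fun_def norm_mult power_mult_distrib real_sqrt_mult)

lemma norm_scaleC_L2: "norm (scaleC_L2 c u) = norm c * norm u"
  unfolding scaleC_eq_toL2
  by (simp add: norm_toL2 sq_integrable_cmult L2_norm_fun_cmult flip: norm_L2I_eq)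

lemma sq_integrable_mult_bounded:
  assumes "f \<in> borel_measurable MI" "sq_integrable g" "AE x in MI. norm (f x) \<le> M"
  shows "sq_integrable (\<lambda>x. f x * g x)"
proof (rule sq_integrable_bound)
  have [measurable]: "g \<in> borel_measurable MI" using assms(2) by (simp add: sq_integrable_def)
  show "(\<lambda>x. f x * g x) \<in> borel_measurable MI" using assms(1) by measurable
  show "sq_integrable (\<lambda>x. of_real M * g x)" by (intro sq_integrable_cmult assms)
  show "AE x in MI. norm (f x * g x) \<le> norm (of_real M * g x)"
    using assms(3) by eventually_elim (auto simp: norm_mult intro!: mult_right_mono)
qed

lemma norm_toL2_mult_bounded:
  assumes "f \<in> borel_measurable MI" "sq_integrable g" "AE x in MI. norm (f x) \<le> M" "0 \<le> M"
  shows "norm (toL2 (\<lambda>x. f x * g x)) \<le> M * norm (toL2 g)"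
proof -
  have "L2_norm_fun (\<lambda>x. f x * g x) \<le> L2_norm_fun (\<lambda>x. of_real M * g x)"
  proof (rule L2_norm_fun_mono)
    show "AE x in MI. norm (f x * g x) \<le> norm (of_real M * g x)"
      using assms(3) by eventually_elim (use assms(4) in \<open>auto simp: norm_mult intro!: mult_right_mono\<close>)
  qed (use assms in \<open>auto intro: sq_integrable_mult_bounded sq_integrable_cmult\<close>)
  then show ?thesis
    using assms by (simp add: norm_toL2 sq_integrable_mult_bounded L2_norm_fun_cmult)
qed

text \<open>Cauchy-Schwarz against the constant 1, since the interval has measure 1.\<close>

lemma LINT_norm_le:
  assumes "sq_integrable f"
  shows "(LINT x|MI. norm (f x)) \<le> L2_norm_fun f"
proof -
  interpret finite_measure MI by (rule finite_measure_MI)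
  have 1: "sq_integrable (\<lambda>x. 1)" by (simp add: sq_integrable_def)
  have "measure MI (space MI) = 1"
    by (simp add: MI_def space_restrict_space measure_restrict_space)
  then have "L2_norm_fun (\<lambda>x. 1) = 1" by (simp add: L2_norm_fun_def)
  then show ?thesis using L2_cauchy_schwarz[OF assms 1] by simp
qed

text \<open>Riesz-Fischer: a Cauchy sequence in L^2 is Cauchy in L^1, so a subsequence converges
  almost everywhere, and Fatou's lemma turns the pointwise limit into an L^2 limit of the whole
  sequence.\<close>

instance L2I :: banach
proof
  fix X :: "nat \<Rightarrow> L2I" assume X: "Cauchy X"
  let ?s = "\<lambda>n. rep_L2 (X n)"
  have int: "integrable MI (?s n)" for n by (simp add: integrable_sq_integrable)
  have "\<exists>N. \<forall>i\<ge>N. \<forall>j\<ge>N. (LINT x|MI. norm (?s i x - ?s j x)) < e" if "e > 0" for e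
  proof -
    obtain N where N: "\<And>i j. i \<ge> N \<Longrightarrow> j \<ge> N \<Longrightarrow> norm (X i - X j) < e"
      using X \<open>e > 0\<close> unfolding Cauchy_iff by blast
    have "(LINT x|MI. norm (?s i x - ?s j x)) \<le> norm (X i - X j)" for i j
    proof -
      have *: "sq_integrable (\<lambda>x. ?s i x - ?s j x)" by (intro sq_integrable_diff) auto
      have "norm (X i - X j) = L2_norm_fun (\<lambda>x. ?s i x - ?s j x)"
        using toL2_diff[of "?s i" "?s j"] norm_toL2[OF *] by simp
      then show ?thesis using LINT_norm_le[OF *] by simp
    qed
    with N show ?thesis by (meson order.strict_trans1)
  qed
  then obtain r where r: "strict_mono r" and ae: "AE x in MI. Cauchy (\<lambda>i. ?s (r i) x)"
    using cauchy_L1_AE_cauchy_subseq[of MI ?s] int by blast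
  define f where "f x = lim (\<lambda>i. ?s (r i) x)" for x
  have lim: "AE x in MI. (\<lambda>i. ?s (r i) x) \<longlonglongrightarrow> f x"
    using ae unfolding f_def by eventually_elim (simp add: Cauchy_convergent_iff convergent_LIMSEQ_iff)
  have fm [measurable]: "f \<in> borel_measurable MI" unfolding f_def by measurable
  \<comment> \<open>Fatou along the subsequence: the Cauchy bound for \<open>X (r i) - X m\<close>
    survives the limit in \<open>i\<close>.\<close>
  have key: "(\<integral>\<^sup>+x. ennreal ((norm (f x - ?s m x))\<^sup>2) \<partial>MI) \<le> ennreal (e\<^sup>2)"
    if N: "\<And>i j. i \<ge> N \<Longrightarrow> j \<ge> N \<Longrightarrow> norm (X i - X j) < e" and m: "m \<ge> N" and e: "e > 0" for N m e
  proof -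
    have "(\<integral>\<^sup>+x. ennreal ((norm (f x - ?s m x))\<^sup>2) \<partial>MI)
        = (\<integral>\<^sup>+x. liminf (\<lambda>i. ennreal ((norm (?s (r i) x - ?s m x))\<^sup>2)) \<partial>MI)"
    proof (rule nn_integral_cong_AE, use lim in eventually_elim)
      fix x assume "(\<lambda>i. ?s (r i) x) \<longlonglongrightarrow> f x"
      then have "(\<lambda>i. ennreal ((norm (?s (r i) x - ?s m x))\<^sup>2)) \<longlonglongrightarrow> ennreal ((norm (f x - ?s m x))\<^sup>2)"
        by (intro tendsto_intros tendsto_ennrealI)
      then show "ennreal ((norm (f x - ?s m x))\<^sup>2) = liminf (\<lambda>i. ennreal ((norm (?s (r i) x - ?s m x))\<^sup>2))"
        by (metis lim_imp_Liminf sequentially_bot)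
    qed
    also have "\<dots> \<le> liminf (\<lambda>i. \<integral>\<^sup>+x. ennreal ((norm (?s (r i) x - ?s m x))\<^sup>2) \<partial>MI)"
      by (rule nn_integral_liminf) measurable
    also have "\<dots> \<le> ennreal (e\<^sup>2)"
    proof (rule Liminf_le)
      show "\<forall>\<^sub>F i in sequentially. (\<integral>\<^sup>+x. ennreal ((norm (?s (r i) x - ?s m x))\<^sup>2) \<partial>MI) \<le> ennreal (e\<^sup>2)"
        using eventually_ge_at_top[of N]
      proof eventually_elim
        case (elim i)
        then have "norm (X (r i) - X m) < e"
          using N[of "r i" m] m seq_suble[OF r, of i] by auto
        moreover have "(\<integral>\<^sup>+x. ennreal ((norm (?s (r i) x - ?s m x))\<^sup>2) \<partial>MI) = ennreal ((norm (X (r i) - X m))\<^sup>2)"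
        proof -
          have *: "sq_integrable (\<lambda>x. ?s (r i) x - ?s m x)" by (intro sq_integrable_diff) auto
          have "norm (X (r i) - X m) = L2_norm_fun (\<lambda>x. ?s (r i) x - ?s m x)"
            using toL2_diff[of "?s (r i)" "?s m"] norm_toL2[OF *] by simp
          then show ?thesis
            using * by (subst nn_integral_eq_integral) (auto simp: sq_integrable_def L2_norm_fun_def)
        qed
        ultimately show ?case
          by (auto intro!: ennreal_leI power_mono)
      qed
    qed (rule sequentially_bot)
    finally show ?thesis .
  qed
  obtain N1 where N1: "\<And>i j. i \<ge> N1 \<Longrightarrow> j \<ge> N1 \<Longrightarrow> norm (X i - X j) < 1"
    using X unfolding Cauchy_iff using zero_less_one by blast
  have sqd: "sq_integrable (\<lambda>x. f x - ?s m x)" if "m \<ge> N1" for m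
    unfolding sq_integrable_def
  proof
    show "integrable MI (\<lambda>x. (norm (f x - ?s m x))\<^sup>2)"
      using key[OF N1 that zero_less_one] by (intro integrableI_bounded) (auto intro: le_less_trans)
  qed measurable
  have sqf: "sq_integrable f"
    using sq_integrable_add[OF sqd[OF order_refl] sq_integrable_rep[of "X N1"]] by simp
  have "X \<longlonglongrightarrow> toL2 f"
  proof (rule LIMSEQ_I)
    fix e :: real assume e: "e > 0"
    then obtain N where N: "\<And>i j. i \<ge> N \<Longrightarrow> j \<ge> N \<Longrightarrow> norm (X i - X j) < e/2"
      using X unfolding Cauchy_iff by (meson half_gt_zero)
    have "norm (X m - toL2 f) < e" if m: "m \<ge> N" for m
    proof -
      have d: "sq_integrable (\<lambda>x. f x - ?s m x)" using sqf by (intro sq_integrable_diff) auto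
      have "(\<integral>\<^sup>+x. ennreal ((norm (f x - ?s m x))\<^sup>2) \<partial>MI) \<le> ennreal ((e/2)\<^sup>2)"
        using e by (intro key[of N "e/2" m] N m) auto
      then have "ennreal (LINT x|MI. (norm (f x - ?s m x))\<^sup>2) \<le> ennreal ((e/2)\<^sup>2)"
        using d by (subst (asm) nn_integral_eq_integral) (auto simp: sq_integrable_def)
      then have "(LINT x|MI. (norm (f x - ?s m x))\<^sup>2) \<le> (e/2)\<^sup>2"
        by (subst (asm) ennreal_le_iff) auto
      then have "L2_norm_fun (\<lambda>x. f x - ?s m x) \<le> e/2"
        unfolding L2_norm_fun_def using e by (intro real_le_lsqrt) auto
      moreover have "norm (X m - toL2 f) = L2_norm_fun (\<lambda>x. f x - ?s m x)"
        using toL2_diff[OF sqf, of "?s m"] norm_toL2[OF d] by (simp add: norm_minus_commute)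
      ultimately show ?thesis using e by simp
    qed
    then show "\<exists>no. \<forall>n\<ge>no. norm (X n - toL2 f) < e" by blast
  qed
  then show "convergent X" by (auto simp: convergent_def)
qed

text \<open>The quadratic form of this real bilinear form is the functional V of the overview, for
  \<open>K = weight\<close>. Bilinearity is what allows V to be differentiated along orbits.\<close>

definition weighted_inner :: "real \<Rightarrow> L2I \<Rightarrow> L2I \<Rightarrow> real" where
  "weighted_inner K u v = (LINT x|MI. (K + x) * (rep_L2 u x \<bullet> rep_L2 v x))"

lemma weighted_inner_integrable:
  assumes f: "sq_integrable f" and g: "sq_integrable g"
  shows "integrable MI (\<lambda>x. (K + x) * (f x \<bullet> g x))"
proof (rule Bochner_Integration.integrable_bound)
  have [measurable]: "f \<in> borel_measurable MI" "g \<in> borel_measurable MI"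
    using assms by (auto simp: sq_integrable_def)
  show "integrable MI (\<lambda>x. (\<bar>K\<bar> + 1) * (norm (f x) * norm (g x)))"
    by (intro integrable_mult_right integrable_mult_norms f g)
  have [measurable]: "(\<lambda>x. x) \<in> borel_measurable MI" unfolding MI_def by (intro measurable_restrict_space1) auto
  show "(\<lambda>x. (K + x) * (f x \<bullet> g x)) \<in> borel_measurable MI" by measurable
  have "\<bar>(K + x) * (f x \<bullet> g x)\<bar> \<le> (\<bar>K\<bar> + 1) * (norm (f x) * norm (g x))" if "x \<in> {0<..<1}" for x
    using that Cauchy_Schwarz_ineq2[of "f x" "g x"] unfolding abs_mult
    by (intro mult_mono) auto
  then show "AE x in MI. norm ((K + x) * (f x \<bullet> g x)) \<le> norm ((\<bar>K\<bar> + 1) * (norm (f x) * norm (g x)))"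
    by (intro AE_I2) auto
qed

lemma weighted_inner_toL2:
  assumes f: "sq_integrable f" and g: "sq_integrable g"
  shows "weighted_inner K (toL2 f) (toL2 g) = (LINT x|MI. (K + x) * (f x \<bullet> g x))"
  unfolding weighted_inner_def
  by (intro integral_cong_AE borel_measurable_integrable weighted_inner_integrable sq_integrable_rep f g)
    (use AE_rep_toL2[OF f] AE_rep_toL2[OF g] in eventually_elim, simp)

lemma weighted_inner_commute: "weighted_inner K u v = weighted_inner K v u"
  by (simp add: weighted_inner_def inner_commute)

lemma weighted_inner_bound: "\<bar>weighted_inner K u v\<bar> \<le> (\<bar>K\<bar> + 1) * (norm u * norm v)"
proof -
  have "\<bar>weighted_inner K u v\<bar> \<le> (LINT x|MI. norm ((K + x) * (rep_L2 u x \<bullet> rep_L2 v x)))"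
    unfolding weighted_inner_def real_norm_def[symmetric] by (rule integral_norm_bound)
  also have "\<dots> \<le> (LINT x|MI. (\<bar>K\<bar> + 1) * (norm (rep_L2 u x) * norm (rep_L2 v x)))"
  proof (intro integral_mono integrable_norm weighted_inner_integrable integrable_mult_right integrable_mult_norms)
    fix x assume "x \<in> space MI"
    then show "norm ((K + x) * (rep_L2 u x \<bullet> rep_L2 v x)) \<le> (\<bar>K\<bar> + 1) * (norm (rep_L2 u x) * norm (rep_L2 v x))"
      unfolding real_norm_def abs_mult using Cauchy_Schwarz_ineq2
      by (intro mult_mono) auto
  qed auto
  also have "\<dots> \<le> (\<bar>K\<bar> + 1) * (norm u * norm v)"
    using L2_cauchy_schwarz[of "rep_L2 u" "rep_L2 v"]
    by (simp add: norm_L2I_eq mult_left_mono)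
  finally show ?thesis .
qed

lemma weighted_inner_add: "weighted_inner K (u + u') v = weighted_inner K u v + weighted_inner K u' v"
proof -
  have "u + u' = toL2 (\<lambda>x. rep_L2 u x + rep_L2 u' x)" by (simp add: toL2_add)
  then have "weighted_inner K (u + u') v = weighted_inner K (toL2 (\<lambda>x. rep_L2 u x + rep_L2 u' x)) (toL2 (rep_L2 v))" by simp
  also have "\<dots> = weighted_inner K u v + weighted_inner K u' v"
    by (subst weighted_inner_toL2) (auto simp: sq_integrable_add inner_add_left distrib_left weighted_inner_def weighted_inner_integrable)
  finally show ?thesis .
qed

lemma weighted_inner_scaleR: "weighted_inner K (c *\<^sub>R u) v = c * weighted_inner K u v"
proof -
  have "c *\<^sub>R u = toL2 (\<lambda>x. c *\<^sub>R rep_L2 u x)" by (simp add: toL2_scaleR)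
  then have "weighted_inner K (c *\<^sub>R u) v = weighted_inner K (toL2 (\<lambda>x. c *\<^sub>R rep_L2 u x)) (toL2 (rep_L2 v))" by simp
  also have "\<dots> = c * weighted_inner K u v"
    by (subst weighted_inner_toL2) (auto simp: sq_integrable_scaleR inner_scaleR_left mult.left_commute weighted_inner_def simp del: scaleR_conv_of_real)
  finally show ?thesis .
qed

lemma bounded_bilinear_weighted_inner: "bounded_bilinear (weighted_inner K)"
proof
  show "\<exists>C. \<forall>u v. norm (weighted_inner K u v) \<le> norm u * norm v * C"
    using weighted_inner_bound[of K] by (intro exI[of _ "\<bar>K\<bar> + 1"]) (auto simp: mult_ac)
  show "weighted_inner K u (v + v') = weighted_inner K u v + weighted_inner K u v'" for u v v'
    using weighted_inner_add[of K v v' u] by (simp only: weighted_inner_commute[of K u])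
  show "weighted_inner K u (c *\<^sub>R v) = c *\<^sub>R weighted_inner K u v" for u v c
    using weighted_inner_scaleR[of K c v u] by (simp add: weighted_inner_commute[of K u])
qed (simp_all add: weighted_inner_add weighted_inner_scaleR)

lemma weighted_inner_ge: "0 \<le> K \<Longrightarrow> K * (norm u)\<^sup>2 \<le> weighted_inner K u u"
proof -
  assume "0 \<le> K"
  have "K * (norm u)\<^sup>2 = (LINT x|MI. K * (norm (rep_L2 u x))\<^sup>2)"
    by (simp add: norm_L2I_sq)
  also have "\<dots> \<le> weighted_inner K u u"
    unfolding weighted_inner_def
    by (intro integral_mono weighted_inner_integrable integrable_mult_right integrable_rep_sq sq_integrable_rep)
      (auto simp: power2_norm_eq_inner intro!: mult_right_mono)
  finally show ?thesis .
qed

lemma weighted_inner_le: "0 \<le> K \<Longrightarrow> weighted_inner K u u \<le> (K + 1) * (norm u)\<^sup>2"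
  using weighted_inner_bound[of K u u] by (simp add: power2_eq_square)

section \<open>Weak derivatives in one dimension\<close>

lemmas hk_integral_add = Henstock_Kurzweil_Integration.integral_add
  and hk_integral_diff = Henstock_Kurzweil_Integration.integral_diff
  and hk_integral_cong = Henstock_Kurzweil_Integration.integral_cong
  and hk_integral_combine = Henstock_Kurzweil_Integration.integral_combine

section \<open>Lebesgue and gauge integrals on the interval, and primitives\<close>

lemma LINT_MI_eq_integral:
  fixes f :: "real \<Rightarrow> 'a::euclidean_space"
  assumes "continuous_on {0..1} f"
  shows "(LINT x|MI. f x) = integral {0..1} f" "integrable MI f"
proof -
  have i: "set_integrable lborel {0..1} f"
    using borel_integrable_compact[OF _ assms] unfolding set_integrable_def by auto
  have i': "set_integrable lborel {0<..<1} f"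
    by (rule set_integrable_subset[OF i]) auto
  then show "integrable MI f"
    unfolding MI_def set_integrable_def by (subst integrable_restrict_space) auto
  have "(LINT x|MI. f x) = (LINT x:{0<..<1}|lborel. f x)"
    unfolding MI_def set_lebesgue_integral_def by (subst integral_restrict_space) auto
  also have "\<dots> = integral {0<..<1} f"
    by (rule set_borel_integral_eq_integral[OF i'])
  also have "\<dots> = integral {0..1} f"
    using integral_open_interval[of 0 1 f] by (simp add: box_real)
  finally show "(LINT x|MI. f x) = integral {0..1} f" .
qed

text \<open>Extension by zero to the line. It discards the arbitrary values of the representative
  outside (0,1), so that primitives can be taken over any interval.\<close>

definition ext0 :: "L2I \<Rightarrow> real \<Rightarrow> complex" where
  "ext0 w y = indicator {0<..<1} y *\<^sub>R rep_L2 w y"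

lemma integrable_ext0: "integrable lborel (ext0 w)"
  using integrable_sq_integrable[OF sq_integrable_rep, of w]
  unfolding ext0_def[abs_def] MI_def by (subst (asm) integrable_restrict_space) auto

lemma ext0_integrable_on: "ext0 w integrable_on {a..b}"
  using integrable_on_subinterval[OF integrable_on_lborel[OF integrable_ext0]] by simp

lemma LINT_ext0: "(LINT x|lborel. f (ext0 w x) x) = (LINT x|MI. f (rep_L2 w x) x)"
  if "\<And>x. f 0 x = 0" for f :: "complex \<Rightarrow> real \<Rightarrow> 'a::euclidean_space"
  unfolding MI_def
  by (subst integral_restrict_space)
    (auto simp: ext0_def indicator_def that intro!: Bochner_Integration.integral_cong)

lemma continuous_on_primitive: "continuous_on {a..b} (\<lambda>x. integral {a..x} (ext0 w))"
  by (intro indefinite_integral_continuous_1 ext0_integrable_on)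

lemma norm_integral_ext0_le: "norm (integral {a..b} (ext0 w)) \<le> norm w"
proof -
  have i: "set_integrable lborel {a..b} (ext0 w)"
    unfolding set_integrable_def using integrable_ext0 by (intro integrable_mult_indicator) auto
  have "norm (integral {a..b} (ext0 w)) = norm (LINT x:{a..b}|lborel. ext0 w x)"
    by (simp add: set_borel_integral_eq_integral[OF i])
  also have "\<dots> \<le> (LINT x|lborel. norm (indicator {a..b} x *\<^sub>R ext0 w x))"
    unfolding set_lebesgue_integral_def by (rule integral_norm_bound)
  also have "\<dots> \<le> (LINT x|lborel. norm (ext0 w x))"
    using i integrable_ext0[of w] unfolding set_integrable_def
    by (intro integral_mono integrable_norm) (auto simp: indicator_def)
  also have "\<dots> \<le> norm w"
    using LINT_ext0[of "\<lambda>y x. norm y" w] LINT_norm_le[of "rep_L2 w"] by (simp add: norm_L2I_eq)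
  finally show ?thesis .
qed

section \<open>Calculus of test functions\<close>

lemma test_funE:
  assumes "test_fun \<psi>"
  obtains a b where "0 < a" "a < b" "b < 1" "\<And>x. x \<notin> {a..b} \<Longrightarrow> \<psi> x = 0"
proof -
  obtain K where K: "compact K" "K \<subseteq> {0<..<1}" "\<And>x. x \<notin> K \<Longrightarrow> \<psi> x = 0"
    using assms unfolding test_fun_def by blast
  show ?thesis
  proof (cases "K = {}")
    case True
    then show ?thesis using K by (intro that[of "1/3" "2/3"]) auto
  next
    case False
    obtain l where l: "l \<in> K" "\<And>x. x \<in> K \<Longrightarrow> l \<le> x"
      using compact_attains_inf[OF K(1) False] by blast
    obtain u where u: "u \<in> K" "\<And>x. x \<in> K \<Longrightarrow> x \<le> u"
      using compact_attains_sup[OF K(1) False] by blast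
    have "0 < l" "u < 1" "l \<le> u" using K(2) l u by auto
    then show ?thesis
    \<comment> \<open>The support may be a single point, so its right end is moved half way towards
      1 to obtain a strict inequality.\<close>
    proof (intro that[of l "(u + 1) / 2"])
      show "\<psi> x = 0" if "x \<notin> {l..(u + 1) / 2}" for x
        using that K(3)[of x] l(2)[of x] u(2)[of x] \<open>u < 1\<close> by fastforce
    qed auto
  qed
qed

lemma test_fun_derivs:
  assumes "test_fun \<psi>"
  shows "((deriv ^^ n) \<psi> has_real_derivative (deriv ^^ Suc n) \<psi> x) (at x)"
  using assms DERIV_deriv_iff_real_differentiable[of "(deriv ^^ n) \<psi>" x]
  by (simp add: test_fun_def)

lemma test_funI:
  assumes "\<And>n x. (deriv ^^ n) \<psi> differentiable at x" "0 < a" "b < 1" "\<And>x. x \<notin> {a..b} \<Longrightarrow> \<psi> x = 0"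
  shows "test_fun \<psi>"
  unfolding test_fun_def using assms by (intro conjI exI[of _ "{a..b}"]) auto

lemma continuous_on_test_fun: "test_fun \<psi> \<Longrightarrow> continuous_on A ((deriv ^^ n) \<psi>)"
  by (intro continuous_at_imp_continuous_on ballI DERIV_isCont[OF test_fun_derivs])

lemma test_fun_deriv:
  assumes \<psi>: "test_fun \<psi>"
  shows "test_fun (deriv \<psi>)"
proof -
  obtain a b where ab: "0 < a" "a < b" "b < 1" "\<And>x. x \<notin> {a..b} \<Longrightarrow> \<psi> x = 0"
    using test_funE[OF \<psi>] by metis
  show ?thesis
  proof (rule test_funI[OF _ ab(1,3)])
    show "(deriv ^^ n) (deriv \<psi>) differentiable at x" for n x
      using \<psi> unfolding test_fun_def by (metis funpow_Suc_right o_apply)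
    fix x assume x: "x \<notin> {a..b}"
    have "\<forall>\<^sub>F y in nhds x. \<psi> y = 0"
      using x ab(4) by (auto simp: eventually_nhds intro!: exI[of _ "- {a..b}"])
    then have "(\<psi> has_real_derivative 0) (at x)"
      by (subst DERIV_cong_ev[OF refl _ refl, of _ "\<lambda>_. 0"]) auto
    then show "deriv \<psi> x = 0" by (rule DERIV_imp_deriv)
  qed
qed

lemma test_fun_lincomb:
  assumes \<psi>: "test_fun \<psi>" and \<phi>: "test_fun \<phi>"
  shows "test_fun (\<lambda>x. \<psi> x + c * \<phi> x)"
proof -
  obtain a b where ab: "0 < a" "a < b" "b < 1" "\<And>x. x \<notin> {a..b} \<Longrightarrow> \<psi> x = 0"
    using test_funE[OF \<psi>] by metis
  obtain a' b' where ab': "0 < a'" "a' < b'" "b' < 1" "\<And>x. x \<notin> {a'..b'} \<Longrightarrow> \<phi> x = 0"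
    using test_funE[OF \<phi>] by metis
  have D: "((\<lambda>x. (deriv ^^ n) \<psi> x + c * (deriv ^^ n) \<phi> x) has_real_derivative
      (deriv ^^ Suc n) \<psi> x + c * (deriv ^^ Suc n) \<phi> x) (at x)" for n x
    by (intro DERIV_add DERIV_cmult test_fun_derivs \<psi> \<phi>)
  have eq: "(deriv ^^ n) (\<lambda>x. \<psi> x + c * \<phi> x) = (\<lambda>x. (deriv ^^ n) \<psi> x + c * (deriv ^^ n) \<phi> x)" for n
  proof (induction n)
    case (Suc n)
    have "(deriv ^^ Suc n) (\<lambda>x. \<psi> x + c * \<phi> x) = deriv (\<lambda>x. (deriv ^^ n) \<psi> x + c * (deriv ^^ n) \<phi> x)"
      by (simp add: Suc)
    also have "\<dots> = (\<lambda>x. (deriv ^^ Suc n) \<psi> x + c * (deriv ^^ Suc n) \<phi> x)"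
      by (intro ext DERIV_imp_deriv D)
    finally show ?case .
  qed simp
  show ?thesis
  proof (rule test_funI[of _ "min a a'" "max b b'"])
    show "(deriv ^^ n) (\<lambda>x. \<psi> x + c * \<phi> x) differentiable at x" for n x
      unfolding eq using D real_differentiable_def by blast
    show "\<psi> x + c * \<phi> x = 0" if "x \<notin> {min a a'..max b b'}" for x
    proof -
      have "x \<notin> {a..b}" "x \<notin> {a'..b'}" using that by auto
      then show ?thesis using ab(4) ab'(4) by simp
    qed
  qed (use ab(1-3) ab'(1-3) in auto)
qed

text \<open>A primitive that vanishes to the left of the support is constant to the right of it, and
  the vanishing mean makes this constant 0.\<close>

lemma test_fun_antiderivative:
  assumes \<eta>: "test_fun \<eta>" and int0: "integral {0..1} \<eta> = 0"
  obtains \<theta> where "test_fun \<theta>" "deriv \<theta> = \<eta>"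
proof -
  obtain a b where ab: "0 < a" "a < b" "b < 1" "\<And>x. x \<notin> {a..b} \<Longrightarrow> \<eta> x = 0"
    using test_funE[OF \<eta>] by metis
  \<comment> \<open>The base point -1 lies strictly to the left of the support, so every point from
    \<open>a\<close> on is interior to an interval starting there and the derivative is
    two-sided.\<close>
  define \<theta> where "\<theta> x = integral {-1..x} \<eta>" for x
  have cont: "continuous_on A \<eta>" for A
    using continuous_on_test_fun[OF \<eta>, of A 0] by simp
  have neg: "\<theta> x = 0" if "x < a" for x
  proof -
    have "\<theta> x = integral {-1..x} (\<lambda>_. 0)"
      unfolding \<theta>_def using that ab(4) by (intro integral_cong) auto
    then show ?thesis by simp
  qed
  have D: "(\<theta> has_real_derivative \<eta> x) (at x)" for x
  proof (cases "x < a")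
    case True
    have "\<forall>\<^sub>F y in nhds x. \<theta> y = 0"
      using True neg by (auto simp: eventually_nhds intro!: exI[of _ "{..<a}"])
    then have "(\<theta> has_real_derivative 0) (at x)"
      by (subst DERIV_cong_ev[OF refl _ refl, of _ "\<lambda>_. 0"]) auto
    then show ?thesis using True ab(4)[of x] by simp
  next
    case False
    then have "(\<theta> has_real_derivative \<eta> x) (at x within {-1..x+1})"
      unfolding \<theta>_def using ab(1) by (intro integral_has_real_derivative cont) auto
    then show ?thesis
      using False ab(1) by (subst (asm) at_within_Icc_at) auto
  qed
  have \<theta>1: "\<theta> 1 = 0"
  proof -
    have "\<theta> 1 = integral {-1..0} \<eta> + integral {0..1} \<eta>"
      unfolding \<theta>_def
      by (intro hk_integral_combine[symmetric] integrable_continuous_real cont) auto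
    then show ?thesis using int0 neg[of 0] ab(1) by (simp add: \<theta>_def)
  qed
  have "(\<theta> has_real_derivative 0) (at x within {b<..})" if "x \<in> {b<..}" for x
    using has_field_derivative_at_within[OF D[of x], of "{b<..}"] ab(4)[of x] that by simp
  from has_field_derivative_zero_constant[OF convex_real_interval(3) this]
  obtain c where c: "\<And>x. b < x \<Longrightarrow> \<theta> x = c"
    by auto
  have pos: "\<theta> x = 0" if "x > b" for x
    using c[OF that] c[OF ab(3)] \<theta>1 by simp
  have d: "deriv \<theta> = \<eta>" by (intro ext DERIV_imp_deriv D)
  have "test_fun \<theta>"
  proof (rule test_funI[OF _ ab(1,3)])
    show "(deriv ^^ n) \<theta> differentiable at x" for n x
    proof (cases n)
      case 0
      then show ?thesis using D real_differentiable_def by auto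
    next
      case (Suc m)
      then have "(deriv ^^ n) \<theta> = (deriv ^^ m) \<eta>"
        by (simp only: funpow_Suc_right o_apply d)
      then show ?thesis using \<eta> by (simp add: test_fun_def)
    qed
  qed (use neg pos in auto)
  with d that show ?thesis by blast
qed

lemma LINT_test_fun:
  assumes "test_fun \<psi>"
  shows "(LINT x|MI. \<psi> x) = integral {0..1} \<psi>" "integrable MI \<psi>"
  using LINT_MI_eq_integral[of \<psi>] continuous_on_test_fun[OF assms, of "{0..1}" 0] by auto

text \<open>Subtracting from a test function a multiple of a fixed one with nonzero mean leaves mean
  zero, hence a derivative of a test function, which \<open>h\<close> annihilates. So
  \<open>h\<close> acts on test functions as a constant.\<close>

lemma weak_constancy:
  fixes h :: "real \<Rightarrow> complex"
  assumes h: "sq_integrable h"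
    and orth: "\<And>\<psi>. test_fun \<psi> \<Longrightarrow> (LINT x|MI. h x * of_real (deriv \<psi> x)) = 0"
  obtains c where "AE x in MI. h x = c"
proof -
  \<comment> \<open>If all means vanished, \<open>du_Bois_Reymond\<close> applied to the constant 1
    would give 1 = 0 almost everywhere.\<close>
  have "\<exists>\<psi>. test_fun \<psi> \<and> (LINT x|MI. \<psi> x) \<noteq> 0"
  proof (rule ccontr)
    assume neg: "\<nexists>\<psi>. test_fun \<psi> \<and> (LINT x|MI. \<psi> x) \<noteq> 0"
    have "AE x in MI. (1::complex) = 0"
    proof (rule du_Bois_Reymond)
      show "integrable MI (\<lambda>x. 1::complex)"
        by (intro finite_measure.integrable_const finite_measure_MI)
      show "(LINT x|MI. 1 * complex_of_real (\<psi> x)) = 0" if "test_fun \<psi>" for \<psi>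
        using neg that by simp
    qed
    then obtain N where "{x \<in> space MI. (1::complex) \<noteq> 0} \<subseteq> N" "N \<in> sets MI" "emeasure MI N = 0"
      by (rule AE_E)
    then have "space MI \<subseteq> N" "N \<in> sets MI" "emeasure MI N = 0"
      by auto
    then have "emeasure MI (space MI) = 0"
      by (metis emeasure_mono le_zero_eq)
    then show False
      by (simp add: MI_def emeasure_restrict_space space_restrict_space)
  qed
  then obtain \<psi>0 where \<psi>0: "test_fun \<psi>0" "(LINT x|MI. \<psi>0 x) \<noteq> 0" by blast
  note i = integrable_mult_test[OF h, of _ 0, simplified]
  define m where "m = (LINT x|MI. \<psi>0 x)"
  define c where "c = (LINT x|MI. h x * of_real (\<psi>0 x)) / of_real m"
  have m: "m \<noteq> 0" using \<psi>0 by (simp add: m_def)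
  have fin: "integrable MI (\<lambda>x. c)" by (intro finite_measure.integrable_const finite_measure_MI)
  have "AE x in MI. h x - c = 0"
  proof (rule du_Bois_Reymond)
    show "integrable MI (\<lambda>x. h x - c)"
      by (intro Bochner_Integration.integrable_diff integrable_sq_integrable h fin)
    fix \<psi> assume \<psi>: "test_fun \<psi>"
    define k where "k = (LINT x|MI. \<psi> x) / m"
    let ?\<eta> = "\<lambda>x. \<psi> x + (- k) * \<psi>0 x"
    have \<eta>: "test_fun ?\<eta>" by (intro test_fun_lincomb \<psi> \<psi>0)
    have "(LINT x|MI. ?\<eta> x) = (LINT x|MI. \<psi> x) - k * m"
      using LINT_test_fun(2)[OF \<psi>] LINT_test_fun(2)[OF \<psi>0(1)] by (simp add: m_def)
    also have "\<dots> = 0" using m by (simp add: k_def)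
    finally have "integral {0..1} ?\<eta> = 0" using LINT_test_fun(1)[OF \<eta>] by (rule back_subst[of "\<lambda>t. t = 0"])
    then obtain \<theta> where \<theta>: "test_fun \<theta>" "deriv \<theta> = ?\<eta>"
      using test_fun_antiderivative[OF \<eta>] by blast
    have "0 = (LINT x|MI. h x * of_real (?\<eta> x))"
      using orth[OF \<theta>(1)] by (simp add: \<theta>(2))
    also have "\<dots> = (LINT x|MI. h x * of_real (\<psi> x) - of_real k * (h x * of_real (\<psi>0 x)))"
      by (intro Bochner_Integration.integral_cong) (auto simp: algebra_simps)
    also have "\<dots> = (LINT x|MI. h x * of_real (\<psi> x)) - of_real k * (LINT x|MI. h x * of_real (\<psi>0 x))"
      using i[OF \<psi>] i[OF \<psi>0(1)] by simp
    also have "of_real k * (LINT x|MI. h x * of_real (\<psi>0 x)) = c * of_real (LINT x|MI. \<psi> x)"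
      using m by (simp add: c_def k_def)
    also have "\<dots> = (LINT x|MI. c * of_real (\<psi> x))"
      by simp
    finally have "(LINT x|MI. h x * of_real (\<psi> x)) - (LINT x|MI. c * of_real (\<psi> x)) = 0" by simp
    then show "(LINT x|MI. (h x - c) * of_real (\<psi> x)) = 0"
      using i[OF \<psi>] LINT_test_fun(2)[OF \<psi>]
      by (simp add: left_diff_distrib)
  qed
  then show ?thesis using that[of c] by simp
qed

text \<open>Fubini on the triangle y <= x: for fixed \<open>y\<close> the integral of \<psi>' over
  [y,1] is -\<psi>(y), since \<psi> vanishes at 1.\<close>

lemma LINT_primitive_deriv:
  assumes \<psi>: "test_fun \<psi>"
  shows "(LINT x|MI. integral {0..x} (ext0 w) * of_real (deriv \<psi> x))
    = - (LINT x|MI. rep_L2 w x * of_real (\<psi> x))"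
proof -
  obtain a b where ab: "0 < a" "a < b" "b < 1" "\<And>x. x \<notin> {a..b} \<Longrightarrow> \<psi> x = 0"
    using test_funE[OF \<psi>] by metis
  have D: "(\<psi> has_real_derivative deriv \<psi> x) (at x)" for x
    using test_fun_derivs[OF \<psi>, of 0] by simp
  have cont: "continuous_on A (deriv \<psi>)" for A
    using continuous_on_test_fun[OF \<psi>, of A 1] by simp
  have [measurable]: "deriv \<psi> \<in> borel_measurable borel"
    by (rule borel_measurable_continuous_onI[OF cont])
  have [measurable]: "ext0 w \<in> borel_measurable borel"
    using borel_measurable_integrable[OF integrable_ext0[of w]] by simp
  define h where "h x = complex_of_real (indicator {0..1} x * deriv \<psi> x)" for x
  have h: "integrable lborel h"
  proof -
    have "integrable lborel (\<lambda>x. indicator {0..1} x *\<^sub>R deriv \<psi> x)"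
      by (rule borel_integrable_compact[OF _ cont]) auto
    then show ?thesis unfolding h_def real_scaleR_def by (rule integrable_of_real)
  qed
  have [measurable]: "h \<in> borel_measurable borel"
    using borel_measurable_integrable[OF h] by simp
  \<comment> \<open>The double integrand on the triangle. It is dominated by the product of
    \<open>h x\<close> and \<open>ext0 w y\<close>, which gives the integrability that Fubini
    requires.\<close>
  define F where "F x y = indicator {0..x} y *\<^sub>R ext0 w y * h x" for x y :: real
  have Fm [measurable]: "case_prod F \<in> borel_measurable (lborel \<Otimes>\<^sub>M lborel)"
  proof -
    have "case_prod F = (\<lambda>(x, y). (if 0 \<le> y \<and> y \<le> x then ext0 w y * h x else 0))"
      by (auto simp: F_def indicator_def fun_eq_iff)
    then show ?thesis by simp
  qed
  have prod: "integrable (lborel \<Otimes>\<^sub>M lborel) (\<lambda>(x, y). h x * ext0 w y)"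
  proof (rule lborel_pair.Fubini_integrable)
    show "integrable lborel (\<lambda>x. LINT y|lborel. norm (case (x, y) of (x, y) \<Rightarrow> h x * ext0 w y))"
      using h integrable_ext0[of w] by (simp add: norm_mult)
    show "AE x in lborel. integrable lborel (\<lambda>y. case (x, y) of (x, y) \<Rightarrow> h x * ext0 w y)"
      using integrable_ext0[of w] by simp
  qed measurable
  have F: "integrable (lborel \<Otimes>\<^sub>M lborel) (case_prod F)"
    by (rule Bochner_Integration.integrable_bound[OF prod])
      (auto simp: F_def indicator_def norm_mult)
  have 1: "(LINT y|lborel. F x y) = integral {0..x} (ext0 w) * h x" for x
  proof -
    have i: "set_integrable lborel {0..x} (ext0 w)"
      unfolding set_integrable_def using integrable_ext0 by (intro integrable_mult_indicator) auto
    have "(LINT y|lborel. F x y) = (LINT y:{0..x}|lborel. ext0 w y) * h x"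
      unfolding F_def set_lebesgue_integral_def
      by (rule Bochner_Integration.integral_mult_left) (use i in \<open>auto simp: set_integrable_def\<close>)
    then show ?thesis by (simp add: set_borel_integral_eq_integral[OF i])
  qed
  have 2: "(LINT x|lborel. F x y) = - (ext0 w y * of_real (\<psi> y))" for y
  proof (cases "y \<in> {0<..<1}")
    case True
    have "(LINT x|lborel. F x y) = (LINT x|lborel. ext0 w y * (indicator {y..1} x *\<^sub>R complex_of_real (deriv \<psi> x)))"
      using True by (intro Bochner_Integration.integral_cong) (auto simp: F_def h_def indicator_def)
    also have "\<dots> = ext0 w y * (LINT x|lborel. indicator {y..1} x *\<^sub>R complex_of_real (deriv \<psi> x))"
      by (rule integral_mult_right_zero)
    also have "(LINT x|lborel. indicator {y..1} x *\<^sub>R complex_of_real (deriv \<psi> x)) = of_real (\<psi> 1) - of_real (\<psi> y)"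
    proof (rule integral_FTC_Icc)
      show "((\<lambda>x. complex_of_real (\<psi> x)) has_vector_derivative complex_of_real (deriv \<psi> x)) (at x within {y..1})" for x
        using D[of x] by (rule has_vector_derivative_at_within[OF has_vector_derivative_of_real])
    qed (use True in \<open>auto intro!: continuous_intros cont\<close>)
    finally show ?thesis using ab by simp
  next
    case False
    then have "ext0 w y = 0" by (simp add: ext0_def)
    then show ?thesis by (simp add: F_def)
  qed
  have "(LINT x|MI. integral {0..x} (ext0 w) * of_real (deriv \<psi> x))
      = (LINT x|lborel. indicator {0<..<1} x *\<^sub>R (integral {0..x} (ext0 w) * of_real (deriv \<psi> x)))"
    unfolding MI_def by (subst integral_restrict_space) auto
  also have "\<dots> = (LINT x|lborel. integral {0..x} (ext0 w) * h x)"
  proof (rule integral_cong_AE)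
    have m: "(\<lambda>x. integral {0..x} (ext0 w) * h x) \<in> borel_measurable lborel"
      unfolding 1[symmetric] by measurable
    then show "(\<lambda>x. integral {0..x} (ext0 w) * h x) \<in> borel_measurable lborel" .
    have "(\<lambda>x. indicator {0<..<1} x *\<^sub>R (integral {0..x} (ext0 w) * of_real (deriv \<psi> x)))
        = (\<lambda>x. indicator {0<..<1} x *\<^sub>R (integral {0..x} (ext0 w) * h x))"
      by (auto simp: fun_eq_iff h_def indicator_def)
    then show "(\<lambda>x. indicator {0<..<1} x *\<^sub>R (integral {0..x} (ext0 w) * of_real (deriv \<psi> x))) \<in> borel_measurable lborel"
      using m by simp
    show "AE x in lborel. indicator {0<..<1} x *\<^sub>R (integral {0..x} (ext0 w) * of_real (deriv \<psi> x)) = integral {0..x} (ext0 w) * h x"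
      using AE_lborel_singleton[of 0] AE_lborel_singleton[of 1]
      by eventually_elim (auto simp: h_def indicator_def)
  qed
  also have "\<dots> = (LINT x|lborel. LINT y|lborel. F x y)" by (simp add: 1)
  also have "\<dots> = (LINT y|lborel. LINT x|lborel. F x y)"
    by (rule lborel_pair.Fubini_integral[symmetric, OF F])
  also have "\<dots> = - (LINT y|lborel. ext0 w y * of_real (\<psi> y))" by (simp add: 2)
  also have "(LINT y|lborel. ext0 w y * of_real (\<psi> y)) = (LINT y|MI. rep_L2 w y * of_real (\<psi> y))"
    by (rule LINT_ext0) simp
  finally show ?thesis .
qed

text \<open>The difference of \<open>u\<close> and the primitive of \<open>w\<close> is orthogonal
  to all derivatives of test functions, so \<open>weak_constancy\<close> applies. This is how weak
  derivatives are turned into classical objects throughout.\<close>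

lemma weak_deriv_1_primitive:
  assumes "weak_deriv 1 u w"
  obtains c where "u = toL2 (\<lambda>x. c + integral {0..x} (ext0 w))"
proof -
  let ?W = "\<lambda>x. integral {0..x} (ext0 w)"
  have W: "sq_integrable ?W" by (intro sq_integrable_continuous continuous_on_primitive)
  have sq: "sq_integrable (\<lambda>x. rep_L2 u x - ?W x)" by (intro sq_integrable_diff W) simp
  obtain c where c: "AE x in MI. rep_L2 u x - ?W x = c"
  proof (rule weak_constancy[OF sq])
    fix \<psi> assume \<psi>: "test_fun \<psi>"
    have "(LINT x|MI. (rep_L2 u x - ?W x) * of_real (deriv \<psi> x))
        = (LINT x|MI. rep_L2 u x * of_real (deriv \<psi> x)) - (LINT x|MI. ?W x * of_real (deriv \<psi> x))"
      using integrable_mult_test[OF sq_integrable_rep \<psi>, of u 1] integrable_mult_test[OF W \<psi>, of 1]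
      by (simp add: left_diff_distrib)
    also have "\<dots> = 0"
      using assms \<psi> LINT_primitive_deriv[OF \<psi>, of w] by (simp add: weak_deriv_def)
    finally show "(LINT x|MI. (rep_L2 u x - ?W x) * of_real (deriv \<psi> x)) = 0" .
  qed blast
  have "sq_integrable (\<lambda>x. c + ?W x)"
    by (intro sq_integrable_continuous continuous_intros continuous_on_primitive)
  then have "toL2 (\<lambda>x. c + ?W x) = u"
    by (subst toL2_eq_iff) (use c in \<open>auto elim!: AE_mp simp: algebra_simps\<close>)
  then show ?thesis using that by blast
qed

lemma weak_deriv_1_continuous:
  assumes "weak_deriv 1 u w"
  obtains U where "continuous_on {0..1} U" "u = toL2 U"
proof -
  obtain c where "u = toL2 (\<lambda>x. c + integral {0..x} (ext0 w))"
    using weak_deriv_1_primitive[OF assms] by blast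
  then show ?thesis
    by (rule that[rotated]) (intro continuous_intros continuous_on_primitive)
qed

text \<open>With a continuous derivative the representative of \<open>weak_deriv_1_primitive\<close>
  is a primitive in the classical sense. This is the step of the bootstrap in
  \<open>C5_rep_exists\<close>.\<close>

lemma weak_deriv_1_C1:
  assumes w: "weak_deriv 1 u (toL2 g)" and g: "continuous_on {0..1} g"
  obtains U where "u = toL2 U"
    "\<And>x. x \<in> {0..1} \<Longrightarrow> (U has_vector_derivative g x) (at x within {0..1})"
proof -
  obtain c where c: "u = toL2 (\<lambda>x. c + integral {0..x} (ext0 (toL2 g)))"
    using weak_deriv_1_primitive[OF w] by blast
  have eq: "integral {0..x} (ext0 (toL2 g)) = integral {0..x} g" if "0 < x" "x < 1" for x
  proof -
    have "AE y in MI. rep_L2 (toL2 g) y = g y"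
      by (intro AE_rep_toL2 sq_integrable_continuous g)
    then have ae: "AE y in lborel. y \<in> {0<..<1} \<longrightarrow> rep_L2 (toL2 g) y = g y"
      unfolding MI_def by (subst (asm) AE_restrict_space_iff) auto
    have i: "set_integrable lborel {0..x} (ext0 (toL2 g))"
      unfolding set_integrable_def using integrable_ext0 by (intro integrable_mult_indicator) auto
    have i': "set_integrable lborel {0..x} g"
      using borel_integrable_compact[of "{0..x}" g] continuous_on_subset[OF g, of "{0..x}"] that
      unfolding set_integrable_def by auto
    have "integral {0..x} (ext0 (toL2 g)) = (LINT y:{0..x}|lborel. ext0 (toL2 g) y)"
      by (simp add: set_borel_integral_eq_integral[OF i])
    also have "\<dots> = (LINT y:{0..x}|lborel. g y)"
      unfolding set_lebesgue_integral_def
    proof (rule integral_cong_AE)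
      show "AE y in lborel. indicator {0..x} y *\<^sub>R ext0 (toL2 g) y = indicator {0..x} y *\<^sub>R g y"
        using ae AE_lborel_singleton[of 0] AE_lborel_singleton[of 1]
        by eventually_elim (use that in \<open>auto simp: ext0_def indicator_def\<close>)
    qed (use i i' in \<open>auto simp: set_integrable_def\<close>)
    also have "\<dots> = integral {0..x} g"
      by (rule set_borel_integral_eq_integral[OF i'])
    finally show ?thesis .
  qed
  show ?thesis
  proof (rule that[of "\<lambda>x. c + integral {0..x} g"])
    show "u = toL2 (\<lambda>x. c + integral {0..x} g)"
      unfolding c by (rule toL2_cong) (simp add: eq)
    show "((\<lambda>x. c + integral {0..x} g) has_vector_derivative g x) (at x within {0..1})"
      if "x \<in> {0..1}" for x
      using has_vector_derivative_add[OF has_vector_derivative_const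
          integral_has_vector_derivative[OF g that], of c] by simp
  qed
qed

text \<open>The relation of order \<open>j\<close> is tested against \<psi>', the one of order
  \<open>j + 1\<close> against \<psi>; the left-hand sides agree.\<close>

lemma weak_deriv_shift:
  assumes "weak_deriv j u v" "weak_deriv (Suc j) u w"
  shows "weak_deriv 1 v w"
  unfolding weak_deriv_def
proof (intro allI impI)
  fix \<psi> assume \<psi>: "test_fun \<psi>"
  have "(LINT x|MI. rep_L2 u x * of_real ((deriv ^^ j) (deriv \<psi>) x))
      = (-1) ^ j * (LINT x|MI. rep_L2 v x * of_real (deriv \<psi> x))"
    using assms(1) test_fun_deriv[OF \<psi>] by (simp add: weak_deriv_def)
  moreover have "(LINT x|MI. rep_L2 u x * of_real ((deriv ^^ Suc j) \<psi> x))
      = (-1) ^ Suc j * (LINT x|MI. rep_L2 w x * of_real (\<psi> x))"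
    using assms(2) \<psi> unfolding weak_deriv_def by blast
  moreover have "(deriv ^^ Suc j) \<psi> = (deriv ^^ j) (deriv \<psi>)"
    by (simp add: funpow_swap1)
  ultimately have "(-1) ^ j * (LINT x|MI. rep_L2 v x * of_real (deriv \<psi> x))
      = (-1) ^ j * - (LINT x|MI. rep_L2 w x * of_real (\<psi> x))" by simp
  then have "(LINT x|MI. rep_L2 v x * of_real (deriv \<psi> x)) = - (LINT x|MI. rep_L2 w x * of_real (\<psi> x))"
    by (subst (asm) mult_cancel_left) simp
  then show "(LINT x|MI. rep_L2 v x * of_real ((deriv ^^ 1) \<psi> x))
      = (-1) ^ 1 * (LINT x|MI. rep_L2 w x * of_real (\<psi> x))"
    by simp
qed

lemma weak_deriv_1_wderiv:
  "u \<in> sobolev k \<Longrightarrow> j < k \<Longrightarrow> weak_deriv 1 (wderiv j u) (wderiv (Suc j) u)"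
  by (rule weak_deriv_shift[of j u]) (auto intro: weak_deriv_wderiv)

lemma sobolev_mono: "u \<in> sobolev k \<Longrightarrow> j \<le> k \<Longrightarrow> u \<in> sobolev j"
  by (auto simp: sobolev_def)

text \<open>A continuous representative oscillates by at most the \<open>L\<^sup>1\<close> norm of the derivative around
  its mean value.\<close>

lemma sobolev_1_bound:
  assumes "weak_deriv 1 u w"
  shows "AE x in MI. norm (rep_L2 u x) \<le> norm u + norm w"
proof -
  interpret finite_measure MI by (rule finite_measure_MI)
  obtain c where c: "u = toL2 (\<lambda>x. c + integral {0..x} (ext0 w))"
    using weak_deriv_1_primitive[OF assms] by blast
  let ?U = "\<lambda>x. c + integral {0..x} (ext0 w)"
  have U: "sq_integrable ?U"
    by (intro sq_integrable_continuous continuous_intros continuous_on_primitive)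
  have osc: "norm (?U x) \<le> norm (?U y) + norm w" if "0 \<le> x" "0 \<le> y" for x y
  proof -
    have "norm (?U x - ?U y) \<le> norm w" if "0 \<le> y" "y \<le> x" for x y
    proof -
      have "integral {0..x} (ext0 w) = integral {0..y} (ext0 w) + integral {y..x} (ext0 w)"
        using that by (intro hk_integral_combine[symmetric] ext0_integrable_on)
      then show ?thesis using norm_integral_ext0_le[of y x w] by simp
    qed
    from this[of x y] this[of y x] that have "norm (?U x - ?U y) \<le> norm w"
      by (cases "x \<le> y") (auto simp: norm_minus_commute)
    then show ?thesis by (smt (verit) norm_triangle_ineq2)
  qed
  have one: "measure MI (space MI) = 1"
    by (simp add: MI_def space_restrict_space measure_restrict_space)
  have bd: "norm (?U x) \<le> norm u + norm w" if "x \<in> {0<..<1}" for x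
  proof -
    have "norm (?U x) = (LINT y|MI. norm (?U x))" using one by simp
    also have "\<dots> \<le> (LINT y|MI. norm (?U y) + norm w)"
      using that osc[of x]
      by (intro integral_mono Bochner_Integration.integrable_add integrable_norm
          integrable_sq_integrable[OF U] integrable_const) auto
    also have "\<dots> = (LINT y|MI. norm (?U y)) + norm w"
      using integrable_sq_integrable[OF U] one by simp
    also have "\<dots> \<le> norm u + norm w"
      using LINT_norm_le[OF U] norm_toL2[OF U] by (simp add: c)
    finally show ?thesis .
  qed
  have "AE x in MI. rep_L2 u x = ?U x" using AE_rep_toL2[OF U] by (simp add: c)
  moreover have "AE x in MI. x \<in> {0<..<1}" using AE_space[of MI] by simp
  ultimately show ?thesis by eventually_elim (simp only: bd)
qed

lemma bounded_linear_pairing: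
  assumes "test_fun \<psi>"
  shows "bounded_linear (\<lambda>u. LINT x|MI. rep_L2 u x * of_real ((deriv ^^ j) \<psi> x))"
proof (rule bounded_linear_intro)
  have sq: "sq_integrable (\<lambda>x. complex_of_real ((deriv ^^ j) \<psi> x))"
    by (intro sq_integrable_continuous continuous_intros continuous_on_test_fun assms)
  show "norm (LINT x|MI. rep_L2 u x * of_real ((deriv ^^ j) \<psi> x))
      \<le> norm u * L2_norm_fun (\<lambda>x. complex_of_real ((deriv ^^ j) \<psi> x))" for u
  proof -
    have "norm (LINT x|MI. rep_L2 u x * of_real ((deriv ^^ j) \<psi> x))
        \<le> (LINT x|MI. norm (rep_L2 u x * of_real ((deriv ^^ j) \<psi> x)))"
      by (rule integral_norm_bound)
    also have "\<dots> = (LINT x|MI. norm (rep_L2 u x) * norm (complex_of_real ((deriv ^^ j) \<psi> x)))"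
      by (simp add: norm_mult)
    also have "\<dots> \<le> norm u * L2_norm_fun (\<lambda>x. complex_of_real ((deriv ^^ j) \<psi> x))"
      unfolding norm_L2I_eq by (rule L2_cauchy_schwarz[OF sq_integrable_rep sq])
    finally show ?thesis .
  qed
qed (use integral_rep_add[OF assms] integral_rep_scaleR[OF assms] in auto)

text \<open>For a fixed test function both sides of the defining identity are continuous in the L^2
  norm.\<close>

lemma weak_deriv_closed:
  assumes "\<And>n. weak_deriv j (u n) (w n)" "u \<longlonglongrightarrow> u'" "w \<longlonglongrightarrow> w'"
  shows "weak_deriv j u' w'"
  unfolding weak_deriv_def
proof (intro allI impI)
  fix \<psi> assume \<psi>: "test_fun \<psi>"
  let ?P = "\<lambda>i u. LINT x|MI. rep_L2 u x * of_real ((deriv ^^ i) \<psi> x)"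
  have "(\<lambda>n. ?P j (u n)) \<longlonglongrightarrow> ?P j u'"
    by (rule bounded_linear.tendsto[OF bounded_linear_pairing[OF \<psi>] assms(2)])
  moreover have "(\<lambda>n. (-1) ^ j * ?P 0 (w n)) \<longlonglongrightarrow> (-1) ^ j * ?P 0 w'"
    by (intro tendsto_mult tendsto_const bounded_linear.tendsto[OF bounded_linear_pairing[OF \<psi>] assms(3)])
  moreover have "?P j (u n) = (-1) ^ j * ?P 0 (w n)" for n
    using assms(1)[of n] \<psi> by (simp add: weak_deriv_def)
  ultimately show "?P j u' = (-1) ^ j * (LINT x|MI. rep_L2 w' x * of_real (\<psi> x))"
    by (simp add: LIMSEQ_unique)
qed

section \<open>The space \<open>H\<^sup>2(I)\<close>\<close>

definition h2d :: "nat \<Rightarrow> H2I \<Rightarrow> L2I" where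
  "h2d j u = wderiv j (of_H2 u)"

lemma weak_deriv_h2d: "j \<le> 2 \<Longrightarrow> weak_deriv j (of_H2 u) (h2d j u)"
  unfolding h2d_def using of_H2 by (rule weak_deriv_wderiv)

lemma weak_deriv_1_h2d: "j < 2 \<Longrightarrow> weak_deriv 1 (h2d j u) (h2d (Suc j) u)"
  unfolding h2d_def using of_H2 by (rule weak_deriv_1_wderiv)

lemma h2d_0 [simp]: "h2d 0 u = of_H2 u"
  by (simp add: h2d_def)

lemma norm_H2I_sq: "(norm u)\<^sup>2 = (\<Sum>j\<le>2. (norm (h2d j u))\<^sup>2)"
  by (simp add: norm_H2I.rep_eq h2d_def sum_nonneg)

lemma norm_h2d_le: "j \<le> 2 \<Longrightarrow> norm (h2d j u) \<le> norm u"
  by (rule power2_le_imp_le) (auto simp: norm_H2I_sq intro: member_le_sum)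

lemma norm_of_H2_le: "norm (of_H2 u) \<le> norm u"
  using norm_h2d_le[of 0 u] by simp

lemma norm_H2I_le: "norm u \<le> norm (h2d 0 u) + norm (h2d 1 u) + norm (h2d 2 u)"
proof (rule power2_le_imp_le)
  have "(\<Sum>j\<le>2. (norm (h2d j u))\<^sup>2) = (norm (h2d 0 u))\<^sup>2 + (norm (h2d 1 u))\<^sup>2 + (norm (h2d 2 u))\<^sup>2"
    by (simp add: numeral_2_eq_2)
  then show "(norm u)\<^sup>2 \<le> (norm (h2d 0 u) + norm (h2d 1 u) + norm (h2d 2 u))\<^sup>2"
    unfolding norm_H2I_sq by (simp add: power2_sum)
qed simp

lemma h2d_add: "j \<le> 2 \<Longrightarrow> h2d j (u + v) = h2d j u + h2d j v"
  unfolding h2d_def plus_H2I.rep_eq by (rule wderiv_add[OF of_H2 of_H2])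

lemma h2d_scaleR: "j \<le> 2 \<Longrightarrow> h2d j (c *\<^sub>R u) = c *\<^sub>R h2d j u"
  unfolding h2d_def scaleR_H2I.rep_eq by (rule wderiv_scaleR[OF of_H2])

lemma bounded_linear_h2d: "j \<le> 2 \<Longrightarrow> bounded_linear (h2d j)"
  by (rule bounded_linear_intro[of _ 1]) (auto simp: h2d_add h2d_scaleR norm_h2d_le)

lemma bounded_linear_of_H2: "bounded_linear of_H2"
  using bounded_linear_h2d[of 0] by (simp add: h2d_def[abs_def])

lemma h2d_diff: "j \<le> 2 \<Longrightarrow> h2d j (u - v) = h2d j u - h2d j v"
  by (intro linear_diff bounded_linear.linear bounded_linear_h2d)

lemma of_H2_inject': "of_H2 u = of_H2 v \<Longrightarrow> u = v"
  by (simp add: of_H2_inject)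

text \<open>Each derivative of a Cauchy sequence converges in L^2, and
  \<open>weak_deriv_closed\<close> identifies the limits as the derivatives of the limit.\<close>

instance H2I :: banach
proof
  fix X :: "nat \<Rightarrow> H2I" assume X: "Cauchy X"
  have "convergent (\<lambda>n. h2d j (X n))" if "j \<le> 2" for j
    using bounded_linear.Cauchy[OF bounded_linear_h2d[OF that] X] by (simp add: Cauchy_convergent_iff)
  moreover define w where "w j = lim (\<lambda>n. h2d j (X n))" for j
  ultimately have w: "(\<lambda>n. h2d j (X n)) \<longlonglongrightarrow> w j" if "j \<le> 2" for j
    using that by (simp add: convergent_LIMSEQ_iff)
  have wd: "weak_deriv j (w 0) (w j)" if "j \<le> 2" for j
  proof (rule weak_deriv_closed)
    show "weak_deriv j (of_H2 (X n)) (h2d j (X n))" for n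
      by (rule weak_deriv_h2d[OF that])
    show "(\<lambda>n. of_H2 (X n)) \<longlonglongrightarrow> w 0"
      using w[of 0] by simp
  qed (rule w[OF that])
  then have "w 0 \<in> sobolev 2" unfolding sobolev_def by blast
  then obtain u where u: "of_H2 u = w 0" by (metis Abs_H2_inverse)
  have hu: "h2d j u = w j" if "j \<le> 2" for j
    unfolding h2d_def u by (rule wderiv_eq[OF wd[OF that]])
  have lim0: "(\<lambda>n. h2d j (X n - u)) \<longlonglongrightarrow> 0" if "j \<le> 2" for j
    unfolding h2d_diff[OF that] hu[OF that] by (rule LIM_zero[OF w[OF that]])
  have "(\<lambda>n. norm (h2d 0 (X n - u)) + norm (h2d 1 (X n - u)) + norm (h2d 2 (X n - u))) \<longlonglongrightarrow> 0 + 0 + 0"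
    by (intro tendsto_add tendsto_norm_zero lim0) simp_all
  then have "(\<lambda>n. norm (h2d 0 (X n - u)) + norm (h2d 1 (X n - u)) + norm (h2d 2 (X n - u))) \<longlonglongrightarrow> 0"
    by simp
  then have "(\<lambda>n. X n - u) \<longlonglongrightarrow> 0"
    by (rule Lim_null_comparison[OF always_eventually, rotated]) (intro allI norm_H2I_le)
  then have "X \<longlonglongrightarrow> u" by (rule LIM_zero_cancel)
  then show "convergent X" by (auto simp: convergent_def)
qed

section \<open>Regularity on the domain of the generator\<close>

text \<open>Classical derivatives of all orders up to 5, with the boundary conditions as point
  values. A general element of H^5 has no continuous fifth derivative, so this describes only the
  smoother part of the domain, where ordinary integration by parts is available.\<close>

definition C5_rep :: "real \<Rightarrow> L2I \<Rightarrow> (nat \<Rightarrow> real \<Rightarrow> complex) \<Rightarrow> bool" where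
  "C5_rep \<alpha> v V \<longleftrightarrow>
    (\<forall>j<5. \<forall>x\<in>{0..1}. (V j has_vector_derivative V (Suc j) x) (at x within {0..1})) \<and>
    continuous_on {0..1} (V 5) \<and> (\<forall>j\<le>5. wderiv j v = toL2 (V j)) \<and>
    V 0 0 = 0 \<and> V 0 1 = 0 \<and> V 1 0 = 0 \<and> V 1 1 = 0 \<and> V 2 1 = of_real \<alpha> * V 2 0"

lemma continuous_on_C5_rep:
  assumes "C5_rep \<alpha> v V" "j \<le> 5"
  shows "continuous_on {0..1} (V j)"
proof (cases "j = 5")
  case False
  then have "j < 5" using assms(2) by simp
  then show ?thesis
    using assms(1) unfolding C5_rep_def by (intro continuous_on_vector_derivative) blast
qed (use assms in \<open>simp add: C5_rep_def\<close>)

text \<open>Since z = v_xxxxx - v_xxx with both \<open>z\<close> and v_xxx in H^1, the derivative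
  v_xxxxx is continuous. Integrating downwards makes all lower derivatives classical, and the traces
  in the domain become values at the end points.\<close>

lemma C5_rep_exists:
  assumes "(v, z) \<in> kawahara_op \<alpha>" "z \<in> sobolev 1"
  obtains V where "C5_rep \<alpha> v V" "z = toL2 (\<lambda>x. V 5 x - V 3 x)"
proof -
  have v: "v \<in> sobolev 5" and z: "z = - wderiv 3 v + wderiv 5 v"
    and bc: "pt_val v 0 = 0" "pt_val v 1 = 0" "pt_val (wderiv 1 v) 0 = 0" "pt_val (wderiv 1 v) 1 = 0"
      "pt_val (wderiv 2 v) 1 = of_real \<alpha> * pt_val (wderiv 2 v) 0"
    using assms(1) unfolding kawahara_op_def by auto
  note wd = weak_deriv_1_wderiv[OF v]
  obtain Z where Z: "continuous_on {0..1} Z" "z = toL2 Z"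
    using weak_deriv_1_continuous[OF weak_deriv_1_wderiv[OF assms(2), of 0]] by auto
  obtain W where W: "continuous_on {0..1} W" "wderiv 3 v = toL2 W"
    using weak_deriv_1_continuous[OF wd[of 3]] by auto
  let ?V5 = "\<lambda>x. Z x + W x"
  have V5: "continuous_on {0..1} ?V5" by (intro continuous_intros Z W)
  have w5: "wderiv 5 v = toL2 ?V5"
    using z Z(2) W(2) by (simp add: toL2_add sq_integrable_continuous Z W)
  \<comment> \<open>One step down: a continuous derivative of order \<open>j + 1\<close> gives a
    continuously differentiable representative of order \<open>j\<close>.\<close>
  have step: "\<exists>U. wderiv j v = toL2 U \<and> continuous_on {0..1} U \<and>
      (\<forall>x\<in>{0..1}. (U has_vector_derivative g x) (at x within {0..1}))"
    if g: "j < 5" "wderiv (Suc j) v = toL2 g" "continuous_on {0..1} g" for j g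
  proof -
    obtain U where "wderiv j v = toL2 U"
      "\<And>x. x \<in> {0..1} \<Longrightarrow> (U has_vector_derivative g x) (at x within {0..1})"
      using weak_deriv_1_C1[OF _ g(3), of "wderiv j v"] wd[OF g(1)] g(2) by metis
    then show ?thesis using continuous_on_vector_derivative by blast
  qed
  obtain V4 where V4: "wderiv 4 v = toL2 V4" "continuous_on {0..1} V4"
    "\<And>x. x \<in> {0..1} \<Longrightarrow> (V4 has_vector_derivative ?V5 x) (at x within {0..1})"
    using step[of 4, OF _ _ V5] w5 by (auto simp: eval_nat_numeral)
  obtain V3 where V3: "wderiv 3 v = toL2 V3" "continuous_on {0..1} V3"
    "\<And>x. x \<in> {0..1} \<Longrightarrow> (V3 has_vector_derivative V4 x) (at x within {0..1})"
    using step[of 3, OF _ _ V4(2)] V4(1) by (auto simp: eval_nat_numeral)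
  obtain V2 where V2: "wderiv 2 v = toL2 V2" "continuous_on {0..1} V2"
    "\<And>x. x \<in> {0..1} \<Longrightarrow> (V2 has_vector_derivative V3 x) (at x within {0..1})"
    using step[of 2, OF _ _ V3(2)] V3(1) by (auto simp: eval_nat_numeral)
  obtain V1 where V1: "wderiv 1 v = toL2 V1" "continuous_on {0..1} V1"
    "\<And>x. x \<in> {0..1} \<Longrightarrow> (V1 has_vector_derivative V2 x) (at x within {0..1})"
    using step[of 1, OF _ _ V2(2)] V2(1) by (auto simp: eval_nat_numeral)
  obtain V0 where V0: "wderiv 0 v = toL2 V0" "continuous_on {0..1} V0"
    "\<And>x. x \<in> {0..1} \<Longrightarrow> (V0 has_vector_derivative V1 x) (at x within {0..1})"
    using step[of 0, OF _ _ V1(2)] V1(1) by auto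
  define V where "V j = [V0, V1, V2, V3, V4, ?V5] ! j" for j
  have V: "V 0 = V0" "V 1 = V1" "V (Suc 0) = V1" "V 2 = V2" "V 3 = V3" "V 4 = V4" "V 5 = ?V5"
    by (simp_all add: V_def eval_nat_numeral)
  have less5: "j < 5 \<longleftrightarrow> j = 0 \<or> j = 1 \<or> j = 2 \<or> j = 3 \<or> j = 4" for j :: nat by auto
  have le5: "j \<le> 5 \<longleftrightarrow> j = 0 \<or> j = 1 \<or> j = 2 \<or> j = 3 \<or> j = 4 \<or> j = 5" for j :: nat by auto
  have "C5_rep \<alpha> v V"
    unfolding C5_rep_def
  proof (intro conjI allI impI ballI)
    fix j :: nat and x :: real assume "j < 5" and x: "x \<in> {0..1}"
    then show "(V j has_vector_derivative V (Suc j) x) (at x within {0..1})"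
      unfolding less5 using V0(3)[OF x] V1(3)[OF x] V2(3)[OF x] V3(3)[OF x] V4(3)[OF x]
      by (auto simp: V simp flip: numeral_eq_Suc Suc_1)
        (simp_all add: V_def eval_nat_numeral)
  next
    fix j :: nat assume "j \<le> 5"
    then show "wderiv j v = toL2 (V j)"
      unfolding le5 using V0(1) V1(1) V2(1) V3(1) V4(1) w5 by (auto simp: V)
  qed (use bc V0(1) V1(1) V2(1) V0(2) V1(2) V2(2) V5 in \<open>auto simp: V pt_val_toL2\<close>)
  moreover have "z = toL2 (\<lambda>x. V 5 x - V 3 x)"
    using z w5 V3(1) by (simp add: V toL2_diff sq_integrable_continuous V5 V3(2))
  ultimately show ?thesis using that by blast
qed

section \<open>Calculus inequalities on the unit interval\<close>

abbreviation (input) nrm :: "(real \<Rightarrow> complex) \<Rightarrow> real" where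
  "nrm f \<equiv> norm (toL2 f)"

lemma nrm_sq:
  assumes "continuous_on {0..1} f"
  shows "(nrm f)\<^sup>2 = integral {0..1} (\<lambda>x. f x \<bullet> f x)"
proof -
  have "(nrm f)\<^sup>2 = (LINT x|MI. f x \<bullet> f x)"
    using norm_toL2[OF sq_integrable_continuous[OF assms]]
    by (simp add: L2_norm_fun_def power2_norm_eq_inner)
  also have "\<dots> = integral {0..1} (\<lambda>x. f x \<bullet> f x)"
    by (intro LINT_MI_eq_integral continuous_intros assms)
  finally show ?thesis .
qed

lemma weighted_inner_continuous:
  assumes "continuous_on {0..1} f" "continuous_on {0..1} g"
  shows "weighted_inner K (toL2 f) (toL2 g) = integral {0..1} (\<lambda>x. (K + x) * (f x \<bullet> g x))"
  by (subst weighted_inner_toL2) (auto intro!: sq_integrable_continuous LINT_MI_eq_integral continuous_intros assms)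

lemma integral_norm_le_nrm:
  assumes "continuous_on {0..1} f"
  shows "integral {0..1} (\<lambda>x. norm (f x)) \<le> nrm f"
proof -
  have "integral {0..1} (\<lambda>x. norm (f x)) = (LINT x|MI. norm (f x))"
    by (intro LINT_MI_eq_integral(1)[symmetric] continuous_intros assms)
  also have "\<dots> \<le> nrm f"
    using LINT_norm_le norm_toL2 sq_integrable_continuous[OF assms] by metis
  finally show ?thesis .
qed

lemma integral_norm_mult_le_nrm:
  assumes "continuous_on {0..1} f" "continuous_on {0..1} g"
  shows "integral {0..1} (\<lambda>x. norm (f x) * norm (g x)) \<le> nrm f * nrm g"
proof -
  have "integral {0..1} (\<lambda>x. norm (f x) * norm (g x)) = (LINT x|MI. norm (f x) * norm (g x))"
    by (intro LINT_MI_eq_integral(1)[symmetric] continuous_intros assms)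
  also have "\<dots> \<le> nrm f * nrm g"
    using L2_cauchy_schwarz[of f g] assms by (simp add: norm_toL2 sq_integrable_continuous)
  finally show ?thesis .
qed

lemma integral_inner_le_nrm:
  assumes "continuous_on {0..1} f" "continuous_on {0..1} g"
  shows "\<bar>integral {0..1} (\<lambda>x. f x \<bullet> g x)\<bar> \<le> nrm f * nrm g"
proof -
  have "norm (integral {0..1} (\<lambda>x. f x \<bullet> g x)) \<le> integral {0..1} (\<lambda>x. norm (f x) * norm (g x))"
    by (intro integral_norm_bound_integral integrable_continuous_real continuous_intros assms)
      (auto simp: Cauchy_Schwarz_ineq2)
  also note integral_norm_mult_le_nrm[OF assms]
  finally show ?thesis by simp
qed

lemma nrm_le_sup:
  assumes "continuous_on {0..1} f" "\<And>x. x \<in> {0..1} \<Longrightarrow> norm (f x) \<le> B"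
  shows "nrm f \<le> B"
proof (rule power2_le_imp_le)
  show B: "0 \<le> B" using assms(2)[of 0] norm_ge_zero[of "f 0"] by (smt (verit) atLeastAtMost_iff)
  have "(nrm f)\<^sup>2 \<le> integral {0..1} (\<lambda>x::real. B\<^sup>2)"
    unfolding nrm_sq[OF assms(1)]
    by (intro integral_le integrable_continuous_real continuous_intros assms)
      (auto simp: power2_norm_eq_inner[symmetric] intro!: power_mono assms(2))
  then show "(nrm f)\<^sup>2 \<le> B\<^sup>2" by simp
qed

lemma DERIV_inner:
  fixes f g :: "real \<Rightarrow> 'a::real_inner"
  assumes "(f has_vector_derivative f') (at x within S)" "(g has_vector_derivative g') (at x within S)"
  shows "((\<lambda>x. f x \<bullet> g x) has_real_derivative f x \<bullet> g' + f' \<bullet> g x) (at x within S)"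
  unfolding has_real_derivative_iff_has_vector_derivative
  by (rule bounded_bilinear.has_vector_derivative[OF bounded_bilinear_inner assms])

lemma FTC_real:
  assumes "\<And>x. x \<in> {0..1::real} \<Longrightarrow> (P has_real_derivative p x) (at x within {0..1})"
  shows "integral {0..1} p = P 1 - P 0"
  using assms unfolding has_real_derivative_iff_has_vector_derivative
  by (intro integral_unique fundamental_theorem_of_calculus) auto

lemma oscillation_le_integral:
  fixes f :: "real \<Rightarrow> 'a::banach"
  assumes f: "\<And>x. x \<in> {0..1} \<Longrightarrow> (f has_vector_derivative f' x) (at x within {0..1})"
    and f': "continuous_on {0..1} f'" and xy: "x \<in> {0..1}" "y \<in> {0..1}"
  shows "norm (f x - f y) \<le> integral {0..1} (\<lambda>x. norm (f' x))"
proof -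
  have *: "norm (f x - f y) \<le> integral {0..1} (\<lambda>x. norm (f' x))"
    if xy: "x \<in> {0..1}" "y \<in> {0..1}" "y \<le> x" for x y
  proof -
    have sub: "{y..x} \<subseteq> {0..1}" using xy by auto
    have "(f' has_integral (f x - f y)) {y..x}"
      using xy sub by (intro fundamental_theorem_of_calculus)
        (auto intro!: has_vector_derivative_within_subset[OF f sub])
    then have "norm (f x - f y) = norm (integral {y..x} f')" by (simp add: integral_unique)
    also have "\<dots> \<le> integral {y..x} (\<lambda>x. norm (f' x))"
      by (intro integral_norm_bound_integral integrable_continuous_real continuous_intros
          continuous_on_subset[OF f' sub]) auto
    also have "\<dots> \<le> integral {0..1} (\<lambda>x. norm (f' x))"
      by (intro integral_subset_le sub integrable_continuous_real continuous_intros f'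
          continuous_on_subset[OF f' sub]) auto
    finally show ?thesis .
  qed
  show ?thesis
    using *[OF xy] *[OF xy(2,1)] by (cases "y \<le> x") (auto simp: norm_minus_commute)
qed

lemma oscillation_le_nrm:
  assumes "\<And>x. x \<in> {0..1} \<Longrightarrow> (f has_vector_derivative f' x) (at x within {0..1})"
    and f': "continuous_on {0..1} f'" and "x \<in> {0..1}" "y \<in> {0..1}"
  shows "norm (f x - f y) \<le> nrm f'"
  using oscillation_le_integral[OF assms] integral_norm_le_nrm[OF f'] by linarith

text \<open>The constant is 1 because |f(x)| = |f(x) - f(0)| is at most the L^1 norm of f' on an
  interval of length 1.\<close>

lemma poincare:
  assumes f: "\<And>x. x \<in> {0..1} \<Longrightarrow> (f has_vector_derivative f' x) (at x within {0..1})"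
    and f': "continuous_on {0..1} f'" and "f 0 = 0"
  shows "nrm f \<le> nrm f'"
proof (rule nrm_le_sup)
  show "continuous_on {0..1} f" using f continuous_on_vector_derivative by blast
  show "norm (f x) \<le> nrm f'" if "x \<in> {0..1}" for x
    using oscillation_le_nrm[OF f f' that, of 0] assms(3) by simp
qed

text \<open>The square |f|^2 oscillates by at most the integral of 2 |f| |f'|; its value at
  \<open>x\<close> is compared with its mean, so no boundary condition on \<open>f\<close>
  enters.\<close>

lemma agmon:
  assumes f: "\<And>x. x \<in> {0..1} \<Longrightarrow> (f has_vector_derivative f' x) (at x within {0..1})"
    and f': "continuous_on {0..1} f'" and x: "x \<in> {0..1}"
  shows "(norm (f x))\<^sup>2 \<le> (nrm f)\<^sup>2 + 2 * nrm f * nrm f'"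
proof -
  have fc: "continuous_on {0..1} f" using f continuous_on_vector_derivative by blast
  have bd: "f x \<bullet> f x - 2 * nrm f * nrm f' \<le> f y \<bullet> f y" if y: "y \<in> {0..1}" for y
  proof -
    have "norm (f x \<bullet> f x - f y \<bullet> f y) \<le> integral {0..1} (\<lambda>x. norm (f x \<bullet> f' x + f' x \<bullet> f x))"
    proof (rule oscillation_le_integral[OF _ _ x y])
      show "((\<lambda>x. f x \<bullet> f x) has_vector_derivative f x \<bullet> f' x + f' x \<bullet> f x) (at x within {0..1})"
        if "x \<in> {0..1}" for x
        using DERIV_inner[OF f[OF that] f[OF that]]
        unfolding has_real_derivative_iff_has_vector_derivative .
    qed (intro continuous_intros fc f')
    also have "\<dots> \<le> integral {0..1} (\<lambda>x. 2 * (norm (f x) * norm (f' x)))"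
    proof (intro integral_le integrable_continuous_real continuous_intros fc f')
      show "norm (f t \<bullet> f' t + f' t \<bullet> f t) \<le> 2 * (norm (f t) * norm (f' t))" for t
        using Cauchy_Schwarz_ineq2[of "f t" "f' t"] by (simp add: inner_commute)
    qed
    also have "\<dots> \<le> 2 * nrm f * nrm f'"
      using integral_norm_mult_le_nrm[OF fc f'] by simp
    finally show ?thesis unfolding real_norm_def by linarith
  qed
  have "integral {0..1} (\<lambda>y::real. f x \<bullet> f x - 2 * nrm f * nrm f') \<le> integral {0..1} (\<lambda>y. f y \<bullet> f y)"
    by (intro integral_le integrable_continuous_real continuous_intros fc bd) auto
  then show ?thesis
    by (simp add: nrm_sq[OF fc] power2_norm_eq_inner)
qed

text \<open>Integrating against the weight \<open>y (1 - y)\<close>, which vanishes at both ends, moves the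
  derivative off \<open>f\<close>.\<close>

lemma sup_deriv_le:
  assumes f: "\<And>x. x \<in> {0..1} \<Longrightarrow> (f has_vector_derivative f1 x) (at x within {0..1})"
    and f1: "\<And>x. x \<in> {0..1} \<Longrightarrow> (f1 has_vector_derivative f2 x) (at x within {0..1})"
    and f2: "continuous_on {0..1} f2" and x: "x \<in> {0..1}"
  shows "norm (f1 x) \<le> 6 * (nrm f + nrm f2)"
proof -
  have fc: "continuous_on {0..1} f" using f continuous_on_vector_derivative by blast
  have f1c: "continuous_on {0..1} f1" using f1 continuous_on_vector_derivative by blast
  let ?w = "\<lambda>y::real. y * (1 - y)"
  have w: "0 \<le> ?w y" "?w y \<le> 1" if "y \<in> {0..1}" for y
    using that by (auto simp: mult_le_one)
  \<comment> \<open>The mean 1/6 of the weight is the origin of the factor 6.\<close>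
  have "integral {0..1} ?w = (\<lambda>y. y\<^sup>2 / 2 - y ^ 3 / 3) 1 - (\<lambda>y::real. y\<^sup>2 / 2 - y ^ 3 / 3) 0"
    by (rule FTC_real) (auto intro!: derivative_eq_intros simp: power2_eq_square algebra_simps)
  then have w6: "integral {0..1} ?w = 1 / 6" by simp
  have "((\<lambda>y. ?w y *\<^sub>R f1 y + (1 - 2 * y) *\<^sub>R f y) has_integral (\<lambda>y. ?w y *\<^sub>R f y) 1 - (\<lambda>y. ?w y *\<^sub>R f y) 0) {0..1}"
    by (rule fundamental_theorem_of_calculus) (auto intro!: derivative_eq_intros f has_vector_derivative_scaleR simp: algebra_simps)
  then have ibp: "integral {0..1} (\<lambda>y. ?w y *\<^sub>R f1 y + (1 - 2 * y) *\<^sub>R f y) = 0"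
    by (simp add: integral_unique)
  have "(?w has_integral 1 / 6) {0..1}"
    unfolding w6[symmetric]
    by (intro integrable_integral integrable_continuous_real continuous_intros)
  then have "((\<lambda>y. ?w y *\<^sub>R f1 x) has_integral (1/6) *\<^sub>R f1 x) {0..1}"
    by (rule has_integral_scaleR_left)
  then have "(1/6) *\<^sub>R f1 x = integral {0..1} (\<lambda>y. ?w y *\<^sub>R f1 x)"
    by (simp only: integral_unique)
  also have "\<dots> = integral {0..1} (\<lambda>y. ?w y *\<^sub>R (f1 x - f1 y) - (1 - 2 * y) *\<^sub>R f y
      + (?w y *\<^sub>R f1 y + (1 - 2 * y) *\<^sub>R f y))"
    by (intro hk_integral_cong) (simp add: algebra_simps)
  also have "\<dots> = integral {0..1} (\<lambda>y. ?w y *\<^sub>R (f1 x - f1 y) - (1 - 2 * y) *\<^sub>R f y)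
      + integral {0..1} (\<lambda>y. ?w y *\<^sub>R f1 y + (1 - 2 * y) *\<^sub>R f y)"
    by (intro hk_integral_add integrable_continuous_real continuous_intros fc f1c)
  finally have eq: "(1/6) *\<^sub>R f1 x = integral {0..1} (\<lambda>y. ?w y *\<^sub>R (f1 x - f1 y) - (1 - 2 * y) *\<^sub>R f y)"
    by (simp add: ibp)
  have "norm ((1/6) *\<^sub>R f1 x) \<le> integral {0..1} (\<lambda>y. nrm f2 + norm (f y))"
    unfolding eq
  proof (intro integral_norm_bound_integral integrable_continuous_real continuous_intros fc f1c)
    fix y :: real assume y: "y \<in> {0..1}"
    have "norm (?w y *\<^sub>R (f1 x - f1 y)) \<le> 1 * nrm f2"
      unfolding norm_scaleR using w[OF y] oscillation_le_nrm[OF f1 f2 x y]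
      by (intro mult_mono) auto
    moreover have "norm ((1 - 2 * y) *\<^sub>R f y) \<le> 1 * norm (f y)"
      unfolding norm_scaleR using y by (intro mult_right_mono) auto
    ultimately show "norm (?w y *\<^sub>R (f1 x - f1 y) - (1 - 2 * y) *\<^sub>R f y) \<le> nrm f2 + norm (f y)"
      using norm_triangle_ineq4[of "?w y *\<^sub>R (f1 x - f1 y)" "(1 - 2 * y) *\<^sub>R f y"] by linarith
  qed
  also have "\<dots> = nrm f2 + integral {0..1} (\<lambda>y. norm (f y))"
    by (subst hk_integral_add)
      (auto intro!: integrable_continuous_real continuous_intros fc)
  also have "\<dots> \<le> nrm f2 + nrm f" using integral_norm_le_nrm[OF fc] by simp
  finally show ?thesis by simp
qed

text \<open>Here \<open>a\<close>, \<open>b\<close>, \<open>c\<close>, \<open>d\<close> stand for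
  the norms of H, H', H'', H''' and \<open>q\<close> for the boundary terms. If b > a, all reduces
  to b^2 <= 1200 a m with m = max b d; the case m = b then gives b <= 1200 a, whence 1440000 =
  1200^2.\<close>

lemma interpolation_arith:
  fixes a b c d q :: real
  assumes nn: "0 \<le> a" "0 \<le> b" "0 \<le> c" "0 \<le> d" "0 \<le> q"
    and 1: "b\<^sup>2 \<le> 2 * q + a * c" and 2: "q\<^sup>2 \<le> (a\<^sup>2 + 2 * a * b) * (b\<^sup>2 + 2 * b * c)"
    and 3: "c \<le> 6 * (b + d)"
  shows "b\<^sup>2 \<le> 1440000 * a * (a + d)"
proof (cases "b \<le> a")
  case True
  then have "b\<^sup>2 \<le> a\<^sup>2" using nn by (intro power_mono)
  moreover have "a\<^sup>2 \<le> 1440000 * a * (a + d)"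
    using nn by (simp add: power2_eq_square algebra_simps add_increasing)
  ultimately show ?thesis by linarith
next
  case False
  then have ab: "a < b" by simp
  then have b: "0 < b" using nn by linarith
  define m where "m = max b d"
  have m: "b \<le> m" "d \<le> m" "0 < m" using b by (auto simp: m_def)
  have "6 * (b + d) \<le> 6 * (m + m)" using m by (intro mult_left_mono add_mono) auto
  with 3 have c: "c \<le> 12 * m" by simp
  have "a\<^sup>2 + 2 * a * b \<le> 3 * (a * b)"
    using mult_left_mono[of a b a] ab nn by (simp add: power2_eq_square)
  moreover have "b\<^sup>2 + 2 * b * c \<le> 25 * (b * m)"
  proof -
    have "b * c \<le> b * (12 * m)" "b * b \<le> b * m" using c m b by (intro mult_left_mono; simp)+
    then show ?thesis by (simp add: power2_eq_square)
  qed
  ultimately have "(a\<^sup>2 + 2 * a * b) * (b\<^sup>2 + 2 * b * c) \<le> (3 * (a * b)) * (25 * (b * m))"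
    using nn m by (intro mult_mono) auto
  with 2 have q: "q\<^sup>2 \<le> 75 * (a * b\<^sup>2 * m)" by (simp add: power2_eq_square mult_ac)
  have ac: "a * c \<le> 12 * (a * m)" using mult_left_mono[OF c nn(1)] by simp
  \<comment> \<open>Either b^2 is at most twice the interior bound 12 a m, or the boundary term
    dominates, b^2 <= 4 q, and squaring yields the factor 16 times 75.\<close>
  have bam: "b\<^sup>2 \<le> 1200 * (a * m)"
  proof (cases "b\<^sup>2 \<le> 24 * (a * m)")
    case True
    moreover have "0 \<le> a * m" using nn m by simp
    ultimately show ?thesis by linarith
  next
    case False
    then have "b\<^sup>2 \<le> 4 * q" using 1 ac by linarith
    then have "(b\<^sup>2)\<^sup>2 \<le> (4 * q)\<^sup>2" by (intro power_mono) auto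
    also have "\<dots> \<le> 16 * (75 * (a * b\<^sup>2 * m))" using q by (simp add: power_mult_distrib mult_ac)
    finally have "b\<^sup>2 * b\<^sup>2 \<le> b\<^sup>2 * (1200 * (a * m))" by (simp add: power2_eq_square mult_ac)
    then show ?thesis by (rule mult_left_le_imp_le) (use b in simp)
  qed
  show ?thesis
  proof (cases "d \<le> b")
    case True
    then have "m = b" by (simp add: m_def)
    then have "b * b \<le> b * (1200 * a)" using bam by (simp add: power2_eq_square mult_ac)
    then have "b \<le> 1200 * a" using b by (simp add: mult_le_cancel_left)
    then have "b\<^sup>2 \<le> (1200 * a)\<^sup>2" using b by (intro power_mono) auto
    also have "\<dots> \<le> 1440000 * a * (a + d)"
      using nn by (simp add: power2_eq_square algebra_simps)
    finally show ?thesis .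
  next
    case False
    then have "m = d" by (simp add: m_def)
    moreover have "1200 * (a * d) \<le> 1440000 * a * (a + d)"
      using nn by (simp add: algebra_simps)
    ultimately show ?thesis using bam by simp
  qed
qed

text \<open>Integrating |H'|^2 by parts leaves H . H'' in the interior and H . H' at the end points.
  The exponent 1/2 on the norm of \<open>H\<close> is weaker than the 2/3 of scaling; this is the
  price of treating the boundary terms so simply.\<close>

lemma interpolation_H3:
  assumes H: "\<And>x. x \<in> {0..1} \<Longrightarrow> (H has_vector_derivative H1 x) (at x within {0..1})"
    and H1: "\<And>x. x \<in> {0..1} \<Longrightarrow> (H1 has_vector_derivative H2 x) (at x within {0..1})"
    and H2: "\<And>x. x \<in> {0..1} \<Longrightarrow> (H2 has_vector_derivative H3 x) (at x within {0..1})"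
    and H3: "continuous_on {0..1} H3"
  shows "(nrm H1)\<^sup>2 \<le> 1440000 * nrm H * (nrm H + nrm H3)"
proof -
  have Hc: "continuous_on {0..1} H" "continuous_on {0..1} H1" "continuous_on {0..1} H2"
    using H H1 H2 continuous_on_vector_derivative by blast+
  let ?a = "nrm H" and ?b = "nrm H1" and ?c = "nrm H2" and ?d = "nrm H3"
  \<comment> \<open>No boundary condition on \<open>H\<close> is available, so the end point terms
    |H| |H'| are bounded by Agmon's inequality for both factors.\<close>
  define q where "q = sqrt ((?a\<^sup>2 + 2 * ?a * ?b) * (?b\<^sup>2 + 2 * ?b * ?c))"
  have q: "norm (H x) * norm (H1 x) \<le> q" if x: "x \<in> {0..1}" for x
    unfolding q_def
  proof (rule real_le_rsqrt)
    show "(norm (H x) * norm (H1 x))\<^sup>2 \<le> (?a\<^sup>2 + 2 * ?a * ?b) * (?b\<^sup>2 + 2 * ?b * ?c)"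
      unfolding power_mult_distrib
      using agmon[OF H Hc(2) x] agmon[OF H1 Hc(3) x] by (intro mult_mono) auto
  qed
  have "integral {0..1} (\<lambda>x. H x \<bullet> H2 x + H1 x \<bullet> H1 x) = H 1 \<bullet> H1 1 - H 0 \<bullet> H1 0"
    by (rule FTC_real) (rule DERIV_inner[OF H H1])
  moreover have "integral {0..1} (\<lambda>x. H x \<bullet> H2 x + H1 x \<bullet> H1 x)
      = integral {0..1} (\<lambda>x. H x \<bullet> H2 x) + integral {0..1} (\<lambda>x. H1 x \<bullet> H1 x)"
    by (intro hk_integral_add integrable_continuous_real continuous_intros Hc)
  moreover have "\<bar>integral {0..1} (\<lambda>x. H x \<bullet> H2 x)\<bar> \<le> ?a * ?c"
    by (rule integral_inner_le_nrm[OF Hc(1,3)])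
  moreover have "\<bar>H 1 \<bullet> H1 1\<bar> \<le> q" "\<bar>H 0 \<bullet> H1 0\<bar> \<le> q"
    using q[of 1] q[of 0] Cauchy_Schwarz_ineq2[of "H 1" "H1 1"] Cauchy_Schwarz_ineq2[of "H 0" "H1 0"] by auto
  ultimately have 1: "?b\<^sup>2 \<le> 2 * q + ?a * ?c"
    unfolding nrm_sq[OF Hc(2)] by linarith
  have 3: "?c \<le> 6 * (?b + ?d)"
    by (intro nrm_le_sup Hc sup_deriv_le[OF H1 H2 H3])
  show ?thesis
    by (rule interpolation_arith[OF _ _ _ _ _ 1 _ 3]) (auto simp: q_def)
qed

section \<open>Energy estimates for the generator\<close>

text \<open>Multiplication by 2 (K + x) v and integration by parts: each time the derivative falls
  on the weight it produces a definite square, 5 |v_xx|^2 from the fifth-order term and 3 |v_x|^2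
  from the third-order one. At the ends only v_xx survives.\<close>

lemma energy_dissipation:
  assumes \<alpha>: "\<bar>\<alpha>\<bar> < 1" and V: "C5_rep \<alpha> v V" and z: "z = toL2 (\<lambda>x. V 5 x - V 3 x)"
    and K: "K = 1 / (1 - \<alpha>\<^sup>2)"
  shows "2 * weighted_inner K z v + 5 * (norm (wderiv 2 v))\<^sup>2 \<le> 0"
proof -
  have c: "continuous_on {0..1} (V j)" if "j \<le> 5" for j
    by (rule continuous_on_C5_rep[OF V that])
  have D0: "(V j has_vector_derivative V (Suc j) x) (at x within {0..1})" if "j < 5" "x \<in> {0..1}" for j x
    using V that unfolding C5_rep_def by blast
  have D: "(V 0 has_vector_derivative V 1 x) (at x within {0..1})"
    "(V 1 has_vector_derivative V 2 x) (at x within {0..1})"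
    "(V 2 has_vector_derivative V 3 x) (at x within {0..1})"
    "(V 3 has_vector_derivative V 4 x) (at x within {0..1})"
    "(V 4 has_vector_derivative V 5 x) (at x within {0..1})" if "x \<in> {0..1}" for x
    using D0[of 0 x] D0[of 1 x] D0[of 2 x] D0[of 3 x] D0[of 4 x] that
    by (simp_all add: eval_nat_numeral)
  have bc: "V 0 0 = 0" "V 0 1 = 0" "V 1 0 = 0" "V 1 1 = 0" "V 2 1 = of_real \<alpha> * V 2 0"
    using V unfolding C5_rep_def by auto
  have w: "v = toL2 (V 0)" "wderiv 2 v = toL2 (V 2)"
    using V wderiv_0[of v] unfolding C5_rep_def by (metis zero_le, simp)
  \<comment> \<open>All boundary terms of the repeated integrations by parts, collected into one
    primitive: the first two lines belong to the fifth-order term, the last to the third-order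
    term.\<close>
  define P where "P x = 2 * ((K + x) * (V 0 x \<bullet> V 4 x)) - 2 * (V 0 x \<bullet> V 3 x) - 2 * ((K + x) * (V 1 x \<bullet> V 3 x))
     + 4 * (V 1 x \<bullet> V 2 x) + (K + x) * (V 2 x \<bullet> V 2 x)
     - (2 * ((K + x) * (V 0 x \<bullet> V 2 x)) - 2 * (V 0 x \<bullet> V 1 x) - (K + x) * (V 1 x \<bullet> V 1 x))" for x
  let ?p = "\<lambda>x. 2 * ((K + x) * ((V 5 x - V 3 x) \<bullet> V 0 x)) + (5 * (V 2 x \<bullet> V 2 x) + 3 * (V 1 x \<bullet> V 1 x))"
  have "integral {0..1} ?p = P 1 - P 0"
  proof (rule FTC_real)
    fix x :: real assume x: "x \<in> {0..1}"
    note D' = D[OF x]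
    show "(P has_real_derivative ?p x) (at x within {0..1})"
      unfolding P_def
      apply (rule DERIV_cong)
       apply (rule derivative_intros DERIV_inner D')+
      apply (simp add: inner_diff_left inner_commute algebra_simps)
      done
  qed
  also have "P 1 - P 0 = (K + 1) * (\<alpha> * (\<alpha> * (V 2 0 \<bullet> V 2 0))) - K * (V 2 0 \<bullet> V 2 0)"
    unfolding P_def bc by (simp flip: scaleR_conv_of_real)
  also have "\<dots> = (\<alpha>\<^sup>2 - K * (1 - \<alpha>\<^sup>2)) * (V 2 0 \<bullet> V 2 0)"
    by (simp add: algebra_simps power2_eq_square)
  \<comment> \<open>The reason for the value of \<open>K\<close>: the boundary form \<alpha>^2 - K
    (1 - \<alpha>^2) becomes \<alpha>^2 - 1, which is negative.\<close>
  also have "K * (1 - \<alpha>\<^sup>2) = 1"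
    using abs_square_less_1[of \<alpha>] \<alpha> unfolding K by simp
  also have "(\<alpha>\<^sup>2 - 1) * (V 2 0 \<bullet> V 2 0) \<le> 0"
    using abs_square_less_1[of \<alpha>] \<alpha> by (intro mult_nonpos_nonneg) auto
  finally have "integral {0..1} ?p \<le> 0" .
  moreover have "integral {0..1} ?p = 2 * weighted_inner K z v + (5 * (norm (wderiv 2 v))\<^sup>2 + 3 * (norm (toL2 (V 1)))\<^sup>2)"
  proof -
    note i = integrable_continuous_real
    have n1: "(nrm (V 1))\<^sup>2 = integral {0..1} (\<lambda>x. V 1 x \<bullet> V 1 x)"
      and n2: "(nrm (V 2))\<^sup>2 = integral {0..1} (\<lambda>x. V 2 x \<bullet> V 2 x)"
      by (auto intro!: nrm_sq c)
    have "integral {0..1} ?p = integral {0..1} (\<lambda>x. 2 * ((K + x) * ((V 5 x - V 3 x) \<bullet> V 0 x)))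
        + integral {0..1} (\<lambda>x. 5 * (V 2 x \<bullet> V 2 x) + 3 * (V 1 x \<bullet> V 1 x))"
      by (intro hk_integral_add i continuous_intros c) auto
    also have "integral {0..1} (\<lambda>x. 5 * (V 2 x \<bullet> V 2 x) + 3 * (V 1 x \<bullet> V 1 x))
       = integral {0..1} (\<lambda>x. 5 * (V 2 x \<bullet> V 2 x)) + integral {0..1} (\<lambda>x. 3 * (V 1 x \<bullet> V 1 x))"
      by (intro hk_integral_add i continuous_intros c) auto
    finally show ?thesis
      unfolding w(2) n1 n2
      unfolding w(1) z by (subst weighted_inner_continuous) (auto intro!: continuous_intros c)
  qed
  moreover have "0 \<le> (norm (toL2 (V 1)))\<^sup>2" by simp
  ultimately show ?thesis by linarith
qed

lemma C5_rep_poincare: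
  assumes V: "C5_rep \<alpha> v V"
  shows "norm v \<le> norm (wderiv 1 v)" "norm (wderiv 1 v) \<le> norm (wderiv 2 v)"
proof -
  have c: "continuous_on {0..1} (V j)" if "j \<le> 5" for j
    by (rule continuous_on_C5_rep[OF V that])
  have D0: "(V j has_vector_derivative V (Suc j) x) (at x within {0..1})" if "j < 5" "x \<in> {0..1}" for j x
    using V that unfolding C5_rep_def by blast
  have w: "wderiv j v = toL2 (V j)" if "j \<le> 5" for j
    using V that unfolding C5_rep_def by blast
  have "V 0 0 = 0" "V 1 0 = 0" using V unfolding C5_rep_def by auto
  then have *: "norm (wderiv j v) \<le> norm (wderiv (Suc j) v)" if "j = 0 \<or> j = 1" for j
    unfolding w[of j] using that
    by (subst (1 2) w) (auto intro!: poincare D0 c simp del: wderiv_0)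
  show "norm v \<le> norm (wderiv 1 v)" using *[of 0] by simp
  show "norm (wderiv 1 v) \<le> norm (wderiv 2 v)" using *[of 1] by (simp add: numeral_2_eq_2)
qed

text \<open>In the application \<open>Z\<close>, \<open>s\<close>, \<open>b\<close>,
  \<open>h\<close> are the norms of A w, (A w)_xx, H_x and w_xx. Unless Z <= h, eliminating
  \<open>b\<close> gives Z^3 <= 2 C h s^2. Then either Z^2 <= \<mu> s^2 and the first term on the
  right suffices, or \<mu> Z <= 2 C h and the second does.\<close>

lemma young_arith:
  fixes Z s b h C \<mu> :: real
  assumes nn: "0 \<le> Z" "0 \<le> s" "0 \<le> b" "0 \<le> h" and C: "1 \<le> C" and \<mu>: "0 \<le> \<mu>" "\<mu> \<le> 1"
    and 1: "Z\<^sup>2 \<le> s * b" and 2: "b\<^sup>2 \<le> C * h * (h + Z)"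
  shows "\<mu>\<^sup>2 * Z\<^sup>2 \<le> \<mu> ^ 3 * s\<^sup>2 + 4 * C\<^sup>2 * h\<^sup>2"
proof (cases "Z \<le> h")
  case True
  have "\<mu>\<^sup>2 * Z\<^sup>2 \<le> 1 * h\<^sup>2"
    using True nn \<mu> by (intro mult_mono power_mono power_le_one) auto
  also have "\<dots> \<le> 4 * C\<^sup>2 * h\<^sup>2"
    using power_mono[OF C, of 2] by (intro mult_right_mono) auto
  also have "\<dots> \<le> \<mu> ^ 3 * s\<^sup>2 + 4 * C\<^sup>2 * h\<^sup>2" using \<mu> by simp
  finally show ?thesis .
next
  case False
  then have Z: "0 < Z" using nn by linarith
  have "(Z\<^sup>2)\<^sup>2 \<le> (s * b)\<^sup>2" using 1 by (intro power_mono) auto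
  also have "\<dots> \<le> s\<^sup>2 * (C * h * (h + Z))"
    unfolding power_mult_distrib using 2 by (intro mult_left_mono) auto
  also have "\<dots> \<le> s\<^sup>2 * (C * h * (Z + Z))"
    using False nn C by (intro mult_left_mono mult_nonneg_nonneg) auto
  finally have "Z * (Z * Z\<^sup>2) \<le> Z * (2 * C * h * s\<^sup>2)" by (simp add: power2_eq_square mult_ac)
  then have 3: "Z * Z\<^sup>2 \<le> 2 * C * h * s\<^sup>2" using Z by (simp add: mult_le_cancel_left)
  show ?thesis
  proof (cases "Z\<^sup>2 \<le> \<mu> * s\<^sup>2")
    case True
    have "\<mu>\<^sup>2 * Z\<^sup>2 \<le> \<mu>\<^sup>2 * (\<mu> * s\<^sup>2)" using True by (intro mult_left_mono) auto
    also have "\<dots> \<le> \<mu> ^ 3 * s\<^sup>2 + 4 * C\<^sup>2 * h\<^sup>2" by (simp add: power2_eq_square power3_eq_cube)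
    finally show ?thesis .
  next
    case False
    have "\<mu> * (Z * Z\<^sup>2) \<le> 2 * C * h * (\<mu> * s\<^sup>2)"
      using mult_left_mono[OF 3 \<mu>(1)] by (simp add: mult_ac)
    also have "\<dots> \<le> 2 * C * h * Z\<^sup>2" using False nn C by (intro mult_left_mono) auto
    finally have "Z\<^sup>2 * (\<mu> * Z) \<le> Z\<^sup>2 * (2 * C * h)" by (simp add: mult_ac)
    then have "\<mu> * Z \<le> 2 * C * h" using Z by (simp add: mult_le_cancel_left)
    then have "(\<mu> * Z)\<^sup>2 \<le> (2 * C * h)\<^sup>2" using \<mu> nn by (intro power_mono) auto
    moreover have "0 \<le> \<mu> ^ 3 * s\<^sup>2" using \<mu> by simp
    ultimately show ?thesis by (simp add: power_mult_distrib)
  qed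
qed

text \<open>With \<open>H = v'' - v\<close> the equation reads \<open>z = H'''\<close>, and integrating by parts twice leaves only
  the first derivative of \<open>H\<close>.\<close>

lemma generator_interpolation:
  assumes V: "C5_rep \<alpha> v V" and z: "z = toL2 (\<lambda>x. V 5 x - V 3 x)" and Z: "C5_rep \<alpha> z Z"
    and \<mu>: "0 \<le> \<mu>" "\<mu> \<le> 1"
  shows "\<mu>\<^sup>2 * (norm z)\<^sup>2 \<le> \<mu> ^ 3 * (norm (wderiv 2 z))\<^sup>2 + 4 * 5760000\<^sup>2 * (norm (wderiv 2 v))\<^sup>2"
proof -
  have c: "continuous_on {0..1} (V j)" "continuous_on {0..1} (Z j)" if "j \<le> 5" for j
    using continuous_on_C5_rep[OF V that] continuous_on_C5_rep[OF Z that] .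
  have D: "(V j has_vector_derivative V (Suc j) x) (at x within {0..1})"
    "(Z j has_vector_derivative Z (Suc j) x) (at x within {0..1})" if "j < 5" "x \<in> {0..1}" for j x
    using V Z that unfolding C5_rep_def by blast+
  have w: "wderiv j v = toL2 (V j)" "wderiv j z = toL2 (Z j)" if "j \<le> 5" for j
    using V Z that unfolding C5_rep_def by blast+
  define H where "H j x = V (j + 2) x - V j x" for j x
  have HD: "(H j has_vector_derivative H (Suc j) x) (at x within {0..1})" if "j < 3" "x \<in> {0..1}" for j x
    unfolding H_def using D(1)[of "j + 2" x] D(1)[of j x] that by (intro has_vector_derivative_diff) auto
  have Hc: "continuous_on {0..1} (H j)" if "j \<le> 3" for j
    unfolding H_def using that by (intro continuous_intros c) auto
  have H3: "H 3 = (\<lambda>x. V 5 x - V 3 x)" by (simp add: H_def fun_eq_iff)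
  have zZ: "toL2 (Z 0) = toL2 (H 3)" using w(2)[of 0] z by (simp add: H3)
  have Z0: "Z 0 x = H 3 x" if "x \<in> {0..1}" for x
    by (rule continuous_toL2_eq[OF c(2) Hc zZ that]) auto
  have bc: "Z 0 0 = 0" "Z 0 1 = 0" "Z 1 0 = 0" "Z 1 1 = 0" using Z unfolding C5_rep_def by auto
  have nz: "norm z = nrm (H 3)" "norm z = nrm (Z 0)" using z w(2)[of 0] by (simp_all add: H3)
  \<comment> \<open>Both boundary terms carry a factor Z or Z', which vanish at the two ends;
    nothing is known there about \<open>H 1\<close> and \<open>H 2\<close>.\<close>
  have "integral {0..1} (\<lambda>x. (Z 0 x \<bullet> H 3 x + Z 1 x \<bullet> H 2 x) - (Z 1 x \<bullet> H 2 x + Z 2 x \<bullet> H 1 x))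
      = (\<lambda>x. Z 0 x \<bullet> H 2 x - Z 1 x \<bullet> H 1 x) 1 - (\<lambda>x. Z 0 x \<bullet> H 2 x - Z 1 x \<bullet> H 1 x) 0"
  proof (rule FTC_real)
    fix x :: real assume x: "x \<in> {0..1}"
    have e: "Suc 2 = 3" "Suc 1 = 2" "Suc 0 = 1" by simp_all
    show "((\<lambda>x. Z 0 x \<bullet> H 2 x - Z 1 x \<bullet> H 1 x) has_real_derivative
        (Z 0 x \<bullet> H 3 x + Z 1 x \<bullet> H 2 x) - (Z 1 x \<bullet> H 2 x + Z 2 x \<bullet> H 1 x)) (at x within {0..1})"
      using HD[of 2 x] HD[of 1 x] D(2)[of 0 x] D(2)[of 1 x] x
      by (intro DERIV_diff DERIV_inner) (simp_all only: e; simp)+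
  qed
  then have "integral {0..1} (\<lambda>x. Z 0 x \<bullet> H 3 x - Z 2 x \<bullet> H 1 x) = 0"
    by (simp add: bc bc[unfolded One_nat_def])
  moreover have "integral {0..1} (\<lambda>x. Z 0 x \<bullet> H 3 x - Z 2 x \<bullet> H 1 x)
      = integral {0..1} (\<lambda>x. Z 0 x \<bullet> H 3 x) - integral {0..1} (\<lambda>x. Z 2 x \<bullet> H 1 x)"
    by (intro hk_integral_diff integrable_continuous_real continuous_intros c Hc) auto
  moreover have "integral {0..1} (\<lambda>x. Z 0 x \<bullet> H 3 x) = (norm z)\<^sup>2"
    unfolding nz(1) nrm_sq[OF Hc[OF order_refl]]
    by (intro hk_integral_cong) (simp add: Z0)
  moreover have "\<bar>integral {0..1} (\<lambda>x. Z 2 x \<bullet> H 1 x)\<bar> \<le> nrm (Z 2) * nrm (H 1)"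
    by (intro integral_inner_le_nrm c Hc) auto
  ultimately have 1: "(norm z)\<^sup>2 \<le> norm (wderiv 2 z) * nrm (H 1)"
    using w(2)[of 2] by simp
  have nH: "nrm (H 0) \<le> 2 * norm (wderiv 2 v)"
  proof -
    have "toL2 (H 0) = wderiv 2 v - v"
      using w(1)[of 2] w(1)[of 0] toL2_diff[of "V 2" "V 0"]
      by (simp add: H_def[abs_def] sq_integrable_continuous c numeral_2_eq_2)
    then have "nrm (H 0) \<le> norm (wderiv 2 v) + norm v" by (simp add: norm_triangle_ineq4)
    then show ?thesis using C5_rep_poincare[OF V] by linarith
  qed
  have e: "Suc 2 = 3" "Suc 1 = 2" "Suc 0 = 1" by simp_all
  have "(nrm (H 1))\<^sup>2 \<le> 1440000 * nrm (H 0) * (nrm (H 0) + nrm (H 3))"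
    using HD[of 2, unfolded e] HD[of 1, unfolded e] HD[of 0, unfolded e] Hc[of 3]
    by (intro interpolation_H3) auto
  \<comment> \<open>The factor 2 of \<open>nH\<close> enters twice, so the constant becomes 4 times
    1440000.\<close>
  also have "\<dots> \<le> 1440000 * (2 * norm (wderiv 2 v)) * (2 * norm (wderiv 2 v) + 2 * norm z)"
    using nH nz(1) by (intro mult_mono add_mono mult_nonneg_nonneg) auto
  also have "\<dots> = 5760000 * norm (wderiv 2 v) * (norm (wderiv 2 v) + norm z)"
    by (simp add: algebra_simps)
  finally have 2: "(nrm (H 1))\<^sup>2 \<le> 5760000 * norm (wderiv 2 v) * (norm (wderiv 2 v) + norm z)" .
  show ?thesis
    by (rule young_arith[OF _ _ _ _ _ \<mu> 1 2]) auto
qed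

section \<open>Contraction semigroups on a Banach space\<close>

text \<open>Links the difference quotients that define the generator with
  \<open>has_vector_derivative\<close>, which is defined by linear approximation.\<close>

lemma has_vector_derivative_iff_quotient:
  "(f has_vector_derivative D) (at x within A) \<longleftrightarrow>
    ((\<lambda>y. (1 / (y - x)) *\<^sub>R (f y - f x)) \<longlongrightarrow> D) (at x within A)"
proof -
  have "(f has_vector_derivative D) (at x within A) \<longleftrightarrow>
      ((\<lambda>y. (1 / norm (y - x)) *\<^sub>R (f y - (f x + (y - x) *\<^sub>R D))) \<longlongrightarrow> 0) (at x within A)"
    unfolding has_vector_derivative_def has_derivative_within
    by (auto intro: bounded_linear_scaleR_left)
  also have "\<dots> \<longleftrightarrow> ((\<lambda>y. norm ((1 / norm (y - x)) *\<^sub>R (f y - (f x + (y - x) *\<^sub>R D)))) \<longlongrightarrow> 0) (at x within A)"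
    by (rule tendsto_norm_zero_iff[symmetric])
  also have "\<dots> \<longleftrightarrow> ((\<lambda>y. norm ((1 / (y - x)) *\<^sub>R (f y - f x) - D)) \<longlongrightarrow> 0) (at x within A)"
  proof (rule tendsto_cong)
    have "norm ((1 / norm (y - x)) *\<^sub>R (f y - (f x + (y - x) *\<^sub>R D))) = norm ((1 / (y - x)) *\<^sub>R (f y - f x) - D)"
      if "y \<noteq> x" for y
    proof -
      have "(1 / (y - x)) *\<^sub>R (f y - f x) - D = (1 / (y - x)) *\<^sub>R (f y - (f x + (y - x) *\<^sub>R D))"
        using that by (simp add: scaleR_right_diff_distrib scaleR_right_distrib)
      then show ?thesis by simp
    qed
    then show "\<forall>\<^sub>F y in at x within A. norm ((1 / norm (y - x)) *\<^sub>R (f y - (f x + (y - x) *\<^sub>R D)))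
        = norm ((1 / (y - x)) *\<^sub>R (f y - f x) - D)"
      by (auto simp: eventually_at_filter)
  qed
  also have "\<dots> \<longleftrightarrow> ((\<lambda>y. (1 / (y - x)) *\<^sub>R (f y - f x) - D) \<longlongrightarrow> 0) (at x within A)"
    by (rule tendsto_norm_zero_iff)
  also have "\<dots> \<longleftrightarrow> ((\<lambda>y. (1 / (y - x)) *\<^sub>R (f y - f x)) \<longlongrightarrow> D) (at x within A)"
    by (rule LIM_zero_iff)
  finally show ?thesis .
qed

lemma has_vector_derivative_right_quotient:
  assumes "(f has_vector_derivative D) (at x within {x..b})" "x < b"
  shows "((\<lambda>h. (1 / h) *\<^sub>R (f (x + h) - f x)) \<longlongrightarrow> D) (at_right 0)"
proof -
  have "at x within {x..b} = at_right x" using assms(2) by (rule at_within_Icc_at_right)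
  then have "((\<lambda>y. (1 / (y - x)) *\<^sub>R (f y - f x)) \<longlongrightarrow> D) (at_right x)"
    using assms(1) unfolding has_vector_derivative_iff_quotient by simp
  then show ?thesis
    by (subst (asm) filterlim_at_right_to_0) (simp add: add.commute)
qed

text \<open>Holds without integrability: the two integrands are integrable together, and otherwise
  both integrals have the same default value.\<close>

lemma integral_shift_real:
  fixes f :: "real \<Rightarrow> 'a::banach"
  shows "integral {a..b} (\<lambda>s. f (s + c)) = integral {a + c..b + c} f"
proof -
  have iff: "((\<lambda>s. f (s + c)) has_integral I) {a..b} \<longleftrightarrow> (f has_integral I) {a + c..b + c}" for I
    using has_integral_affinity_iff[of 1 f c I "a + c" "b + c"] by simp
  then have "(\<lambda>s. f (s + c)) integrable_on {a..b} \<longleftrightarrow> f integrable_on {a + c..b + c}"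
    by (simp add: integrable_on_def)
  with iff show ?thesis
    by (metis (no_types) integrable_integral integral_unique not_integrable_integral)
qed

locale contraction_semigroup =
  fixes S :: "real \<Rightarrow> 'a::banach \<Rightarrow> 'a"
  assumes S_add: "0 \<le> t \<Longrightarrow> S t (v + w) = S t v + S t w"
    and S_scaleR: "0 \<le> t \<Longrightarrow> S t (c *\<^sub>R v) = c *\<^sub>R S t v"
    and S_norm: "0 \<le> t \<Longrightarrow> norm (S t v) \<le> norm v"
    and S_0 [simp]: "S 0 v = v"
    and S_plus: "0 \<le> t \<Longrightarrow> 0 \<le> s \<Longrightarrow> S (t + s) v = S t (S s v)"
    and S_cont_0: "((\<lambda>t. S t v) \<longlongrightarrow> v) (at_right 0)"
begin

definition gen :: "('a \<times> 'a) set" where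
  "gen = {(v, w). ((\<lambda>h. (1 / h) *\<^sub>R (S h v - v)) \<longlongrightarrow> w) (at_right 0)}"

lemma bounded_linear_S: "0 \<le> t \<Longrightarrow> bounded_linear (S t)"
  by (rule bounded_linear_intro[of _ 1]) (auto simp: S_add S_scaleR S_norm)

lemma S_diff: "0 \<le> t \<Longrightarrow> S t (v - w) = S t v - S t w"
  by (intro linear_diff bounded_linear.linear bounded_linear_S)

lemma S_commute: "0 \<le> t \<Longrightarrow> 0 \<le> s \<Longrightarrow> S t (S s v) = S s (S t v)"
  by (metis S_plus add.commute)

lemma continuous_on_S: "continuous_on {0..} (\<lambda>t. S t v)"
  unfolding continuous_on_iff
proof (intro ballI allI impI)
  fix t e :: real assume "0 < e"
  have "\<forall>\<^sub>F h in at_right 0. dist (S h v) v < e"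
    using tendstoD[OF S_cont_0 \<open>0 < e\<close>] .
  then obtain d where d: "d > 0" "\<And>h. 0 < h \<Longrightarrow> h < d \<Longrightarrow> dist (S h v) v < e"
    unfolding eventually_at_right_field by auto
  have *: "dist (S s v) (S t v) < e" if "0 \<le> t" "t \<le> s" "s - t < d" for s t
  proof (cases "s = t")
    case False
    have "S s v - S t v = S t (S (s - t) v - v)"
      using that S_plus[of t "s - t" v] by (simp add: S_diff)
    then have "dist (S s v) (S t v) \<le> dist (S (s - t) v) v"
      using that S_norm[of t] by (simp add: dist_norm)
    then show ?thesis using d(2)[of "s - t"] that False by auto
  qed (use \<open>0 < e\<close> in simp)
  show "\<exists>d>0. \<forall>s\<in>{0..}. dist s t < d \<longrightarrow> dist (S s v) (S t v) < e" if "t \<in> {0..}"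
  proof (intro exI[of _ d] conjI ballI impI d(1))
    fix s assume "s \<in> {0..}" "dist s t < d"
    then show "dist (S s v) (S t v) < e"
      using *[of t s] *[of s t] that by (cases "t \<le> s") (auto simp: dist_real_def dist_commute)
  qed
qed

text \<open>Strong continuity handles the time for the fixed vector \<open>b\<close>, and
  contractivity bounds S (f x) (g x - b) uniformly in the time. This joint continuity is used
  whenever operator and argument vary together.\<close>

lemma tendsto_S:
  assumes f: "(f \<longlongrightarrow> a) F" and nn: "\<forall>\<^sub>F x in F. 0 \<le> f x" "0 \<le> a" and g: "(g \<longlongrightarrow> b) F"
  shows "((\<lambda>x. S (f x) (g x)) \<longlongrightarrow> S a b) F"
proof -
  have "((\<lambda>t. S t b) \<longlongrightarrow> S a b) (at a within {0..})"
    using continuous_on_S[of b] nn(2) unfolding continuous_on_def by auto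
  then have 1: "((\<lambda>x. S (f x) b) \<longlongrightarrow> S a b) F"
    by (rule continuous_within_tendsto_compose[OF _ _ f, unfolded continuous_within])
      (use nn in auto)
  have "((\<lambda>x. S (f x) (g x - b)) \<longlongrightarrow> 0) F"
  proof (rule Lim_null_comparison)
    show "\<forall>\<^sub>F x in F. norm (S (f x) (g x - b)) \<le> norm (g x - b)"
      using nn(1) by eventually_elim (rule S_norm)
    show "((\<lambda>x. norm (g x - b)) \<longlongrightarrow> 0) F"
      using g by (intro tendsto_norm_zero LIM_zero)
  qed
  from tendsto_add[OF 1 this] have "((\<lambda>x. S (f x) b + S (f x) (g x - b)) \<longlongrightarrow> S a b) F" by simp
  moreover have "\<forall>\<^sub>F x in F. S (f x) b + S (f x) (g x - b) = S (f x) (g x)"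
    using nn(1) by eventually_elim (simp add: S_diff)
  ultimately show ?thesis by (rule Lim_transform_eventually)
qed

lemma continuous_on_S_compose:
  assumes "continuous_on A f" "continuous_on A g" "\<And>x. x \<in> A \<Longrightarrow> 0 \<le> f x"
  shows "continuous_on A (\<lambda>x. S (f x) (g x))"
  using assms unfolding continuous_on_def
  by (auto intro!: tendsto_S simp: eventually_at_filter)

lemma gen_S:
  assumes "(v, w) \<in> gen" "0 \<le> t"
  shows "(S t v, S t w) \<in> gen"
proof -
  have "((\<lambda>h. S t ((1 / h) *\<^sub>R (S h v - v))) \<longlongrightarrow> S t w) (at_right 0)"
    using assms unfolding gen_def by (intro bounded_linear.tendsto[OF bounded_linear_S]) auto
  moreover have "\<forall>\<^sub>F h in at_right 0. S t ((1 / h) *\<^sub>R (S h v - v)) = (1 / h) *\<^sub>R (S h (S t v) - S t v)"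
    using eventually_at_right_less[of "0::real"]
    by eventually_elim (use assms in \<open>simp add: S_scaleR S_diff S_commute[of t]\<close>)
  ultimately show ?thesis
    unfolding gen_def by (auto intro: Lim_transform_eventually)
qed

lemma gen_add: "(v, w) \<in> gen \<Longrightarrow> (v', w') \<in> gen \<Longrightarrow> (v + v', w + w') \<in> gen"
proof -
  assume "(v, w) \<in> gen" "(v', w') \<in> gen"
  then have "((\<lambda>h. (1 / h) *\<^sub>R (S h v - v) + (1 / h) *\<^sub>R (S h v' - v')) \<longlongrightarrow> w + w') (at_right 0)"
    unfolding gen_def by (intro tendsto_add) auto
  moreover have "\<forall>\<^sub>F h in at_right 0. (1 / h) *\<^sub>R (S h v - v) + (1 / h) *\<^sub>R (S h v' - v')
      = (1 / h) *\<^sub>R (S h (v + v') - (v + v'))"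
    using eventually_at_right_less[of "0::real"]
    by eventually_elim (simp add: S_add algebra_simps flip: scaleR_add_right)
  ultimately show ?thesis
    unfolding gen_def by (auto intro: Lim_transform_eventually)
qed

lemma gen_scaleR: "(v, w) \<in> gen \<Longrightarrow> (c *\<^sub>R v, c *\<^sub>R w) \<in> gen"
proof -
  assume "(v, w) \<in> gen"
  then have "((\<lambda>h. c *\<^sub>R (1 / h) *\<^sub>R (S h v - v)) \<longlongrightarrow> c *\<^sub>R w) (at_right 0)"
    unfolding gen_def by (intro tendsto_scaleR tendsto_const) auto
  moreover have "\<forall>\<^sub>F h in at_right 0. c *\<^sub>R (1 / h) *\<^sub>R (S h v - v) = (1 / h) *\<^sub>R (S h (c *\<^sub>R v) - c *\<^sub>R v)"
    using eventually_at_right_less[of "0::real"]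
    by eventually_elim (simp add: S_scaleR scaleR_right_diff_distrib mult.commute)
  ultimately show ?thesis
    unfolding gen_def by (auto intro: Lim_transform_eventually)
qed

lemma gen_diff: "(v, w) \<in> gen \<Longrightarrow> (v', w') \<in> gen \<Longrightarrow> (v - v', w - w') \<in> gen"
  using gen_add[of v w "-v'" "-w'"] gen_scaleR[of v' w' "-1"] by simp

text \<open>The generator only provides a right derivative at time 0. The right quotient at
  \<open>t\<close> is its image under the fixed operator S t; the left quotient needs an operator
  that varies.\<close>

lemma S_has_vector_derivative:
  assumes vw: "(v, w) \<in> gen" and t: "0 < t"
  shows "((\<lambda>t. S t v) has_vector_derivative S t w) (at t)"
  unfolding has_vector_derivative_iff_quotient filterlim_split_at
proof (rule filterlim_split_at)
  let ?q = "\<lambda>h. (1 / h) *\<^sub>R (S h v - v)"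
  have q: "(?q \<longlongrightarrow> w) (at_right 0)" using vw by (simp add: gen_def)
  have r: "filterlim (\<lambda>y. y - t) (at_right 0) (at_right t)"
    by (subst filterlim_at_right_to_0) (simp add: filterlim_ident)
  have "((\<lambda>y. S t (?q (y - t))) \<longlongrightarrow> S t w) (at_right t)"
    using t by (intro bounded_linear.tendsto[OF bounded_linear_S] filterlim_compose[OF q r]) auto
  moreover have "\<forall>\<^sub>F y in at_right t. S t (?q (y - t)) = (1 / (y - t)) *\<^sub>R (S y v - S t v)"
    using eventually_at_right_less[of t]
  proof eventually_elim
    case (elim y)
    then show ?case using t S_plus[of t "y - t" v] by (simp add: S_scaleR S_diff)
  qed
  ultimately show "((\<lambda>y. (1 / (y - t)) *\<^sub>R (S y v - S t v)) \<longlongrightarrow> S t w) (at_right t)"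
    by (rule Lim_transform_eventually)
  \<comment> \<open>From the left, the quotient is S y applied to the quotient at 0 with step t - y,
    so \<open>tendsto_S\<close> replaces the continuity of a single operator.\<close>
  have l: "filterlim (\<lambda>y. t - y) (at_right 0) (at_left t)"
    by (subst filterlim_at_left_to_right, subst filterlim_at_right_to_0) (simp add: filterlim_ident)
  have lt: "\<forall>\<^sub>F y in at_left t. y < t" by (simp add: eventually_at_filter)
  have pos: "\<forall>\<^sub>F y in at_left t. 0 \<le> y"
    using t by (auto simp: eventually_at_left_field intro!: exI[of _ 0])
  have "((\<lambda>y. S y (?q (t - y))) \<longlongrightarrow> S t w) (at_left t)"
    using t pos by (intro tendsto_S filterlim_compose[OF q l] tendsto_ident_at) auto
  moreover have "\<forall>\<^sub>F y in at_left t. S y (?q (t - y)) = (1 / (y - t)) *\<^sub>R (S y v - S t v)"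
    using pos lt
  proof eventually_elim
    case (elim y)
    have "1 / (y - t) = - (1 / (t - y))" using elim by (simp add: divide_simps)
    then have "(1 / (y - t)) *\<^sub>R (S y v - S t v) = (1 / (t - y)) *\<^sub>R (S t v - S y v)"
      by (simp only:) (simp add: scaleR_right_diff_distrib)
    then show ?case using elim S_plus[of y "t - y" v] by (simp add: S_scaleR S_diff)
  qed
  ultimately show "((\<lambda>y. (1 / (y - t)) *\<^sub>R (S y v - S t v)) \<longlongrightarrow> S t w) (at_left t)"
    by (rule Lim_transform_eventually)
qed

section \<open>Mollification along orbits and density of the domain of the cube of the
  generator\<close>

lemma S_integrable: "0 \<le> a \<Longrightarrow> (\<lambda>s. S s v) integrable_on {a..b}"
  by (intro integrable_continuous_real continuous_on_subset[OF continuous_on_S]) auto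

text \<open>Averaging over a short piece of the orbit: it gains one step in the domain of the
  generator, commutes with the semigroup and does not increase the norm.\<close>

definition mollify :: "real \<Rightarrow> 'a \<Rightarrow> 'a" where
  "mollify h v = (1 / h) *\<^sub>R integral {0..h} (\<lambda>s. S s v)"

lemma S_mollify: "0 \<le> t \<Longrightarrow> S t (mollify h v) = mollify h (S t v)"
proof -
  assume t: "0 \<le> t"
  have "integral {0..h} (S t \<circ> (\<lambda>s. S s v)) = S t (integral {0..h} (\<lambda>s. S s v))"
    by (intro integral_linear bounded_linear_S t S_integrable) simp
  moreover have "integral {0..h} (S t \<circ> (\<lambda>s. S s v)) = integral {0..h} (\<lambda>s. S s (S t v))"
    using t by (intro hk_integral_cong) (simp add: S_commute)
  ultimately show ?thesis using t by (simp add: mollify_def S_scaleR)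
qed

lemma mollify_diff: "mollify h (v - w) = mollify h v - mollify h w"
proof -
  have "integral {0..h} (\<lambda>s. S s (v - w)) = integral {0..h} (\<lambda>s. S s v - S s w)"
    by (intro hk_integral_cong) (simp add: S_diff)
  then show ?thesis
    by (simp add: mollify_def hk_integral_diff S_integrable scaleR_right_diff_distrib)
qed

lemma mollify_scaleR: "mollify h (c *\<^sub>R v) = c *\<^sub>R mollify h v"
proof -
  have "integral {0..h} (\<lambda>s. S s (c *\<^sub>R v)) = integral {0..h} (\<lambda>s. c *\<^sub>R S s v)"
    by (intro hk_integral_cong) (simp add: S_scaleR)
  then show ?thesis by (simp add: mollify_def)
qed

lemma norm_mollify_le: "0 < h \<Longrightarrow> norm (mollify h v) \<le> norm v"
proof -
  assume h: "0 < h"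
  have "norm (integral {0..h} (\<lambda>s. S s v)) \<le> integral {0..h} (\<lambda>s. norm v)"
    by (intro integral_norm_bound_integral S_integrable integrable_continuous_real continuous_intros S_norm) auto
  then show ?thesis using h by (simp add: mollify_def field_simps)
qed

lemma mollify_tendsto: "((\<lambda>h. mollify h v) \<longlongrightarrow> v) (at_right 0)"
proof -
  have "((\<lambda>u. integral {0..u} (\<lambda>s. S s v)) has_vector_derivative S 0 v) (at 0 within {0..1})"
    by (intro integral_has_vector_derivative continuous_on_subset[OF continuous_on_S]) auto
  from has_vector_derivative_right_quotient[OF this] show ?thesis
    by (simp add: mollify_def)
qed

text \<open>With F the primitive of the orbit, S k (F h) = F (h + k) - F k. The quotient for F h is
  thus a difference of two quotients of F, at \<open>h\<close> and at 0, which tend to S h v and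
  v.\<close>

lemma mollify_gen:
  assumes h: "0 < h"
  shows "(mollify h v, (1 / h) *\<^sub>R (S h v - v)) \<in> gen"
proof -
  define F where "F u = integral {0..u} (\<lambda>s. S s v)" for u
  have c: "continuous_on {0..b} (\<lambda>s. S s v)" for b
    by (rule continuous_on_subset[OF continuous_on_S]) auto
  have "(F has_vector_derivative S h v) (at h within {0..h + 1})"
    unfolding F_def using h by (intro integral_has_vector_derivative c) auto
  then have "(F has_vector_derivative S h v) (at h within {h..h + 1})"
    by (rule has_vector_derivative_within_subset) (use h in auto)
  from has_vector_derivative_right_quotient[OF this]
  have 1: "((\<lambda>k. (1 / k) *\<^sub>R (F (h + k) - F h)) \<longlongrightarrow> S h v) (at_right 0)" by simp
  have "(F has_vector_derivative S 0 v) (at 0 within {0..1})"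
    unfolding F_def by (intro integral_has_vector_derivative c) auto
  from has_vector_derivative_right_quotient[OF this]
  have 2: "((\<lambda>k. (1 / k) *\<^sub>R F k) \<longlongrightarrow> v) (at_right 0)" by (simp add: F_def)
  have "((\<lambda>k. (1 / h) *\<^sub>R ((1 / k) *\<^sub>R (F (h + k) - F h) - (1 / k) *\<^sub>R F k)) \<longlongrightarrow> (1 / h) *\<^sub>R (S h v - v)) (at_right 0)"
    by (intro tendsto_scaleR tendsto_const tendsto_diff 1 2)
  moreover have "\<forall>\<^sub>F k in at_right 0. (1 / h) *\<^sub>R ((1 / k) *\<^sub>R (F (h + k) - F h) - (1 / k) *\<^sub>R F k)
      = (1 / k) *\<^sub>R (S k (mollify h v) - mollify h v)"
    using eventually_at_right_less[of "0::real"]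
  proof eventually_elim
    case (elim k)
    have "S k (F h) = integral {0..h} (S k \<circ> (\<lambda>s. S s v))"
      unfolding F_def using elim h by (intro integral_linear[symmetric] bounded_linear_S S_integrable) auto
    also have "\<dots> = integral {0..h} (\<lambda>s. S (s + k) v)"
      using elim by (intro hk_integral_cong) (simp add: S_plus[symmetric] add.commute)
    also have "\<dots> = integral {k..h + k} (\<lambda>s. S s v)"
      using integral_shift_real[of 0 h "\<lambda>s. S s v" k] by simp
    also have "\<dots> = F (h + k) - F k"
      using hk_integral_combine[of 0 k "h + k" "\<lambda>s. S s v"] elim h
      by (simp add: F_def S_integrable algebra_simps)
    finally have "S k (mollify h v) - mollify h v = (1 / h) *\<^sub>R (F (h + k) - F k - F h)"
      using elim by (simp add: mollify_def S_scaleR F_def[symmetric] scaleR_right_diff_distrib)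
    then show ?case by (simp add: scaleR_right_diff_distrib mult.commute)
  qed
  ultimately show ?thesis
    unfolding gen_def by (auto intro: Lim_transform_eventually)
qed

text \<open>Three mollifications, each moving the vector by less than e/3 because the outer ones are
  contractions. Applying the generator turns one \<open>mollify h\<close> into the bounded operator
  \<open>?D\<close>, which commutes with the others. The cube is needed since A w must have a
  classical representative as well as w.\<close>

lemma gen_cubed_dense:
  assumes e: "0 < e"
  obtains v0 v1 v2 v3 where "norm (v0 - v) < e" "(v0, v1) \<in> gen" "(v1, v2) \<in> gen" "(v2, v3) \<in> gen"
proof -
  have "\<forall>\<^sub>F h in at_right 0. dist (mollify h v) v < e / 3 \<and> 0 < h"
    using tendstoD[OF mollify_tendsto, of "e / 3" v] e
    by (intro eventually_conj eventually_at_right_less) auto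
  then obtain h where h: "0 < h" "norm (mollify h v - v) < e / 3"
    by (metis (no_types, lifting) dist_norm eventually_happens' trivial_limit_at_right_real)
  let ?D = "\<lambda>u. (1 / h) *\<^sub>R (S h u - u)"
  have comm: "?D (mollify h u) = mollify h (?D u)" for u
    using h by (simp add: mollify_scaleR mollify_diff S_mollify)
  have "norm (mollify h (mollify h v) - v) < e / 3 + e / 3"
    using norm_mollify_le[OF h(1), of "mollify h v - v"] h(2)
      norm_triangle_ineq[of "mollify h (mollify h v) - mollify h v" "mollify h v - v"] by (simp add: mollify_diff)
  then have "norm (mollify h (mollify h (mollify h v)) - v) < e"
    using norm_mollify_le[OF h(1), of "mollify h (mollify h v) - v"] h(2)
      norm_triangle_ineq[of "mollify h (mollify h (mollify h v)) - mollify h v" "mollify h v - v"] by (simp add: mollify_diff)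
  moreover have "(mollify h (mollify h (mollify h v)), mollify h (mollify h (?D v))) \<in> gen"
    using mollify_gen[OF h(1), of "mollify h (mollify h v)"] by (simp only: comm)
  moreover have "(mollify h (mollify h (?D v)), mollify h (?D (?D v))) \<in> gen"
    using mollify_gen[OF h(1), of "mollify h (?D v)"] by (simp only: comm)
  moreover have "(mollify h (?D (?D v)), ?D (?D (?D v))) \<in> gen"
    by (rule mollify_gen[OF h(1)])
  ultimately show ?thesis using that by blast
qed

lemma gen_cubed_dense_sequence:
  obtains w where "w \<longlonglongrightarrow> v"
    "\<forall>n. \<exists>v1 v2 v3. (w n, v1) \<in> gen \<and> (v1, v2) \<in> gen \<and> (v2, v3) \<in> gen"
proof -
  have "\<exists>u. norm (u - v) < 1 / real (Suc n) \<and>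
      (\<exists>v1 v2 v3. (u, v1) \<in> gen \<and> (v1, v2) \<in> gen \<and> (v2, v3) \<in> gen)" for n
    by (rule gen_cubed_dense[of "1 / real (Suc n)" v]) auto
  then have "\<forall>n. \<exists>u. norm (u - v) < 1 / real (Suc n) \<and>
      (\<exists>v1 v2 v3. (u, v1) \<in> gen \<and> (v1, v2) \<in> gen \<and> (v2, v3) \<in> gen)" by blast
  from choice[OF this] obtain w where w: "\<And>n. norm (w n - v) < 1 / real (Suc n)"
    "\<And>n. \<exists>v1 v2 v3. (w n, v1) \<in> gen \<and> (v1, v2) \<in> gen \<and> (v2, v3) \<in> gen"
    by blast
  have "(\<lambda>n. w n - v) \<longlonglongrightarrow> 0"
    by (rule Lim_null_comparison[OF _ LIMSEQ_Suc[OF lim_1_over_n]])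
      (intro always_eventually allI less_imp_le w(1))
  then show ?thesis using that LIM_zero_cancel w(2) by blast
qed

end

section \<open>Smoothing and decay of the semigroup\<close>

text \<open>Comparable to \<open>t\<^sup>-\<^sup>3\<^sup>/\<^sup>4\<close> for \<open>t \<le> 1\<close> and to \<open>t\<^sup>-\<^sup>5\<^sup>/\<^sup>4\<close> for \<open>t \<ge> 1\<close>, with a bounded primitive.\<close>

definition kern :: "real \<Rightarrow> real" where
  "kern t = 1 / (4 * sqrt (sqrt t) ^ 3 * (1 + sqrt (sqrt t))\<^sup>2)"

text \<open>With s = t^(1/4) this is s/(1 + s), and ds/dt = 1/(4 s^3); hence the factors of
  \<open>kern\<close>, whose total mass is 1.\<close>

definition Kern :: "real \<Rightarrow> real" where
  "Kern t = sqrt (sqrt t) / (1 + sqrt (sqrt t))"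

lemma kern_pos: "0 < t \<Longrightarrow> 0 < kern t"
  by (auto simp: kern_def intro!: mult_pos_pos zero_less_power add_pos_pos)

lemma Kern_deriv:
  assumes "0 < t" shows "(Kern has_real_derivative kern t) (at t within A)"
proof -
  define s where "s = sqrt (sqrt t)"
  have s: "0 < s" "sqrt t = s\<^sup>2" using assms by (auto simp: s_def)
  have "(Kern has_real_derivative ((1 / (2 * s)) * (1 / (2 * s\<^sup>2)) * (1 + s) - s * ((1 / (2 * s)) * (1 / (2 * s\<^sup>2)))) / (1 + s)\<^sup>2) (at t)"
    unfolding Kern_def[abs_def] using assms s
    by (auto intro!: derivative_eq_intros simp: s_def[symmetric] divide_simps power2_eq_square)
  also have "((1 / (2 * s)) * (1 / (2 * s\<^sup>2)) * (1 + s) - s * ((1 / (2 * s)) * (1 / (2 * s\<^sup>2)))) / (1 + s)\<^sup>2 = kern t"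
    unfolding kern_def s_def[symmetric] using s
    by (simp add: divide_simps power2_eq_square power3_eq_cube)
  finally show ?thesis by (rule has_field_derivative_at_within)
qed

lemma kern_has_integral:
  assumes "0 < a" "a \<le> b" shows "(kern has_integral (Kern b - Kern a)) {a..b}"
  using assms(2)
  by (rule fundamental_theorem_of_calculus)
    (use assms in \<open>auto simp flip: has_real_derivative_iff_has_vector_derivative intro!: Kern_deriv\<close>)

lemma Kern_bounds: "0 < t \<Longrightarrow> 0 \<le> Kern t \<and> Kern t \<le> 1"
proof -
  assume "0 < t"
  then have "0 < sqrt (sqrt t)" by simp
  moreover have "0 \<le> s / (1 + s) \<and> s / (1 + s) \<le> 1" if "0 < s" for s :: real
    using that by (simp add: divide_le_eq_1)
  ultimately show ?thesis unfolding Kern_def by blast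
qed

lemma Kern_tendsto_0: "(\<lambda>n. Kern (1 / real (Suc n))) \<longlonglongrightarrow> 0"
proof -
  have "(\<lambda>n. 1 / real (Suc n)) \<longlonglongrightarrow> 0" by (rule LIMSEQ_Suc[OF lim_1_over_n])
  then have "(\<lambda>n. Kern (1 / real (Suc n))) \<longlonglongrightarrow> sqrt (sqrt 0) / (1 + sqrt (sqrt 0))"
    unfolding Kern_def by (intro tendsto_intros) auto
  then show ?thesis by simp
qed

lemma Kern_tendsto_1: "(\<lambda>n. Kern (real (Suc n))) \<longlonglongrightarrow> 1"
proof -
  have "filterlim (\<lambda>n. 1 + sqrt (sqrt (real (Suc n)))) at_top sequentially"
    by (intro filterlim_tendsto_add_at_top[OF tendsto_const] filterlim_compose[OF sqrt_at_top]
        filterlim_compose[OF filterlim_real_sequentially filterlim_Suc])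
  then have "(\<lambda>n. 1 / (1 + sqrt (sqrt (real (Suc n))))) \<longlonglongrightarrow> 0"
    by (intro real_tendsto_divide_at_top[OF tendsto_const])
  then have "(\<lambda>n. 1 - 1 / (1 + sqrt (sqrt (real (Suc n))))) \<longlonglongrightarrow> 1 - 0"
    by (intro tendsto_intros)
  moreover have "Kern (real (Suc n)) = 1 - 1 / (1 + sqrt (sqrt (real (Suc n))))" for n
  proof -
    have "0 < 1 + sqrt (sqrt (real (Suc n)))" by (intro add_pos_nonneg) auto
    then show ?thesis unfolding Kern_def by (simp add: field_simps)
  qed
  ultimately show ?thesis by simp
qed

text \<open>The cube of x/3 <= exp(x/3). The power 3 is enough because the square of
  \<open>kern\<close> decays only like t^(-5/2).\<close>

lemma exp_minus_le_inverse_cube: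
  fixes x :: real assumes "0 < x" shows "exp (- x) \<le> 27 / x ^ 3"
proof -
  have "x / 3 \<le> exp (x / 3)" using exp_ge_add_one_self[of "x / 3"] by linarith
  then have "(x / 3) ^ 3 \<le> exp (x / 3) ^ 3" using assms by (intro power_mono) auto
  also have "exp (x / 3) ^ 3 = exp x" by (simp flip: exp_of_nat_mult)
  finally have "x ^ 3 / 27 \<le> exp x" by (simp add: power_divide)
  then show ?thesis using assms by (simp add: exp_minus field_simps)
qed

locale kawahara =
  fixes \<alpha> :: real and S :: "real \<Rightarrow> L2I \<Rightarrow> L2I"
  assumes alpha: "\<bar>\<alpha>\<bar> < 1"
    and semigroup: "C0_contraction_semigroup S"
    and generator: "generator S = kawahara_op \<alpha>"
begin

sublocale contraction_semigroup S
proof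
  fix t s :: real and v w :: L2I and c :: real
  note S = semigroup[unfolded C0_contraction_semigroup_def]
  show "0 \<le> t \<Longrightarrow> S t (v + w) = S t v + S t w" using S by blast
  show "0 \<le> t \<Longrightarrow> S t (c *\<^sub>R v) = c *\<^sub>R S t v"
    using S by (metis scaleC_of_real)
  show "0 \<le> t \<Longrightarrow> norm (S t v) \<le> norm v" using S by blast
  show "S 0 v = v" using S by blast
  show "0 \<le> t \<Longrightarrow> 0 \<le> s \<Longrightarrow> S (t + s) v = S t (S s v)" using S by blast
  show "((\<lambda>t. S t v) \<longlongrightarrow> v) (at_right 0)" using S by blast
qed

lemma gen_iff: "(v, w) \<in> gen \<longleftrightarrow> (v, w) \<in> kawahara_op \<alpha>"
  using generator unfolding gen_def generator_def by auto

lemma gen_sobolev: "(v, w) \<in> gen \<Longrightarrow> v \<in> sobolev 5"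
  unfolding gen_iff kawahara_op_def by auto

lemma gen_C5_rep:
  assumes "(v, w) \<in> gen" "(w, x) \<in> gen"
  obtains V where "C5_rep \<alpha> v V" "w = toL2 (\<lambda>x. V 5 x - V 3 x)"
  using C5_rep_exists[of v w \<alpha>] sobolev_mono[OF gen_sobolev[OF assms(2)], of 1] assms(1)
  by (auto simp: gen_iff)

definition weight :: real where "weight = 1 / (1 - \<alpha>\<^sup>2)"

lemma weight_ge_1: "1 \<le> weight"
  using abs_square_less_1[of \<alpha>] alpha by (simp add: weight_def field_simps)

lemma dissipation:
  assumes "(v, w) \<in> gen" "(w, x) \<in> gen"
  shows "2 * weighted_inner weight w v \<le> - 5 * (norm (wderiv 2 v))\<^sup>2"
    "norm v \<le> norm (wderiv 1 v)" "norm (wderiv 1 v) \<le> norm (wderiv 2 v)"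
proof -
  obtain V where V: "C5_rep \<alpha> v V" "w = toL2 (\<lambda>x. V 5 x - V 3 x)" using gen_C5_rep[OF assms] .
  show "2 * weighted_inner weight w v \<le> - 5 * (norm (wderiv 2 v))\<^sup>2"
    using energy_dissipation[OF alpha V weight_def] by simp
  show "norm v \<le> norm (wderiv 1 v)" "norm (wderiv 1 v) \<le> norm (wderiv 2 v)"
    using C5_rep_poincare[OF V(1)] .
qed

section \<open>Exponential decay of the energy\<close>

lemma weighted_inner_S_deriv:
  assumes "(v, w) \<in> gen" "0 < t"
  shows "((\<lambda>t. weighted_inner weight (S t v) (S t v)) has_real_derivative 2 * weighted_inner weight (S t w) (S t v)) (at t)"
  using bounded_bilinear.has_vector_derivative[OF bounded_bilinear_weighted_inner
      S_has_vector_derivative[OF assms] S_has_vector_derivative[OF assms], of weight]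
  unfolding has_real_derivative_iff_has_vector_derivative
  by (simp add: weighted_inner_commute[of weight "S t v"])

lemma continuous_on_weighted_inner_S: "A \<subseteq> {0..} \<Longrightarrow> continuous_on A (\<lambda>t. weighted_inner weight (S t v) (S t v))"
  by (intro bounded_bilinear.continuous_on[OF bounded_bilinear_weighted_inner] continuous_on_subset[OF continuous_on_S])

text \<open>Since V(w) <= (weight + 1) |w|^2 <= (weight + 1) |w_xx|^2 in norms, by Poincare twice,
  the dissipation 5 |w_xx|^2 is at least \<open>rate\<close> times V(w).\<close>

definition rate :: real where "rate = 5 / (weight + 1)"

lemma rate_pos: "0 < rate"
  using weight_ge_1 by (simp add: rate_def)

lemma exp_rate_tendsto: "(\<lambda>n. exp (- rate * real n)) \<longlonglongrightarrow> 0"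
proof -
  have "filterlim (\<lambda>n. rate * real n) at_top sequentially"
    by (intro filterlim_tendsto_pos_mult_at_top[OF tendsto_const rate_pos] filterlim_real_sequentially)
  then have "filterlim (\<lambda>n. - rate * real n) at_bot sequentially"
    by (simp add: filterlim_uminus_at_bot)
  then show ?thesis by (rule filterlim_compose[OF exp_at_bot])
qed

lemma decay_regular:
  assumes vw: "(v, w) \<in> gen" "(w, x) \<in> gen" and t: "0 \<le> t"
  shows "(norm (S t v))\<^sup>2 \<le> 2 * exp (- rate * t) * (norm v)\<^sup>2"
proof -
  let ?L = "\<lambda>t. exp (rate * t) * weighted_inner weight (S t v) (S t v)"
  have "?L t \<le> ?L 0"
  proof (rule DERIV_nonpos_imp_decreasing_open[OF t])
    fix s assume s: "0 < s" "s < t"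
    have "(?L has_real_derivative exp (rate * s) * (rate * weighted_inner weight (S s v) (S s v) + 2 * weighted_inner weight (S s w) (S s v))) (at s)"
      by (auto intro!: derivative_eq_intros weighted_inner_S_deriv[OF vw(1) s(1)] simp: algebra_simps)
    moreover have "rate * weighted_inner weight (S s v) (S s v) + 2 * weighted_inner weight (S s w) (S s v) \<le> 0"
    proof -
      have g: "(S s v, S s w) \<in> gen" "(S s w, S s x) \<in> gen" using vw s by (auto intro: gen_S)
      have "rate * weighted_inner weight (S s v) (S s v) \<le> rate * ((weight + 1) * (norm (S s v))\<^sup>2)"
        using weighted_inner_le[of weight "S s v"] weight_ge_1 rate_pos by (intro mult_left_mono) auto
      also have "\<dots> = 5 * (norm (S s v))\<^sup>2" using weight_ge_1 by (simp add: rate_def)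
      also have "\<dots> \<le> 5 * (norm (wderiv 2 (S s v)))\<^sup>2"
        using dissipation(2,3)[OF g] by (intro mult_left_mono power_mono) auto
      finally show ?thesis using dissipation(1)[OF g] by linarith
    qed
    ultimately show "\<exists>y. DERIV ?L s :> y \<and> y \<le> 0"
      by (auto intro!: exI mult_nonneg_nonpos)
  qed (intro continuous_intros continuous_on_weighted_inner_S, auto)
  then have "exp (rate * t) * weighted_inner weight (S t v) (S t v) \<le> weighted_inner weight v v" by simp
  also have "\<dots> \<le> (weight + 1) * (norm v)\<^sup>2" using weighted_inner_le weight_ge_1 by simp
  \<comment> \<open>As \<open>weight\<close> is at least 1, the factor \<open>weight\<close> now
    appears on both sides and cancels; this leaves the constant 2.\<close>
  also have "\<dots> \<le> 2 * weight * (norm v)\<^sup>2" using weight_ge_1 by (intro mult_right_mono) auto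
  finally have A: "exp (rate * t) * weighted_inner weight (S t v) (S t v) \<le> 2 * weight * (norm v)\<^sup>2" .
  have "exp (rate * t) * (weight * (norm (S t v))\<^sup>2) \<le> exp (rate * t) * weighted_inner weight (S t v) (S t v)"
    using weighted_inner_ge[of weight "S t v"] weight_ge_1 by (intro mult_left_mono) auto
  from order_trans[OF this A] have "weight * (exp (rate * t) * (norm (S t v))\<^sup>2) \<le> weight * (2 * (norm v)\<^sup>2)"
    by (simp add: mult_ac)
  then have "exp (rate * t) * (norm (S t v))\<^sup>2 \<le> 2 * (norm v)\<^sup>2"
    by (rule mult_left_le_imp_le) (use weight_ge_1 in simp)
  then show ?thesis by (simp add: exp_minus field_simps)
qed

lemma decay:
  assumes t: "0 \<le> t"
  shows "(norm (S t v))\<^sup>2 \<le> 2 * exp (- rate * t) * (norm v)\<^sup>2"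
proof -
  obtain u where ul: "u \<longlonglongrightarrow> v"
    and ug: "\<forall>n. \<exists>v1 v2 v3. (u n, v1) \<in> gen \<and> (v1, v2) \<in> gen \<and> (v2, v3) \<in> gen"
    using gen_cubed_dense_sequence[of v] .
  have u2: "(norm (S t (u n)))\<^sup>2 \<le> 2 * exp (- rate * t) * (norm (u n))\<^sup>2" for n
    using ug decay_regular[OF _ _ t] by blast
  from ul have "(\<lambda>n. S t (u n)) \<longlonglongrightarrow> S t v" by (rule bounded_linear.tendsto[OF bounded_linear_S[OF t]])
  then have "(\<lambda>n. (norm (S t (u n)))\<^sup>2) \<longlonglongrightarrow> (norm (S t v))\<^sup>2" by (intro tendsto_intros)
  moreover have "(\<lambda>n. 2 * exp (- rate * t) * (norm (u n))\<^sup>2) \<longlonglongrightarrow> 2 * exp (- rate * t) * (norm v)\<^sup>2"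
    using ul by (intro tendsto_intros)
  ultimately show ?thesis by (rule LIMSEQ_le) (use u2 in auto)
qed

text \<open>The Lyapunov function \<open>t\<^sup>3 V(A w(t)) + b V(w(t))\<close> decreases: the growth of the factor \<open>t\<^sup>3\<close> is
  absorbed through the interpolation inequality with \<open>\<mu>\<close> proportional to \<open>t\<close>.\<close>

lemma smoothing_cubic:
  obtains B where "0 \<le> B"
    "\<And>v0 v1 v2 v3 t. (v0, v1) \<in> gen \<Longrightarrow> (v1, v2) \<in> gen \<Longrightarrow> (v2, v3) \<in> gen \<Longrightarrow> 0 \<le> t \<Longrightarrow> t \<le> 1 \<Longrightarrow>
      t ^ 3 * (norm (S t v1))\<^sup>2 \<le> B * (norm v0)\<^sup>2"
proof -
  define k where "k = weight + 1"
  have k: "1 \<le> k" using weight_ge_1 by (simp add: k_def)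
  define C :: real where "C = 4 * 5760000\<^sup>2"
  \<comment> \<open>Sized so that the w_xx term left by the interpolation, 3 b |w_xx|^2, is absorbed
    by the dissipation 5 b |w_xx|^2 of the second summand.\<close>
  define b where "b = k ^ 3 * C"
  have b: "0 \<le> b" using k by (simp add: b_def C_def)
  have main: "t ^ 3 * (norm (S t v1))\<^sup>2 \<le> (b * k) * (norm v0)\<^sup>2"
    if v: "(v0, v1) \<in> gen" "(v1, v2) \<in> gen" "(v2, v3) \<in> gen" and t: "0 \<le> t" "t \<le> 1" for v0 v1 v2 v3 t
  proof -
    let ?L = "\<lambda>t. t ^ 3 * weighted_inner weight (S t v1) (S t v1) + b * weighted_inner weight (S t v0) (S t v0)"
    have "?L t \<le> ?L 0"
    proof (rule DERIV_nonpos_imp_decreasing_open[OF t(1)])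
      fix s assume s: "0 < s" "s < t"
      let ?w = "S s v0" and ?z = "S s v1"
      have g: "(?w, ?z) \<in> gen" "(?z, S s v2) \<in> gen" "(S s v2, S s v3) \<in> gen"
        using v s by (auto intro: gen_S)
      obtain V where V: "C5_rep \<alpha> ?w V" "?z = toL2 (\<lambda>x. V 5 x - V 3 x)" using gen_C5_rep[OF g(1,2)] .
      obtain Z where Z: "C5_rep \<alpha> ?z Z" using gen_C5_rep[OF g(2,3)] by blast
      \<comment> \<open>The growth term is at most 3 k s^2 |z|^2. With the interpolation parameter s
        / k it becomes 3 s^3 |z_xx|^2 plus 3 b |w_xx|^2, below the dissipation with factors 5. That
        the parameter is at most 1 restricts the argument to t <= 1.\<close>
      define m where "m = s / k"
      have m: "0 \<le> m" "m \<le> 1" "s = m * k" using s t k by (auto simp: m_def)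
      have int: "m\<^sup>2 * (norm ?z)\<^sup>2 \<le> m ^ 3 * (norm (wderiv 2 ?z))\<^sup>2 + C * (norm (wderiv 2 ?w))\<^sup>2"
        unfolding C_def by (rule generator_interpolation[OF V Z m(1,2)])
      have "3 * s\<^sup>2 * weighted_inner weight ?z ?z \<le> 3 * s\<^sup>2 * (k * (norm ?z)\<^sup>2)"
        using weighted_inner_le[of weight ?z] weight_ge_1 by (intro mult_left_mono) (auto simp: k_def)
      also have "\<dots> = 3 * k ^ 3 * (m\<^sup>2 * (norm ?z)\<^sup>2)"
        unfolding m(3) by (simp add: power2_eq_square power3_eq_cube)
      also have "\<dots> \<le> 3 * k ^ 3 * (m ^ 3 * (norm (wderiv 2 ?z))\<^sup>2 + C * (norm (wderiv 2 ?w))\<^sup>2)"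
        using int k by (intro mult_left_mono) auto
      also have "\<dots> = 3 * (s ^ 3 * (norm (wderiv 2 ?z))\<^sup>2) + 3 * (b * (norm (wderiv 2 ?w))\<^sup>2)"
        unfolding m(3) b_def by (simp add: power_mult_distrib algebra_simps)
      finally have 1: "3 * s\<^sup>2 * weighted_inner weight ?z ?z
          \<le> 3 * (s ^ 3 * (norm (wderiv 2 ?z))\<^sup>2) + 3 * (b * (norm (wderiv 2 ?w))\<^sup>2)" .
      have 2: "s ^ 3 * (2 * weighted_inner weight (S s v2) ?z) \<le> s ^ 3 * (- 5 * (norm (wderiv 2 ?z))\<^sup>2)"
        using s by (intro mult_left_mono dissipation(1)[OF g(2,3)]) auto
      have 3: "b * (2 * weighted_inner weight ?z ?w) \<le> b * (- 5 * (norm (wderiv 2 ?w))\<^sup>2)"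
        using b by (intro mult_left_mono dissipation(1)[OF g(1,2)]) auto
      have D: "(?L has_real_derivative (3 * s\<^sup>2 * weighted_inner weight ?z ?z + s ^ 3 * (2 * weighted_inner weight (S s v2) ?z)
          + b * (2 * weighted_inner weight ?z ?w))) (at s)"
        by (auto intro!: derivative_eq_intros weighted_inner_S_deriv[OF v(2) s(1)] weighted_inner_S_deriv[OF v(1) s(1)])
      have "0 \<le> s ^ 3 * (norm (wderiv 2 ?z))\<^sup>2" "0 \<le> b * (norm (wderiv 2 ?w))\<^sup>2" using s b by auto
      then have "3 * s\<^sup>2 * weighted_inner weight ?z ?z + s ^ 3 * (2 * weighted_inner weight (S s v2) ?z) + b * (2 * weighted_inner weight ?z ?w) \<le> 0"
        using 1 2 3 by simp
      with D show "\<exists>y. DERIV ?L s :> y \<and> y \<le> 0" by blast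
    qed (intro continuous_intros continuous_on_weighted_inner_S, auto)
    then have "t ^ 3 * weighted_inner weight (S t v1) (S t v1) + b * weighted_inner weight (S t v0) (S t v0) \<le> b * weighted_inner weight v0 v0"
      by simp
    moreover have "0 \<le> weighted_inner weight (S t v0) (S t v0)"
      using weighted_inner_ge[of weight "S t v0"] weight_ge_1 by (smt (verit) mult_nonneg_nonneg zero_le_power2)
    moreover have "(norm (S t v1))\<^sup>2 \<le> weighted_inner weight (S t v1) (S t v1)"
      using weighted_inner_ge[of weight "S t v1"] weight_ge_1 mult_right_mono[of 1 weight "(norm (S t v1))\<^sup>2"] by simp
    then have "t ^ 3 * (norm (S t v1))\<^sup>2 \<le> t ^ 3 * weighted_inner weight (S t v1) (S t v1)"
      using t by (intro mult_left_mono) auto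
    moreover have "b * weighted_inner weight v0 v0 \<le> b * (k * (norm v0)\<^sup>2)"
      using weighted_inner_le[of weight v0] weight_ge_1 b by (intro mult_left_mono) (auto simp: k_def)
    moreover have "0 \<le> b * weighted_inner weight (S t v0) (S t v0)"
      using b calculation(2) by simp
    ultimately show ?thesis by (simp add: mult.assoc)
  qed
  show ?thesis by (rule that[of "b * k"]) (use b k main in auto)
qed

text \<open>The dissipation inequality, read backwards, bounds |w_xx|^2 by a multiple of |A w| |w|.
  Up to time 1 the factor |A w| is controlled by \<open>smoothing_cubic\<close>; later, exponential
  decay beats the polynomial decay of \<open>kern\<close>.\<close>

lemma smoothing_regular:
  obtains C where "0 \<le> C"
    "\<And>v0 v1 v2 v3 t. (v0, v1) \<in> gen \<Longrightarrow> (v1, v2) \<in> gen \<Longrightarrow> (v2, v3) \<in> gen \<Longrightarrow> 0 < t \<Longrightarrow>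
      norm (wderiv 2 (S t v0)) \<le> C * kern t * norm v0"
proof -
  obtain B where B: "0 \<le> B" "\<And>v0 v1 v2 v3 t. (v0, v1) \<in> gen \<Longrightarrow> (v1, v2) \<in> gen \<Longrightarrow> (v2, v3) \<in> gen \<Longrightarrow>
      0 \<le> t \<Longrightarrow> t \<le> 1 \<Longrightarrow> t ^ 3 * (norm (S t v1))\<^sup>2 \<le> B * (norm v0)\<^sup>2"
    using smoothing_cubic by blast
  define k where "k = weight + 1"
  have k: "1 \<le> k" using weight_ge_1 by (simp add: k_def)
  \<comment> \<open>Chosen so that 2 exp(rate) exp(-rate t) <= E / t^3; the 54 is twice the 27 of
    \<open>exp_minus_le_inverse_cube\<close>.\<close>
  define E where "E = 54 * exp rate / rate ^ 3"
  have E: "0 \<le> E" using rate_pos by (simp add: E_def)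
  \<comment> \<open>The square of the final constant. 256 = 16^2 comes from kern t >= 1/(16 s^3) for
    t <= 1 and kern t >= 1/(16 s^5) for t >= 1, with s = t^(1/4); the sum in brackets serves both
    ranges.\<close>
  define C where "C = 256 * k * (sqrt B + sqrt (2 * B) * E + 1)"
  show ?thesis
  proof (rule that[of "sqrt C"])
    show "0 \<le> sqrt C" using B(1) k E by (simp add: C_def)
    fix v0 v1 v2 v3 and t :: real
    assume v: "(v0, v1) \<in> gen" "(v1, v2) \<in> gen" "(v2, v3) \<in> gen" and t: "0 < t"
    \<comment> \<open>Working with t^(1/4) makes all exponents integers: the bound on A w has the
      factor s^6, the one on w_xx the factor s^3.\<close>
    define s where "s = sqrt (sqrt t)"
    have s2: "s\<^sup>2 = sqrt t" using t by (simp add: s_def)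
    have "s ^ 4 = (s\<^sup>2)\<^sup>2" by (simp flip: power_mult)
    then have s: "0 < s" "s ^ 4 = t" using t by (simp_all add: s2 real_sqrt_pow2) (simp add: s_def)
    let ?w = "S t v0" and ?z = "S t v1"
    have g: "(?w, ?z) \<in> gen" "(?z, S t v2) \<in> gen" using v t by (auto intro: gen_S)
    have "5 * (norm (wderiv 2 ?w))\<^sup>2 \<le> 2 * \<bar>weighted_inner weight ?z ?w\<bar>"
      using dissipation(1)[OF g] by linarith
    also have "\<dots> \<le> 2 * (k * (norm ?z * norm ?w))"
      using weighted_inner_bound[of weight ?z ?w] weight_ge_1 by (simp add: k_def)
    finally have h: "(norm (wderiv 2 ?w))\<^sup>2 \<le> k * (norm ?z * norm ?w)"
      using zero_le_power2[of "norm (wderiv 2 ?w)"] by linarith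
    have "(norm (wderiv 2 ?w))\<^sup>2 \<le> C * (kern t)\<^sup>2 * (norm v0)\<^sup>2"
    proof (cases "t \<le> 1")
      case True
      then have s1: "s \<le> 1" by (simp add: s_def)
      have "s ^ 12 = t ^ 3" unfolding s(2)[symmetric] by (simp flip: power_mult)
      then have "s ^ 12 * (norm ?z)\<^sup>2 \<le> B * (norm v0)\<^sup>2"
        using B(2)[OF v _ True] t by simp
      then have "(s ^ 6 * norm ?z)\<^sup>2 \<le> (sqrt B * norm v0)\<^sup>2"
        using B(1) by (simp add: power_mult_distrib flip: power_mult)
      then have z: "s ^ 6 * norm ?z \<le> sqrt B * norm v0"
        by (rule power2_le_imp_le) (use B(1) in simp)
      have "s ^ 6 * (norm (wderiv 2 ?w))\<^sup>2 \<le> s ^ 6 * (k * (norm ?z * norm ?w))"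
        using s(1) by (intro mult_left_mono h) auto
      also have "\<dots> = k * ((s ^ 6 * norm ?z) * norm ?w)" by (simp add: mult_ac)
      also have "\<dots> \<le> k * ((sqrt B * norm v0) * norm v0)"
        using mult_mono[OF z S_norm[of t v0]] k t B(1) by (intro mult_left_mono) auto
      finally have 1: "s ^ 6 * (norm (wderiv 2 ?w))\<^sup>2 \<le> k * sqrt B * (norm v0)\<^sup>2"
        by (simp add: power2_eq_square mult_ac)
      have "4 * s ^ 3 * (1 + s)\<^sup>2 \<le> 4 * s ^ 3 * 2\<^sup>2"
        using s s1 by (intro mult_left_mono power_mono) auto
      then have "1 / (16 * s ^ 3) \<le> kern t"
        unfolding kern_def s_def[symmetric] using s by (intro divide_left_mono) (auto intro!: mult_pos_pos add_pos_pos)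
      then have "(1 / (16 * s ^ 3))\<^sup>2 \<le> (kern t)\<^sup>2" using s by (intro power_mono) auto
      then have kk: "1 \<le> 256 * s ^ 6 * (kern t)\<^sup>2"
        using s by (simp add: power_divide power_mult_distrib field_simps flip: power_mult)
      have "s ^ 6 * (norm (wderiv 2 ?w))\<^sup>2 \<le> (k * sqrt B * (norm v0)\<^sup>2) * 1" using 1 by simp
      also have "\<dots> \<le> (k * sqrt B * (norm v0)\<^sup>2) * (256 * s ^ 6 * (kern t)\<^sup>2)"
        using kk k B(1) by (intro mult_left_mono) auto
      also have "\<dots> = s ^ 6 * ((256 * k * sqrt B) * ((kern t)\<^sup>2 * (norm v0)\<^sup>2))" by (simp add: mult_ac)
      also have "\<dots> \<le> s ^ 6 * (C * ((kern t)\<^sup>2 * (norm v0)\<^sup>2))"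
        unfolding C_def using s k E B(1) by (intro mult_left_mono mult_right_mono) auto
      finally show ?thesis using s by (simp add: mult.assoc)
    next
      case False
      then have s1: "1 \<le> s" by (simp add: s_def)
      have "(norm (S 1 v1))\<^sup>2 \<le> B * (norm v0)\<^sup>2" using B(2)[OF v, of 1] by simp
      \<comment> \<open>The cubic bound is spent at time 1, and decay takes over from there.\<close>
      moreover have "?z = S (t - 1) (S 1 v1)" using S_plus[of "t - 1" 1 v1] False by simp
      ultimately have "(norm ?z)\<^sup>2 \<le> 2 * exp (- rate * (t - 1)) * (B * (norm v0)\<^sup>2)"
        using decay[of "t - 1" "S 1 v1"] False
        by (smt (verit) exp_gt_zero mult_left_mono zero_le_mult_iff)
      moreover have "(norm ?w)\<^sup>2 \<le> 2 * exp (- rate * t) * (norm v0)\<^sup>2" using decay[of t v0] t by simp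
      ultimately have "(norm ?z)\<^sup>2 * (norm ?w)\<^sup>2 \<le> (2 * exp (- rate * (t - 1)) * (B * (norm v0)\<^sup>2)) * (2 * exp (- rate * t) * (norm v0)\<^sup>2)"
        by (intro mult_mono) (auto simp: B(1))
      also have "\<dots> = (2 * exp rate * exp (- rate * t)) * (2 * exp (- rate * t)) * (B * ((norm v0)\<^sup>2 * (norm v0)\<^sup>2))"
        by (simp add: exp_diff exp_minus field_simps)
      also have "\<dots> \<le> (2 * exp rate * exp (- rate * t)) * (2 * exp rate * exp (- rate * t)) * (B * ((norm v0)\<^sup>2 * (norm v0)\<^sup>2))"
        using rate_pos B(1) by (intro mult_right_mono mult_left_mono) auto
      also have "\<dots> = (2 * exp rate * exp (- rate * t) * sqrt B * (norm v0)\<^sup>2)\<^sup>2"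
        using B(1) by (simp add: power2_eq_square mult_ac)
      finally have "(norm ?z * norm ?w)\<^sup>2 \<le> (2 * exp rate * exp (- rate * t) * sqrt B * (norm v0)\<^sup>2)\<^sup>2"
        by (simp add: power_mult_distrib)
      then have zw: "norm ?z * norm ?w \<le> 2 * exp rate * exp (- rate * t) * sqrt B * (norm v0)\<^sup>2"
        by (rule power2_le_imp_le) (use B(1) in simp)
      have "exp (- rate * t) \<le> 27 / (rate * t) ^ 3"
        using exp_minus_le_inverse_cube[of "rate * t"] rate_pos t by simp
      then have "2 * exp rate * exp (- rate * t) \<le> 2 * exp rate * (27 / (rate * t) ^ 3)"
        by (intro mult_left_mono) auto
      also have "\<dots> = E / t ^ 3" by (simp add: E_def power_mult_distrib)
      finally have "2 * exp rate * exp (- rate * t) \<le> E / t ^ 3" .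
      then have "2 * exp rate * exp (- rate * t) * (sqrt B * (norm v0)\<^sup>2) \<le> E / t ^ 3 * (sqrt B * (norm v0)\<^sup>2)"
        using B(1) by (intro mult_right_mono) auto
      with zw have "norm ?z * norm ?w \<le> E / t ^ 3 * (sqrt B * (norm v0)\<^sup>2)" by (simp add: mult_ac)
      then have "k * (norm ?z * norm ?w) \<le> k * (E / t ^ 3 * (sqrt B * (norm v0)\<^sup>2))"
        using k by (intro mult_left_mono) auto
      with h have 1: "(norm (wderiv 2 ?w))\<^sup>2 \<le> k * (E / t ^ 3 * (sqrt B * (norm v0)\<^sup>2))" by linarith
      have "4 * s ^ 3 * (1 + s)\<^sup>2 \<le> 4 * s ^ 3 * (2 * s)\<^sup>2"
        using s s1 by (intro mult_left_mono power_mono) auto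
      also have "\<dots> = 16 * s ^ 5" by (simp add: power2_eq_square eval_nat_numeral)
      finally have "1 / (16 * s ^ 5) \<le> kern t"
        unfolding kern_def s_def[symmetric] using s by (intro divide_left_mono) (auto intro!: mult_pos_pos add_pos_pos)
      then have "(1 / (16 * s ^ 5))\<^sup>2 \<le> (kern t)\<^sup>2" using s by (intro power_mono) auto
      then have "1 / s ^ 10 \<le> 256 * (kern t)\<^sup>2"
        using s by (simp add: power_divide power_mult_distrib field_simps flip: power_mult)
      \<comment> \<open>There is room to spare: t^3 is s^12, and s >= 1.\<close>
      moreover have "1 / t ^ 3 \<le> 1 / s ^ 10"
      proof (rule divide_left_mono)
        show "s ^ 10 \<le> t ^ 3" unfolding s(2)[symmetric] power_mult[symmetric] using s1 by (intro power_increasing) auto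
      qed (use s t in auto)
      ultimately have "1 / t ^ 3 \<le> 256 * (kern t)\<^sup>2" by linarith
      then have "(k * E * sqrt B * (norm v0)\<^sup>2) * (1 / t ^ 3) \<le> (k * E * sqrt B * (norm v0)\<^sup>2) * (256 * (kern t)\<^sup>2)"
        using k E B(1) by (intro mult_left_mono) auto
      with 1 have "(norm (wderiv 2 ?w))\<^sup>2 \<le> (256 * k * (sqrt B * E)) * ((kern t)\<^sup>2 * (norm v0)\<^sup>2)"
        by (simp add: mult_ac)
      also have "\<dots> \<le> C * ((kern t)\<^sup>2 * (norm v0)\<^sup>2)"
        unfolding C_def
      proof (intro mult_right_mono mult_left_mono)
        have "sqrt B \<le> sqrt (2 * B)" using B(1) by simp
        then have "sqrt B * E \<le> sqrt (2 * B) * E" using E by (rule mult_right_mono)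
        then show "sqrt B * E \<le> sqrt B + sqrt (2 * B) * E + 1" using B(1) by (smt (verit) real_sqrt_ge_zero)
      qed (use k in auto)
      finally show ?thesis by (simp add: mult.assoc)
    qed
    also have "\<dots> = (sqrt C * kern t * norm v0)\<^sup>2"
      using B(1) k E by (simp add: power_mult_distrib C_def)
    finally show "norm (wderiv 2 ?w) \<le> sqrt C * kern t * norm v0"
      by (rule power2_le_imp_le) (use kern_pos[OF t] B(1) k E in \<open>simp add: C_def\<close>)
  qed
qed

text \<open>Only meaningful for \<open>t > 0\<close>, where \<open>S t v\<close> lies in \<open>H\<^sup>2(I)\<close>.\<close>

definition T :: "real \<Rightarrow> L2I \<Rightarrow> H2I" where
  "T t v = Abs_H2 (S t v)"

text \<open>The H^2 bound applied to differences of regular data makes the images of an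
  approximating sequence Cauchy in H^2. Its limit is S t v, because convergence in H^2 implies
  convergence in L^2.\<close>

lemma smoothing_exists:
  "\<exists>C. 0 < C \<and> (\<forall>t>0. \<forall>v. S t v \<in> sobolev 2 \<and> norm (T t v) \<le> C * kern t * norm v)"
proof -
  obtain C where C: "0 \<le> C"
    "\<And>v0 v1 v2 v3 t. (v0, v1) \<in> gen \<Longrightarrow> (v1, v2) \<in> gen \<Longrightarrow> (v2, v3) \<in> gen \<Longrightarrow> 0 < t \<Longrightarrow>
      norm (wderiv 2 (S t v0)) \<le> C * kern t * norm v0"
    using smoothing_regular by blast
  let ?R = "{v. \<exists>v1 v2 v3. (v, v1) \<in> gen \<and> (v1, v2) \<in> gen \<and> (v2, v3) \<in> gen}"
  have main: "\<exists>u. of_H2 u = S t v \<and> norm u \<le> 3 * C * kern t * norm v" if t: "0 < t" for t v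
  proof -
    have reg: "\<exists>u. of_H2 u = S t v \<and> norm u \<le> 3 * C * kern t * norm v" if "v \<in> ?R" for v
    proof -
      obtain v1 v2 v3 where v: "(v, v1) \<in> gen" "(v1, v2) \<in> gen" "(v2, v3) \<in> gen" using \<open>v \<in> ?R\<close> by blast
      have g: "(S t v, S t v1) \<in> gen" "(S t v1, S t v2) \<in> gen" using v t by (auto intro: gen_S)
      have "S t v \<in> sobolev 2" using sobolev_mono[OF gen_sobolev[OF g(1)]] by simp
      then obtain u where u: "of_H2 u = S t v" by (metis Abs_H2_inverse)
      have "norm u \<le> norm (h2d 0 u) + norm (h2d 1 u) + norm (h2d 2 u)" by (rule norm_H2I_le)
      also have "\<dots> \<le> 3 * norm (wderiv 2 (S t v))"
        using dissipation(2,3)[OF g] by (simp add: h2d_def u)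
      also have "\<dots> \<le> 3 * (C * kern t * norm v)" using C(2)[OF v t] by simp
      finally show ?thesis using u by (auto simp: mult.assoc)
    qed
    obtain w where wl: "w \<longlonglongrightarrow> v"
      and wg: "\<forall>n. \<exists>v1 v2 v3. (w n, v1) \<in> gen \<and> (v1, v2) \<in> gen \<and> (v2, v3) \<in> gen"
      using gen_cubed_dense_sequence[of v] .
    have w: "w n \<in> ?R" for n using wg by blast
    have "\<forall>n. \<exists>u. of_H2 u = S t (w n) \<and> norm u \<le> 3 * C * kern t * norm (w n)"
      using reg[OF w] by blast
    from choice[OF this] obtain u where u: "\<And>n. of_H2 (u n) = S t (w n)" "\<And>n. norm (u n) \<le> 3 * C * kern t * norm (w n)"
      by blast
    \<comment> \<open>Regular data form a linear space, so the estimate applies to the difference,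
      and the H^2 element it yields is \<open>u m - u n\<close> by injectivity of
      \<open>of_H2\<close>.\<close>
    have dist: "norm (u m - u n) \<le> 3 * C * kern t * norm (w m - w n)" for m n
    proof -
      obtain a1 a2 a3 b1 b2 b3 where "(w m, a1) \<in> gen" "(a1, a2) \<in> gen" "(a2, a3) \<in> gen"
        "(w n, b1) \<in> gen" "(b1, b2) \<in> gen" "(b2, b3) \<in> gen" using w[of m] w[of n] by auto
      then have "w m - w n \<in> ?R" by (blast intro: gen_diff)
      then obtain x where x: "of_H2 x = S t (w m - w n)" "norm x \<le> 3 * C * kern t * norm (w m - w n)"
        using reg by blast
      have "of_H2 x = of_H2 (u m - u n)"
        using x(1) u(1) t bounded_linear.linear[OF bounded_linear_of_H2] by (simp add: linear_diff S_diff)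
      then show ?thesis using x(2) of_H2_inject' by metis
    qed
    have "Cauchy u"
    proof (rule CauchyI)
      fix e :: real assume e: "0 < e"
      define M where "M = 3 * C * kern t + 1"
      have M: "0 < M" using C(1) kern_pos[OF t] by (simp add: M_def add_nonneg_pos)
      obtain N where N: "\<And>m n. m \<ge> N \<Longrightarrow> n \<ge> N \<Longrightarrow> norm (w m - w n) < e / M"
        using LIMSEQ_imp_Cauchy[OF wl] e M unfolding Cauchy_iff by (meson divide_pos_pos)
      have "norm (u m - u n) < e" if "m \<ge> N" "n \<ge> N" for m n
      proof -
        have "norm (u m - u n) \<le> M * norm (w m - w n)"
          using dist[of m n] by (simp add: M_def distrib_right add_increasing2)
        also have "\<dots> < M * (e / M)" using N[OF that] M by (intro mult_strict_left_mono)
        finally show ?thesis using M by simp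
      qed
      then show "\<exists>N. \<forall>m\<ge>N. \<forall>n\<ge>N. norm (u m - u n) < e" by blast
    qed
    then obtain x where x: "u \<longlonglongrightarrow> x" using Cauchy_convergent_iff convergent_def by blast
    have "(\<lambda>n. of_H2 (u n)) \<longlonglongrightarrow> of_H2 x" by (rule bounded_linear.tendsto[OF bounded_linear_of_H2 x])
    moreover have "(\<lambda>n. S t (w n)) \<longlonglongrightarrow> S t v"
      using t by (intro bounded_linear.tendsto[OF bounded_linear_S] wl) simp
    ultimately have "of_H2 x = S t v" unfolding u(1) by (rule LIMSEQ_unique)
    moreover have "norm x \<le> 3 * C * kern t * norm v"
      by (rule LIMSEQ_le[of "\<lambda>n. norm (u n)" _ "\<lambda>n. 3 * C * kern t * norm (w n)"])
        (use x wl u(2) in \<open>auto intro!: tendsto_intros\<close>)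
    ultimately show ?thesis by blast
  qed
  \<comment> \<open>The added 1 makes the constant strictly positive.\<close>
  have "S t v \<in> sobolev 2 \<and> norm (T t v) \<le> (3 * C + 1) * kern t * norm v" if t: "0 < t" for t v
  proof -
    obtain u where u: "of_H2 u = S t v" "norm u \<le> 3 * C * kern t * norm v" using main[OF t] by blast
    have "3 * C * kern t * norm v \<le> (3 * C + 1) * kern t * norm v"
      using kern_pos[OF t] by (intro mult_right_mono) auto
    moreover have "T t v = u" unfolding T_def u(1)[symmetric] by (rule of_H2_inverse)
    ultimately show ?thesis using u of_H2[of u] by auto
  qed
  then show ?thesis using C(1) by (intro exI[of _ "3 * C + 1"]) auto
qed

definition smoothing_const :: real where
  "smoothing_const = (SOME C. 0 < C \<and> (\<forall>t>0. \<forall>v. S t v \<in> sobolev 2 \<and> norm (T t v) \<le> C * kern t * norm v))"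

lemma smoothing_const_pos: "0 < smoothing_const"
  and S_sobolev: "0 < t \<Longrightarrow> S t v \<in> sobolev 2"
  and norm_T_le: "0 < t \<Longrightarrow> norm (T t v) \<le> smoothing_const * kern t * norm v"
  using someI_ex[OF smoothing_exists] unfolding smoothing_const_def[symmetric] by auto

lemma of_H2_T: "0 < t \<Longrightarrow> of_H2 (T t v) = S t v"
  unfolding T_def by (rule Abs_H2_inverse[OF S_sobolev])

lemma T_plus: "0 < t \<Longrightarrow> 0 \<le> s \<Longrightarrow> T (t + s) v = T t (S s v)"
  by (rule of_H2_inject') (simp add: of_H2_T S_plus)

lemma bounded_linear_T:
  assumes "0 < t" shows "bounded_linear (T t)"
proof (rule bounded_linear_intro)
  note lin = bounded_linear.linear[OF bounded_linear_of_H2]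
  show "T t (v + w) = T t v + T t w" for v w
    by (rule of_H2_inject') (use assms in \<open>simp add: of_H2_T linear_add[OF lin] S_add\<close>)
  show "T t (c *\<^sub>R v) = c *\<^sub>R T t v" for v c
    by (rule of_H2_inject') (use assms in \<open>simp add: of_H2_T linear_scale[OF lin] S_scaleR\<close>)
  show "norm (T t v) \<le> norm v * (smoothing_const * kern t)" for v
    using norm_T_le[OF assms, of v] by (simp add: mult_ac)
qed

end

section \<open>The Duhamel operator on bounded continuous forcings\<close>

context kawahara
begin

text \<open>The variable is the elapsed time \<sigma> = t - s. For 0 < a the integrand is continuous
  with values in H^2, so the integral is formed in H^2 itself; the singularity at 0 and the infinite
  tail are left to a limit.\<close>

definition duhamel :: "real \<Rightarrow> real \<Rightarrow> (real \<Rightarrow> L2I) \<Rightarrow> real \<Rightarrow> H2I" where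
  "duhamel a b g t = integral {a..b} (\<lambda>\<sigma>. T \<sigma> (g (t - \<sigma>)))"

text \<open>Factor T \<sigma> as T a after S (\<sigma> - a): the second is jointly continuous in
  L^2, the first is one bounded operator into H^2.\<close>

lemma continuous_on_T_shift:
  assumes a: "0 < a" and g: "continuous_on UNIV g"
  shows "continuous_on (A \<times> {a..}) (\<lambda>(t, \<sigma>). T \<sigma> (g (t - \<sigma>)))"
proof -
  have "continuous_on (A \<times> {a..}) (\<lambda>p. T a (S (snd p - a) (g (fst p - snd p))))"
    by (intro bounded_linear.continuous_on[OF bounded_linear_T[OF a]] continuous_on_S_compose
        continuous_on_compose2[OF g] continuous_intros) auto
  then show ?thesis
    by (rule continuous_on_eq) (use a T_plus[of a] in \<open>auto simp flip: T_plus\<close>)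
qed

lemma continuous_on_T_slice:
  assumes a: "0 < a" and g: "continuous_on UNIV g"
  shows "continuous_on {a..b} (\<lambda>\<sigma>. T \<sigma> (g (t - \<sigma>)))"
proof -
  have "continuous_on {a..b} (\<lambda>\<sigma>. (\<lambda>(t, \<sigma>). T \<sigma> (g (t - \<sigma>))) (t, \<sigma>))"
    by (rule continuous_on_compose2[OF continuous_on_T_shift[OF a g, of UNIV]])
      (auto intro!: continuous_intros)
  then show ?thesis by simp
qed

lemma continuous_on_duhamel:
  assumes a: "0 < a" and g: "continuous_on UNIV g"
  shows "continuous_on UNIV (duhamel a b g)"
proof -
  have "continuous_on (UNIV \<times> cbox a b) (\<lambda>(t, \<sigma>). T \<sigma> (g (t - \<sigma>)))"
    by (rule continuous_on_subset[OF continuous_on_T_shift[OF a g, of UNIV]]) auto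
  from integral_continuous_on_param[OF this] show ?thesis
    by (simp add: duhamel_def[abs_def])
qed

lemma norm_duhamel_le:
  assumes a: "0 < a" "a \<le> b" and g: "continuous_on UNIV g" "\<And>s. norm (g s) \<le> B"
  shows "norm (duhamel a b g t) \<le> smoothing_const * (Kern b - Kern a) * B"
proof -
  have hi: "((\<lambda>\<sigma>. smoothing_const * kern \<sigma> * B) has_integral smoothing_const * (Kern b - Kern a) * B) {a..b}"
    by (intro has_integral_mult_left has_integral_mult_right kern_has_integral a)
  have "norm (duhamel a b g t) \<le> integral {a..b} (\<lambda>\<sigma>. smoothing_const * kern \<sigma> * B)"
    unfolding duhamel_def
  proof (rule integral_norm_bound_integral)
    show "(\<lambda>\<sigma>. T \<sigma> (g (t - \<sigma>))) integrable_on {a..b}"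
      by (intro integrable_continuous_real continuous_on_T_slice a g)
    show "(\<lambda>\<sigma>. smoothing_const * kern \<sigma> * B) integrable_on {a..b}" using hi by blast
    fix \<sigma> assume s: "\<sigma> \<in> {a..b}"
    then have "norm (T \<sigma> (g (t - \<sigma>))) \<le> smoothing_const * kern \<sigma> * norm (g (t - \<sigma>))"
      using a by (intro norm_T_le) auto
    also have "\<dots> \<le> smoothing_const * kern \<sigma> * B"
      using g(2) smoothing_const_pos kern_pos[of \<sigma>] a s by (intro mult_left_mono) auto
    finally show "norm (T \<sigma> (g (t - \<sigma>))) \<le> smoothing_const * kern \<sigma> * B" .
  qed
  then show ?thesis by (simp only: integral_unique[OF hi])
qed

lemma duhamel_combine:
  assumes "0 < a" "a \<le> b" "b \<le> c" "continuous_on UNIV g"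
  shows "duhamel a c g t = duhamel a b g t + duhamel b c g t"
  unfolding duhamel_def using assms
  by (intro hk_integral_combine[symmetric] integrable_continuous_real continuous_on_T_slice) auto

definition truncated_duhamel :: "nat \<Rightarrow> (real \<Rightarrow>\<^sub>C L2I) \<Rightarrow> (real \<Rightarrow>\<^sub>C H2I)" where
  "truncated_duhamel n g = Bcontfun (duhamel (1 / real (Suc n)) (real (Suc n)) (apply_bcontfun g))"

lemma inverse_Suc_le: "1 / real (Suc n) \<le> real (Suc m)"
proof -
  have "1 / real (Suc n) \<le> 1" by simp
  then show ?thesis by (rule order_trans) simp
qed

lemma apply_truncated_duhamel: "apply_bcontfun (truncated_duhamel n g) = duhamel (1 / real (Suc n)) (real (Suc n)) (apply_bcontfun g)"
  unfolding truncated_duhamel_def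
proof (rule Bcontfun_inverse, rule bcontfun_normI)
  show "continuous_on UNIV (duhamel (1 / real (Suc n)) (real (Suc n)) (apply_bcontfun g))"
    by (rule continuous_on_duhamel) auto
  show "norm (duhamel (1 / real (Suc n)) (real (Suc n)) (apply_bcontfun g) t)
      \<le> smoothing_const * (Kern (real (Suc n)) - Kern (1 / real (Suc n))) * norm g" for t
    by (rule norm_duhamel_le) (auto simp: inverse_Suc_le norm_bounded simp del: of_nat_Suc)
qed

lemma norm_truncated_duhamel_le: "norm (truncated_duhamel n g) \<le> smoothing_const * norm g"
proof (rule norm_bound)
  fix t
  have "norm (apply_bcontfun (truncated_duhamel n g) t) \<le> smoothing_const * (Kern (real (Suc n)) - Kern (1 / real (Suc n))) * norm g"
    unfolding apply_truncated_duhamel by (rule norm_duhamel_le) (auto simp: inverse_Suc_le norm_bounded simp del: of_nat_Suc)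
  also have "\<dots> \<le> smoothing_const * 1 * norm g"
    using smoothing_const_pos Kern_bounds[of "real (Suc n)"] Kern_bounds[of "1 / real (Suc n)"]
    by (intro mult_right_mono mult_left_mono) auto
  finally show "norm (apply_bcontfun (truncated_duhamel n g) t) \<le> smoothing_const * norm g" by simp
qed

text \<open>Enlarging the truncation adds a piece near 0 and a piece near infinity, whose
  \<open>kern\<close>-masses are at most Kern (1/(m+1)) and 1 - Kern (m+1). The bound does not
  depend on \<open>n\<close>, so it gives the Cauchy property at once.\<close>

lemma truncated_duhamel_dist_le:
  assumes "m \<le> n"
  shows "norm (truncated_duhamel n g - truncated_duhamel m g) \<le> smoothing_const * (Kern (1 / real (Suc m)) + 1 - Kern (real (Suc m))) * norm g"
proof (rule norm_bound)
  fix t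
  let ?a = "\<lambda>n. 1 / real (Suc n)" and ?b = "\<lambda>n. real (Suc n)" and ?g = "apply_bcontfun g"
  have le: "0 < ?a n" "?a n \<le> ?a m" "?a m \<le> ?b m" "?b m \<le> ?b n" "0 < ?a m" "0 < ?b m"
    using assms inverse_Suc_le[of m m] by (auto simp: divide_simps)
  have c: "continuous_on UNIV ?g" by simp
  have b: "norm (?g s) \<le> norm g" for s by (rule norm_bounded)
  have "duhamel (?a n) (?b n) ?g t = duhamel (?a n) (?a m) ?g t + (duhamel (?a m) (?b m) ?g t + duhamel (?b m) (?b n) ?g t)"
    unfolding duhamel_combine[OF le(1,2) order_trans[OF le(3,4)] c] duhamel_combine[OF le(5,3,4) c] ..
  then have "apply_bcontfun (truncated_duhamel n g - truncated_duhamel m g) t = duhamel (?a n) (?a m) ?g t + duhamel (?b m) (?b n) ?g t"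
    by (simp only: minus_bcontfun.rep_eq apply_truncated_duhamel) simp
  also have "norm \<dots> \<le> smoothing_const * (Kern (?a m) - Kern (?a n)) * norm g + smoothing_const * (Kern (?b n) - Kern (?b m)) * norm g"
    by (intro norm_triangle_mono norm_duhamel_le le c b)
  also have "\<dots> = smoothing_const * (Kern (?a m) - Kern (?a n) + (Kern (?b n) - Kern (?b m))) * norm g"
    by (simp add: algebra_simps)
  also have "\<dots> \<le> smoothing_const * (Kern (?a m) + 1 - Kern (?b m)) * norm g"
    using Kern_bounds[OF le(1)] Kern_bounds[of "?b n"] smoothing_const_pos
    by (intro mult_right_mono mult_left_mono) auto
  finally show "norm (apply_bcontfun (truncated_duhamel n g - truncated_duhamel m g) t) \<le> smoothing_const * (Kern (?a m) + 1 - Kern (?b m)) * norm g" .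
qed

text \<open>The whole-line Duhamel integral over elapsed times from 0 to infinity. Taking the limit
  in the uniform norm yields boundedness and continuity into H^2 together with the value.\<close>

definition Psi :: "(real \<Rightarrow>\<^sub>C L2I) \<Rightarrow> (real \<Rightarrow>\<^sub>C H2I)" where
  "Psi g = lim (\<lambda>n. truncated_duhamel n g)"

lemma Psi_tendsto: "(\<lambda>n. truncated_duhamel n g) \<longlonglongrightarrow> Psi g"
proof -
  let ?r = "\<lambda>m. smoothing_const * (Kern (1 / real (Suc m)) + 1 - Kern (real (Suc m))) * norm g"
  have r: "?r \<longlonglongrightarrow> smoothing_const * (0 + 1 - 1) * norm g"
    by (intro tendsto_intros Kern_tendsto_0 Kern_tendsto_1)
  have "Cauchy (\<lambda>n. truncated_duhamel n g)"
  proof (rule CauchyI)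
    fix e :: real assume "0 < e"
    with r have "\<forall>\<^sub>F m in sequentially. ?r m < e" by (intro order_tendstoD) auto
    then obtain N where N: "\<And>m. m \<ge> N \<Longrightarrow> ?r m < e" unfolding eventually_sequentially by blast
    have "norm (truncated_duhamel n g - truncated_duhamel m g) < e" if "N \<le> m" "m \<le> n" for m n
      using truncated_duhamel_dist_le[OF that(2)] N[OF that(1)] by (rule order_le_less_trans)
    then have "norm (truncated_duhamel m g - truncated_duhamel n g) < e" if "N \<le> m" "N \<le> n" for m n
      using that by (metis norm_minus_commute nat_le_linear)
    then show "\<exists>M. \<forall>m\<ge>M. \<forall>n\<ge>M. norm (truncated_duhamel m g - truncated_duhamel n g) < e" by blast
  qed
  then show ?thesis
    unfolding Psi_def by (simp add: Cauchy_convergent_iff convergent_LIMSEQ_iff)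
qed

lemma norm_Psi_le: "norm (Psi g) \<le> smoothing_const * norm g"
  by (rule LIMSEQ_le_const2[OF tendsto_norm[OF Psi_tendsto]]) (use norm_truncated_duhamel_le in blast)

lemma Psi_diff: "Psi (g - h) = Psi g - Psi h"
proof -
  have "truncated_duhamel n (g - h) = truncated_duhamel n g - truncated_duhamel n h" for n
  proof (rule bcontfun_eqI)
    fix t
    let ?a = "1 / real (Suc n)" and ?b = "real (Suc n)"
    have "integral {?a..?b} (\<lambda>\<sigma>. T \<sigma> (apply_bcontfun (g - h) (t - \<sigma>)))
        = integral {?a..?b} (\<lambda>\<sigma>. T \<sigma> (apply_bcontfun g (t - \<sigma>)) - T \<sigma> (apply_bcontfun h (t - \<sigma>)))"
    proof (rule hk_integral_cong)
      fix \<sigma> assume "\<sigma> \<in> {?a..?b}"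
      moreover have "0 < ?a" by simp
      ultimately have "0 < \<sigma>" by (simp only: atLeastAtMost_iff) linarith
      then show "T \<sigma> (apply_bcontfun (g - h) (t - \<sigma>))
          = T \<sigma> (apply_bcontfun g (t - \<sigma>)) - T \<sigma> (apply_bcontfun h (t - \<sigma>))"
        by (simp add: linear_diff bounded_linear.linear bounded_linear_T)
    qed
    also have "\<dots> = integral {?a..?b} (\<lambda>\<sigma>. T \<sigma> (apply_bcontfun g (t - \<sigma>)))
        - integral {?a..?b} (\<lambda>\<sigma>. T \<sigma> (apply_bcontfun h (t - \<sigma>)))"
      by (intro hk_integral_diff integrable_continuous_real continuous_on_T_slice) auto
    finally show "apply_bcontfun (truncated_duhamel n (g - h)) t = apply_bcontfun (truncated_duhamel n g - truncated_duhamel n h) t"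
      unfolding minus_bcontfun.rep_eq[of "truncated_duhamel n g"] apply_truncated_duhamel duhamel_def .
  qed
  then have "(\<lambda>n. truncated_duhamel n g - truncated_duhamel n h) \<longlonglongrightarrow> Psi (g - h)"
    using Psi_tendsto[of "g - h"] by simp
  then show ?thesis
    by (rule LIMSEQ_unique) (intro tendsto_diff Psi_tendsto)
qed

section \<open>The integral equation for the Duhamel operator, and uniqueness of bounded
  solutions\<close>

lemma continuous_on_S_shift:
  assumes g: "continuous_on UNIV g" and "0 \<le> a"
  shows "continuous_on {a..b} (\<lambda>\<sigma>. S \<sigma> (g (t - \<sigma>)))"
  using assms(2) by (intro continuous_on_S_compose continuous_on_compose2[OF g] continuous_intros) auto

text \<open>On L^2 the semigroup has no singularity at 0, so the lower limit can be moved to 0 at a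
  cost of at most norm g / (n + 1). This expresses \<open>Psi\<close> through \<open>S\<close>
  alone.\<close>

lemma Psi_tendsto_L2:
  "(\<lambda>n. integral {0..real (Suc n)} (\<lambda>\<sigma>. S \<sigma> (apply_bcontfun g (t - \<sigma>)))) \<longlonglongrightarrow> of_H2 (apply_bcontfun (Psi g) t)"
proof -
  let ?a = "\<lambda>n. 1 / real (Suc n)" and ?b = "\<lambda>n. real (Suc n)" and ?g = "apply_bcontfun g"
  let ?G = "\<lambda>\<sigma>. S \<sigma> (?g (t - \<sigma>))"
  have c: "continuous_on UNIV ?g" by simp
  have "(\<lambda>n. apply_bcontfun (truncated_duhamel n g) t) \<longlonglongrightarrow> apply_bcontfun (Psi g) t"
  proof (rule Lim_null_comparison[THEN LIM_zero_cancel, OF always_eventually])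
    show "\<forall>n. norm (apply_bcontfun (truncated_duhamel n g) t - apply_bcontfun (Psi g) t) \<le> norm (truncated_duhamel n g - Psi g)"
      using norm_bounded[of "truncated_duhamel _ g - Psi g" t] by simp
    show "(\<lambda>n. norm (truncated_duhamel n g - Psi g)) \<longlonglongrightarrow> 0"
      by (intro tendsto_norm_zero LIM_zero Psi_tendsto)
  qed
  then have "(\<lambda>n. of_H2 (apply_bcontfun (truncated_duhamel n g) t)) \<longlonglongrightarrow> of_H2 (apply_bcontfun (Psi g) t)"
    by (rule bounded_linear.tendsto[OF bounded_linear_of_H2])
  moreover have "of_H2 (apply_bcontfun (truncated_duhamel n g) t) = integral {?a n..?b n} ?G" for n
  proof -
    have "of_H2 (apply_bcontfun (truncated_duhamel n g) t) = integral {?a n..?b n} (of_H2 \<circ> (\<lambda>\<sigma>. T \<sigma> (?g (t - \<sigma>))))"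
      unfolding apply_truncated_duhamel duhamel_def
      by (intro integral_linear[symmetric] bounded_linear_of_H2 integrable_continuous_real continuous_on_T_slice c) simp
    also have "\<dots> = integral {?a n..?b n} ?G"
    proof (rule hk_integral_cong)
      fix \<sigma> assume "\<sigma> \<in> {?a n..?b n}"
      moreover have "0 < ?a n" by simp
      ultimately have "0 < \<sigma>" by (simp only: atLeastAtMost_iff) linarith
      then show "(of_H2 \<circ> (\<lambda>\<sigma>. T \<sigma> (?g (t - \<sigma>)))) \<sigma> = ?G \<sigma>" by (simp add: of_H2_T)
    qed
    finally show ?thesis .
  qed
  ultimately have 1: "(\<lambda>n. integral {?a n..?b n} ?G) \<longlonglongrightarrow> of_H2 (apply_bcontfun (Psi g) t)" by simp
  have 2: "(\<lambda>n. integral {0..?a n} ?G) \<longlonglongrightarrow> 0"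
  proof (rule Lim_null_comparison[OF always_eventually])
    show "\<forall>n. norm (integral {0..?a n} ?G) \<le> ?a n * norm g"
    proof
      fix n
      have "norm (integral {0..?a n} ?G) \<le> integral {0..?a n} (\<lambda>_. norm g)"
      proof (rule integral_norm_bound_integral)
        show "?G integrable_on {0..?a n}"
          by (intro integrable_continuous_real continuous_on_S_shift c) simp
        show "norm (?G \<sigma>) \<le> norm g" if "\<sigma> \<in> {0..?a n}" for \<sigma>
          using that S_norm[of \<sigma> "?g (t - \<sigma>)"] norm_bounded[of g "t - \<sigma>"] by (simp del: of_nat_Suc)
      qed (intro integrable_continuous_real continuous_intros)
      then show "norm (integral {0..?a n} ?G) \<le> ?a n * norm g" by simp
    qed
    have "(\<lambda>n. ?a n * norm g) \<longlonglongrightarrow> 0 * norm g"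
      by (intro tendsto_mult tendsto_const LIMSEQ_Suc[OF lim_1_over_n])
    then show "(\<lambda>n. ?a n * norm g) \<longlonglongrightarrow> 0" by simp
  qed
  have "integral {0..?a n} ?G + integral {?a n..?b n} ?G = integral {0..?b n} ?G" for n
    by (intro hk_integral_combine integrable_continuous_real continuous_on_S_shift c inverse_Suc_le) auto
  with tendsto_add[OF 2 1] show ?thesis by simp
qed

lemma integral_reverse:
  fixes f :: "real \<Rightarrow> 'a::banach"
  shows "integral {r..t} f = integral {0..t - r} (\<lambda>\<sigma>. f (t - \<sigma>))"
proof -
  have "integral {r..t} f = integral {-t..-r} (\<lambda>s. f (- s))"
    using Henstock_Kurzweil_Integration.integral_reflect_real[of t r f] by simp
  also have "\<dots> = integral {0 + -t..(t - r) + -t} (\<lambda>s. f (- s))" by simp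
  also have "\<dots> = integral {0..t - r} (\<lambda>s. f (- (s + -t)))"
    by (rule integral_shift_real[symmetric])
  finally show ?thesis by simp
qed

text \<open>Applying S (t - r) to the integral at time \<open>r\<close> shifts elapsed times by d =
  t - r. Compared with the integral at time \<open>t\<close>, the interval [0,d] is missing, which
  is exactly the integral over [r,t], and a piece of length \<open>d\<close> is added far out, which
  vanishes by the decay.\<close>

lemma Psi_mild:
  assumes rt: "r \<le> t"
  shows "of_H2 (apply_bcontfun (Psi g) t)
    = S (t - r) (of_H2 (apply_bcontfun (Psi g) r)) + integral {r..t} (\<lambda>s. S (t - s) (apply_bcontfun g s))"
proof -
  let ?g = "apply_bcontfun g" and ?b = "\<lambda>n. real (Suc n)"
  let ?G = "\<lambda>t \<sigma>. S \<sigma> (?g (t - \<sigma>))"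
  define d where "d = t - r"
  have d: "0 \<le> d" using rt by (simp add: d_def)
  have c: "continuous_on UNIV ?g" by simp
  have io: "?G t integrable_on {a..b}" if "0 \<le> a" for a b t
    using that by (intro integrable_continuous_real continuous_on_S_shift c)
  have shift: "S d (integral {0..?b n} (?G r)) = integral {0..?b n} (?G t) + integral {?b n..?b n + d} (?G t) - integral {0..d} (?G t)" for n
  proof -
    have "S d (integral {0..?b n} (?G r)) = integral {0..?b n} (S d \<circ> ?G r)"
      by (intro integral_linear[symmetric] bounded_linear_S d io) simp
    also have "\<dots> = integral {0..?b n} (\<lambda>\<sigma>. ?G t (\<sigma> + d))"
    proof (rule hk_integral_cong)
      fix \<sigma> assume "\<sigma> \<in> {0..?b n}"
      then show "(S d \<circ> ?G r) \<sigma> = ?G t (\<sigma> + d)"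
        using S_plus[of d \<sigma> "?g (r - \<sigma>)"] d by (simp add: d_def algebra_simps)
    qed
    also have "\<dots> = integral {d..?b n + d} (?G t)"
      using integral_shift_real[of 0 "?b n" "?G t" d] by simp
    also have "\<dots> = integral {0..?b n + d} (?G t) - integral {0..d} (?G t)"
      using hk_integral_combine[of 0 d "?b n + d" "?G t"] d io[of 0]
      by (simp add: algebra_simps)
    also have "integral {0..?b n + d} (?G t) = integral {0..?b n} (?G t) + integral {?b n..?b n + d} (?G t)"
      using hk_integral_combine[of 0 "?b n" "?b n + d" "?G t"] d io[of 0] by simp
    finally show ?thesis .
  qed
  have tail: "(\<lambda>n. integral {?b n..?b n + d} (?G t)) \<longlonglongrightarrow> 0"
  proof (rule Lim_null_comparison[OF always_eventually])
    let ?e = "\<lambda>n. sqrt (2 * exp (- rate * ?b n)) * norm g * d"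
    show "\<forall>n. norm (integral {?b n..?b n + d} (?G t)) \<le> ?e n"
    proof
      fix n
      have "norm (integral {?b n..?b n + d} (?G t)) \<le> integral {?b n..?b n + d} (\<lambda>_. sqrt (2 * exp (- rate * ?b n)) * norm g)"
      proof (rule integral_norm_bound_integral)
        show "?G t integrable_on {?b n..?b n + d}" by (rule io) simp
        fix \<sigma> assume s: "\<sigma> \<in> {?b n..?b n + d}"
        then have "0 \<le> \<sigma>" by (simp only: atLeastAtMost_iff) (smt (verit) of_nat_0_le_iff)
        then have "(norm (?G t \<sigma>))\<^sup>2 \<le> 2 * exp (- rate * \<sigma>) * (norm (?g (t - \<sigma>)))\<^sup>2" by (rule decay)
        also have "\<dots> \<le> 2 * exp (- rate * ?b n) * (norm g)\<^sup>2"
          using s rate_pos norm_bounded[of g "t - \<sigma>"]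
          by (intro mult_mono power_mono) (auto simp del: of_nat_Suc)
        also have "\<dots> = (sqrt (2 * exp (- rate * ?b n)) * norm g)\<^sup>2" by (simp add: power_mult_distrib)
        finally show "norm (?G t \<sigma>) \<le> sqrt (2 * exp (- rate * ?b n)) * norm g"
          by (rule power2_le_imp_le) simp
      qed (intro integrable_continuous_real continuous_intros)
      then show "norm (integral {?b n..?b n + d} (?G t)) \<le> ?e n" using d by (simp add: mult_ac)
    qed
    have "?e \<longlonglongrightarrow> sqrt (2 * 0) * norm g * d"
      by (intro tendsto_intros LIMSEQ_Suc[OF exp_rate_tendsto])
    then show "?e \<longlonglongrightarrow> 0" by simp
  qed
  have "(\<lambda>n. S d (integral {0..?b n} (?G r))) \<longlonglongrightarrow> S d (of_H2 (apply_bcontfun (Psi g) r))"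
    by (rule bounded_linear.tendsto[OF bounded_linear_S[OF d] Psi_tendsto_L2])
  moreover have "(\<lambda>n. integral {0..?b n} (?G t) + integral {?b n..?b n + d} (?G t) - integral {0..d} (?G t))
      \<longlonglongrightarrow> of_H2 (apply_bcontfun (Psi g) t) + 0 - integral {0..d} (?G t)"
    by (intro tendsto_intros Psi_tendsto_L2 tail)
  ultimately have "S d (of_H2 (apply_bcontfun (Psi g) r)) = of_H2 (apply_bcontfun (Psi g) t) + 0 - integral {0..d} (?G t)"
    unfolding shift by (rule LIMSEQ_unique)
  moreover have "integral {r..t} (\<lambda>s. S (t - s) (?g s)) = integral {0..d} (?G t)"
    unfolding d_def by (subst integral_reverse) simp
  ultimately show ?thesis by (simp add: d_def)
qed

lemma mild_integrable:
  assumes "continuous_on UNIV g"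
  shows "(\<lambda>s. S (t - s) (g s)) integrable_on {r..t}"
  by (intro integrable_continuous_real continuous_on_S_compose continuous_intros continuous_on_subset[OF assms]) auto

text \<open>The difference of two bounded solutions satisfies \<open>d(t) = S(t - r) d(r)\<close>, which decays as
  \<open>r\<close> tends to \<open>-\<infinity>\<close>.\<close>

lemma bounded_mild_unique:
  assumes mild: "\<And>r t. r \<le> t \<Longrightarrow> y t = S (t - r) (y r) + integral {r..t} (\<lambda>s. S (t - s) (apply_bcontfun g s))"
    and bd: "\<And>t. norm (y t) \<le> B"
  shows "y t = of_H2 (apply_bcontfun (Psi g) t)"
proof -
  define d where "d t = y t - of_H2 (apply_bcontfun (Psi g) t)" for t
  have dS: "d t = S (t - r) (d r)" if "r \<le> t" for r
    using mild[OF that] Psi_mild[OF that, of g] that by (simp add: d_def S_diff)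
  have db: "norm (d s) \<le> B + norm (Psi g)" for s
    using norm_triangle_ineq4[of "y s" "of_H2 (apply_bcontfun (Psi g) s)"] bd[of s]
      norm_of_H2_le[of "apply_bcontfun (Psi g) s"] norm_bounded[of "Psi g" s] by (simp add: d_def)
  let ?M = "B + norm (Psi g)"
  have le: "(norm (d t))\<^sup>2 \<le> 2 * exp (- rate * real n) * ?M\<^sup>2" for n
  proof -
    have "(norm (d t))\<^sup>2 \<le> 2 * exp (- rate * real n) * (norm (d (t - real n)))\<^sup>2"
      using dS[of "t - real n"] decay[of "real n" "d (t - real n)"] by simp
    also have "\<dots> \<le> 2 * exp (- rate * real n) * ?M\<^sup>2"
      using db by (intro mult_left_mono power_mono) auto
    finally show ?thesis .
  qed
  have "(\<lambda>n. 2 * exp (- rate * real n) * ?M\<^sup>2) \<longlonglongrightarrow> 2 * 0 * ?M\<^sup>2"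
    by (intro tendsto_intros exp_rate_tendsto)
  then have "(norm (d t))\<^sup>2 \<le> 2 * 0 * ?M\<^sup>2" by (rule LIMSEQ_le_const) (use le in blast)
  then show ?thesis by (simp add: d_def)
qed

end

section \<open>The nonlinear forcing\<close>

lemma bounded_bilinear_scaleC: "bounded_bilinear scaleC_L2"
proof
  show "scaleC_L2 (c + d) u = scaleC_L2 c u + scaleC_L2 d u" for c d u
    unfolding scaleC_eq_toL2 by (simp add: distrib_right toL2_add sq_integrable_cmult)
  show "scaleC_L2 c (u + v) = scaleC_L2 c u + scaleC_L2 c v" for c u v
    using toL2_cmult[of "\<lambda>x. rep_L2 u x + rep_L2 v x" c]
    by (simp add: toL2_add sq_integrable_add sq_integrable_cmult distrib_left scaleC_eq_toL2[of c u] scaleC_eq_toL2[of c v])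
  show "scaleC_L2 (r *\<^sub>R c) u = r *\<^sub>R scaleC_L2 c u" for r c u
    unfolding scaleC_eq_toL2 using toL2_scaleR[of "\<lambda>x. c * rep_L2 u x" r]
    by (simp add: sq_integrable_cmult del: scaleR_conv_of_real)
  show "scaleC_L2 c (r *\<^sub>R u) = r *\<^sub>R scaleC_L2 c u" for r c u
    using toL2_cmult[of "\<lambda>x. r *\<^sub>R rep_L2 u x" c] toL2_scaleR[of "\<lambda>x. c * rep_L2 u x" r]
    by (simp add: toL2_scaleR sq_integrable_scaleR sq_integrable_cmult scaleC_eq_toL2[of c u] del: scaleR_conv_of_real)
  show "\<exists>K. \<forall>c u. norm (scaleC_L2 c u) \<le> norm c * norm u * K"
    by (intro exI[of _ 1]) (simp add: norm_scaleC_L2)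
qed

definition mult_op :: "(real \<Rightarrow> complex) \<Rightarrow> L2I \<Rightarrow> L2I" where
  "mult_op f u = toL2 (\<lambda>x. f x * rep_L2 u x)"

lemma sq_integrable_mult_op:
  assumes "f \<in> borel_measurable MI" "AE x in MI. norm (f x) \<le> M"
  shows "sq_integrable (\<lambda>x. f x * rep_L2 u x)"
  by (rule sq_integrable_mult_bounded[OF assms(1) sq_integrable_rep assms(2)])

lemma mult_op_bounded_linear:
  assumes f: "f \<in> borel_measurable MI" "AE x in MI. norm (f x) \<le> M" and M: "0 \<le> M"
  shows "bounded_linear (mult_op f)" "norm (mult_op f u) \<le> M * norm u"
proof -
  note sq = sq_integrable_mult_op[OF f]
  show nb: "norm (mult_op f u) \<le> M * norm u" for u
    using norm_toL2_mult_bounded[OF f(1) sq_integrable_rep f(2) M, of u] by (simp add: mult_op_def)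
  show "bounded_linear (mult_op f)"
  proof (rule bounded_linear_intro)
    show "mult_op f (u + v) = mult_op f u + mult_op f v" for u v
      unfolding mult_op_def toL2_add[OF sq sq, symmetric]
      by (rule toL2_cong_AE[OF sq sq_integrable_add[OF sq sq]])
        (use rep_add[of u v] in eventually_elim, simp add: distrib_left)
    show "mult_op f (c *\<^sub>R u) = c *\<^sub>R mult_op f u" for c u
      unfolding mult_op_def toL2_scaleR[OF sq, symmetric]
      by (rule toL2_cong_AE[OF sq sq_integrable_scaleR[OF sq]])
        (use rep_scaleR[of c u] in eventually_elim, simp del: scaleR_conv_of_real)
    show "norm (mult_op f u) \<le> norm u * M" for u using nb[of u] by (simp add: mult.commute)
  qed
qed

lemma H2_sup_bound: "AE x in MI. norm (rep_L2 (of_H2 y) x) \<le> 2 * norm y"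
proof -
  have "weak_deriv 1 (of_H2 y) (h2d 1 y)" using weak_deriv_1_h2d[of 0 y] by simp
  from sobolev_1_bound[OF this] show ?thesis
    by eventually_elim (use norm_of_H2_le[of y] norm_h2d_le[of 1 y] in simp)
qed

text \<open>The term y y_x in polarised form: continuity in time and the Lipschitz estimate both
  follow from bounded bilinearity.\<close>

definition convection :: "H2I \<Rightarrow> H2I \<Rightarrow> L2I" where
  "convection y w = mult_op (rep_L2 (of_H2 y)) (h2d 1 w)"

lemma norm_convection_le: "norm (convection y w) \<le> 2 * norm y * norm w"
proof -
  have "norm (convection y w) \<le> 2 * norm y * norm (h2d 1 w)"
    unfolding convection_def by (rule mult_op_bounded_linear(2)[OF rep_L2_measurable H2_sup_bound]) simp
  also have "\<dots> \<le> 2 * norm y * norm w"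
    using norm_h2d_le[of 1 w] by (intro mult_left_mono) auto
  finally show ?thesis .
qed

lemma bounded_bilinear_convection: "bounded_bilinear convection"
proof
  note bl = mult_op_bounded_linear(1)[OF rep_L2_measurable H2_sup_bound]
  note sq = sq_integrable_mult_op[OF rep_L2_measurable H2_sup_bound]
  note lin = bounded_linear.linear[OF bounded_linear_of_H2]
  show "convection y (w + w') = convection y w + convection y w'" for y w w'
    unfolding convection_def by (simp add: h2d_add linear_add[OF bounded_linear.linear[OF bl]])
  show "convection y (c *\<^sub>R w) = c *\<^sub>R convection y w" for y c w
    unfolding convection_def by (simp add: h2d_scaleR linear_scale[OF bounded_linear.linear[OF bl]])
  show "convection (y + y') w = convection y w + convection y' w" for y y' w
    unfolding convection_def mult_op_def toL2_add[OF sq sq, symmetric]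
    by (rule toL2_cong_AE[OF sq sq_integrable_add[OF sq sq]])
      (use rep_add[of "of_H2 y" "of_H2 y'"] in eventually_elim, simp add: distrib_right linear_add[OF lin])
  show "convection (c *\<^sub>R y) w = c *\<^sub>R convection y w" for c y w
    unfolding convection_def mult_op_def toL2_scaleR[OF sq, symmetric]
    by (rule toL2_cong_AE[OF sq sq_integrable_scaleR[OF sq]])
      (use rep_scaleR[of c "of_H2 y"] in eventually_elim, simp add: linear_scale[OF lin] del: scaleR_conv_of_real)
  show "\<exists>K. \<forall>y w. norm (convection y w) \<le> norm y * norm w * K"
    using norm_convection_le by (intro exI[of _ 2]) (auto simp: mult_ac)
qed

section \<open>The boundary profile\<close>

lemma profA_deriv: "(profA \<alpha> has_real_derivative (2 * ((\<alpha> - 1) / (\<alpha> + 1)) * x + 2 / (\<alpha> + 1))) (at x)"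
proof -
  have "((\<lambda>x. p * x\<^sup>2 + q * x - 1) has_real_derivative (2 * p * x + q)) (at x)" for p q :: real
    by (auto intro!: derivative_eq_intros)
  then show ?thesis unfolding profA_def[abs_def] .
qed

lemma deriv_profA: "deriv (profA \<alpha>) = (\<lambda>x. 2 * ((\<alpha> - 1) / (\<alpha> + 1)) * x + 2 / (\<alpha> + 1))"
  by (intro ext DERIV_imp_deriv profA_deriv)

lemma continuous_profA: "continuous_on A (profA \<alpha>)" "continuous_on A (deriv (profA \<alpha>))"
proof -
  show "continuous_on A (deriv (profA \<alpha>))" unfolding deriv_profA by (intro continuous_intros)
  show "continuous_on A (profA \<alpha>)" unfolding profA_def[abs_def] by (intro continuous_intros)
qed

lemma weak_deriv_1_classical:
  assumes f: "\<And>x. x \<in> {0..1} \<Longrightarrow> (f has_vector_derivative f' x) (at x within {0..1})"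
    and f': "continuous_on {0..1} f'"
  shows "weak_deriv 1 (toL2 f) (toL2 f')"
  unfolding weak_deriv_def
proof (intro allI impI)
  fix \<psi> assume \<psi>: "test_fun \<psi>"
  have fc: "continuous_on {0..1} f" using f continuous_on_vector_derivative by blast
  have rep: "(LINT x|MI. rep_L2 (toL2 g) x * of_real ((deriv ^^ j) \<psi> x)) = integral {0..1} (\<lambda>x. g x * of_real ((deriv ^^ j) \<psi> x))"
    if g: "continuous_on {0..1} g" for g j
  proof -
    have "(LINT x|MI. rep_L2 (toL2 g) x * of_real ((deriv ^^ j) \<psi> x)) = (LINT x|MI. g x * of_real ((deriv ^^ j) \<psi> x))"
      by (intro integral_cong_AE borel_measurable_integrable integrable_mult_test \<psi> sq_integrable_rep sq_integrable_continuous g)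
        (use AE_rep_toL2[OF sq_integrable_continuous[OF g]] in eventually_elim, simp)
    also have "\<dots> = integral {0..1} (\<lambda>x. g x * of_real ((deriv ^^ j) \<psi> x))"
      by (intro LINT_MI_eq_integral(1) continuous_intros g continuous_on_test_fun \<psi>)
    finally show ?thesis .
  qed
  obtain a b where ab: "0 < a" "a < b" "b < 1" "\<And>x. x \<notin> {a..b} \<Longrightarrow> \<psi> x = 0"
    using test_funE[OF \<psi>] by metis
  have ends: "\<psi> 0 = 0" "\<psi> 1 = 0" using ab(1-3) by (auto intro: ab(4))
  have "((\<lambda>x. f x * of_real (deriv \<psi> x) + f' x * of_real (\<psi> x)) has_integral
      f 1 * of_real (\<psi> 1) - f 0 * of_real (\<psi> 0)) {0..1}"
  proof (rule fundamental_theorem_of_calculus)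
    fix x :: real assume x: "x \<in> {0..1}"
    have "((\<lambda>x. complex_of_real (\<psi> x)) has_vector_derivative of_real (deriv \<psi> x)) (at x within {0..1})"
      using test_fun_derivs[OF \<psi>, of 0 x]
      by (intro has_vector_derivative_at_within[OF has_vector_derivative_of_real]) simp
    then show "((\<lambda>x. f x * of_real (\<psi> x)) has_vector_derivative f x * of_real (deriv \<psi> x) + f' x * of_real (\<psi> x)) (at x within {0..1})"
      by (rule has_vector_derivative_mult[OF f[OF x]])
  qed simp
  then have "integral {0..1} (\<lambda>x. f x * of_real (deriv \<psi> x) + f' x * of_real (\<psi> x)) = 0"
    by (simp add: integral_unique ends)
  moreover have "integral {0..1} (\<lambda>x. f x * of_real (deriv \<psi> x) + f' x * of_real (\<psi> x))
      = integral {0..1} (\<lambda>x. f x * of_real (deriv \<psi> x)) + integral {0..1} (\<lambda>x. f' x * of_real (\<psi> x))"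
    using continuous_on_test_fun[OF \<psi>, of "{0..1}" 0] continuous_on_test_fun[OF \<psi>, of "{0..1}" 1]
    by (intro hk_integral_add integrable_continuous_real continuous_intros fc f') auto
  ultimately show "(LINT x|MI. rep_L2 (toL2 f) x * of_real ((deriv ^^ 1) \<psi> x))
      = (-1) ^ 1 * (LINT x|MI. rep_L2 (toL2 f') x * of_real (\<psi> x))"
    using rep[OF fc, of 1] rep[OF f', of 0] by (simp add: add_eq_0_iff)
qed

lemma weak_deriv_2I:
  assumes "weak_deriv 1 u v" "weak_deriv 1 v w"
  shows "weak_deriv 2 u w"
  using assms test_fun_deriv unfolding weak_deriv_def
  by (simp add: numeral_2_eq_2)

lemma toL2_quadratic_sobolev: "toL2 (\<lambda>x. c * of_real (profA \<alpha> x)) \<in> sobolev 2"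
proof -
  let ?f = "\<lambda>x. c * complex_of_real (profA \<alpha> x)" and ?f1 = "\<lambda>x. c * complex_of_real (deriv (profA \<alpha>) x)"
  let ?f2 = "\<lambda>x::real. c * complex_of_real (2 * ((\<alpha> - 1) / (\<alpha> + 1)))"
  have 1: "weak_deriv 1 (toL2 ?f) (toL2 ?f1)"
  proof (rule weak_deriv_1_classical)
    show "(?f has_vector_derivative ?f1 x) (at x within {0..1})" for x
      using profA_deriv[of \<alpha> x] unfolding deriv_profA
      by (intro has_vector_derivative_mult_right has_vector_derivative_at_within[OF has_vector_derivative_of_real])
  qed (intro continuous_intros continuous_profA)
  have 2: "weak_deriv 1 (toL2 ?f1) (toL2 ?f2)"
  proof (rule weak_deriv_1_classical)
    have "(deriv (profA \<alpha>) has_real_derivative 2 * ((\<alpha> - 1) / (\<alpha> + 1))) (at x)" for x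
    proof -
      have "((\<lambda>x. p * x + q) has_real_derivative p) (at x)" for p q :: real
        by (auto intro!: derivative_eq_intros)
      then show ?thesis unfolding deriv_profA .
    qed
    then show "(?f1 has_vector_derivative ?f2 x) (at x within {0..1})" for x
      by (intro has_vector_derivative_mult_right has_vector_derivative_at_within[OF has_vector_derivative_of_real])
  qed (intro continuous_intros)
  have "\<exists>w. weak_deriv j (toL2 ?f) w" if "j \<le> 2" for j
  proof -
    have "j = 0 \<or> j = 1 \<or> j = 2" using that by auto
    then show ?thesis using weak_deriv_0 1 weak_deriv_2I[OF 1 2] by blast
  qed
  then show ?thesis by (auto simp: sobolev_def)
qed

definition profile :: "real \<Rightarrow> complex \<Rightarrow> H2I" where
  "profile \<alpha> c = Abs_H2 (toL2 (\<lambda>x. c * of_real (profA \<alpha> x)))"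

lemma of_H2_profile: "of_H2 (profile \<alpha> c) = toL2 (\<lambda>x. c * of_real (profA \<alpha> x))"
  unfolding profile_def by (rule Abs_H2_inverse[OF toL2_quadratic_sobolev])

text \<open>\<open>H2I\<close> carries a real vector space structure only, so a complex factor is
  split into two real ones. The norm bound and the continuity in \<open>c\<close> rest on
  this.\<close>

lemma profile_decompose: "profile \<alpha> c = Re c *\<^sub>R profile \<alpha> 1 + Im c *\<^sub>R profile \<alpha> \<i>"
proof (rule of_H2_inject')
  note lin = bounded_linear.linear[OF bounded_linear_of_H2]
  have sq: "sq_integrable (\<lambda>x. d * complex_of_real (profA \<alpha> x))" for d
    by (intro sq_integrable_continuous continuous_intros continuous_profA)
  have "of_H2 (Re c *\<^sub>R profile \<alpha> 1 + Im c *\<^sub>R profile \<alpha> \<i>)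
      = toL2 (\<lambda>x. Re c *\<^sub>R (1 * of_real (profA \<alpha> x)) + Im c *\<^sub>R (\<i> * of_real (profA \<alpha> x)))"
    unfolding linear_add[OF lin] linear_scale[OF lin] of_H2_profile
    by (simp only: toL2_add toL2_scaleR sq sq_integrable_scaleR)
  also have "\<dots> = of_H2 (profile \<alpha> c)"
    unfolding of_H2_profile
    by (rule toL2_cong) (subst complex_eq[of c], simp add: scaleR_conv_of_real algebra_simps)
  finally show "of_H2 (profile \<alpha> c) = of_H2 (Re c *\<^sub>R profile \<alpha> 1 + Im c *\<^sub>R profile \<alpha> \<i>)" by simp
qed

definition profile_const :: "real \<Rightarrow> real" where
  "profile_const \<alpha> = norm (profile \<alpha> 1) + norm (profile \<alpha> \<i>)"

lemma norm_profile_le: "norm (profile \<alpha> c) \<le> profile_const \<alpha> * norm c"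
proof -
  have "norm (profile \<alpha> c) \<le> \<bar>Re c\<bar> * norm (profile \<alpha> 1) + \<bar>Im c\<bar> * norm (profile \<alpha> \<i>)"
    by (subst profile_decompose) (metis norm_triangle_ineq norm_scaleR)
  also have "\<dots> \<le> norm c * norm (profile \<alpha> 1) + norm c * norm (profile \<alpha> \<i>)"
    by (intro add_mono mult_right_mono abs_Re_le_cmod abs_Im_le_cmod) auto
  finally show ?thesis by (simp add: profile_const_def algebra_simps)
qed

lemma continuous_on_profile: "continuous_on A f \<Longrightarrow> continuous_on A (\<lambda>t. profile \<alpha> (f t))"
  by (subst profile_decompose) (intro continuous_intros)

text \<open>Both coefficients carry the factor -\<phi>(t), so the terms -a y_x - b y equal \<phi>(t)
  times this operator, which does not depend on time.\<close>

definition linear_part :: "real \<Rightarrow> H2I \<Rightarrow> L2I" where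
  "linear_part \<alpha> y = mult_op (\<lambda>x. of_real (profA \<alpha> x)) (h2d 1 y) + mult_op (\<lambda>x. of_real (deriv (profA \<alpha>) x)) (of_H2 y)"

lemma continuous_measurable_bounded:
  fixes f :: "real \<Rightarrow> complex"
  assumes "continuous_on {0..1} f"
  obtains M where "f \<in> borel_measurable MI" "AE x in MI. norm (f x) \<le> M" "0 \<le> M"
proof -
  have "compact (f ` {0..1})" by (intro compact_continuous_image assms) auto
  then obtain M where M: "\<And>x. x \<in> {0..1} \<Longrightarrow> norm (f x) \<le> M"
    by (meson bounded_iff compact_imp_bounded imageI)
  have "f \<in> borel_measurable MI"
    using sq_integrable_continuous[OF assms] by (simp add: sq_integrable_def)
  moreover have "AE x in MI. norm (f x) \<le> M" using M by (intro AE_I2) auto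
  moreover have "0 \<le> M" using order_trans[OF norm_ge_zero M[of 0]] by simp
  ultimately show ?thesis using that by blast
qed

lemma bounded_linear_mult_op_continuous: "continuous_on {0..1} f \<Longrightarrow> bounded_linear (mult_op f)"
  using mult_op_bounded_linear(1) continuous_measurable_bounded by metis

lemma bounded_linear_linear_part: "bounded_linear (linear_part \<alpha>)"
  unfolding linear_part_def[abs_def]
  by (intro bounded_linear_add bounded_linear_compose[OF bounded_linear_mult_op_continuous bounded_linear_h2d]
      bounded_linear_compose[OF bounded_linear_mult_op_continuous bounded_linear_of_H2] continuous_intros continuous_profA) simp

definition source0 :: "real \<Rightarrow> L2I" where
  "source0 \<alpha> = toL2 (\<lambda>x. of_real (profA \<alpha> x))"

definition source1 :: "real \<Rightarrow> L2I" where
  "source1 \<alpha> = toL2 (\<lambda>x. of_real (profA \<alpha> x) * of_real (deriv (profA \<alpha>) x))"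

lemma forcing_eq:
  assumes "y s = of_H2 Y"
  shows "forcing \<alpha> \<phi> y s = - convection Y Y + scaleC_L2 (\<phi> s) (linear_part \<alpha> Y)
    + (scaleC_L2 (vector_derivative \<phi> (at s)) (source0 \<alpha>) - scaleC_L2 ((\<phi> s)\<^sup>2) (source1 \<alpha>))"
proof -
  let ?A = "\<lambda>x. complex_of_real (profA \<alpha> x)" and ?B = "\<lambda>x. complex_of_real (deriv (profA \<alpha>) x)"
  let ?q = "rep_L2 (of_H2 Y)" and ?p = "rep_L2 (h2d 1 Y)"
  have cA: "continuous_on {0..1} ?A" and cB: "continuous_on {0..1} ?B"
    by (intro continuous_intros continuous_profA)+
  have sq1: "sq_integrable (\<lambda>x. ?q x * ?p x)"
    by (rule sq_integrable_mult_op[OF rep_L2_measurable H2_sup_bound])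
  have sq2: "sq_integrable (\<lambda>x. ?A x * ?p x)" "sq_integrable (\<lambda>x. ?B x * ?q x)"
    using continuous_measurable_bounded[OF cA] continuous_measurable_bounded[OF cB] sq_integrable_mult_op by metis+
  have sq3: "sq_integrable ?A" "sq_integrable (\<lambda>x. ?A x * ?B x)"
    by (intro sq_integrable_continuous continuous_intros cA cB)+
  note sq = sq1 sq2 sq3 sq_integrable_cmult sq_integrable_add sq_integrable_diff sq_integrable_uminus
  have "forcing \<alpha> \<phi> y s = toL2 (\<lambda>x. (- (?q x * ?p x) + \<phi> s * (?A x * ?p x + ?B x * ?q x))
      + (vector_derivative \<phi> (at s) * ?A x - (\<phi> s)\<^sup>2 * (?A x * ?B x)))"
    unfolding forcing_def assms coef_a_def coef_b_def source_f_def
    by (rule toL2_cong) (simp add: h2d_def algebra_simps)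
  also have "\<dots> = (- toL2 (\<lambda>x. ?q x * ?p x) + scaleC_L2 (\<phi> s) (toL2 (\<lambda>x. ?A x * ?p x) + toL2 (\<lambda>x. ?B x * ?q x)))
      + (scaleC_L2 (vector_derivative \<phi> (at s)) (toL2 ?A) - scaleC_L2 ((\<phi> s)\<^sup>2) (toL2 (\<lambda>x. ?A x * ?B x)))"
    by (simp only: toL2_add toL2_diff toL2_uminus toL2_cmult sq)
  finally show ?thesis
    by (simp only: convection_def linear_part_def mult_op_def source0_def source1_def)
qed

section \<open>Existence and uniqueness by contraction\<close>

lemma C1_norm_bounds:
  assumes "C1_norm \<phi> \<le> ereal \<epsilon>"
  shows "norm (\<phi> t) \<le> \<epsilon>" "norm (vector_derivative \<phi> (at t)) \<le> \<epsilon>"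
proof -
  let ?s = "SUP t. ereal (norm (\<phi> t))" and ?s' = "SUP t. ereal (norm (vector_derivative \<phi> (at t)))"
  have le: "ereal (norm (\<phi> t)) \<le> ?s" "ereal (norm (vector_derivative \<phi> (at t))) \<le> ?s'"
    by (auto intro: SUP_upper)
  have nn: "0 \<le> ?s" "0 \<le> ?s'"
    using le order_trans[of 0 "ereal (norm (\<phi> t))"] order_trans[of 0 "ereal (norm (vector_derivative \<phi> (at t)))"] by auto
  have "?s + ?s' \<le> ereal \<epsilon>" using assms by (simp add: C1_norm_def)
  moreover have "?s \<le> ?s + ?s'" "?s' \<le> ?s + ?s'" using nn by (simp_all add: add_increasing add_increasing2)
  ultimately have "ereal (norm (\<phi> t)) \<le> ereal \<epsilon>" "ereal (norm (vector_derivative \<phi> (at t))) \<le> ereal \<epsilon>"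
    using le by (meson order_trans)+
  then show "norm (\<phi> t) \<le> \<epsilon>" "norm (vector_derivative \<phi> (at t)) \<le> \<epsilon>" by simp_all
qed

definition linear_const :: "real \<Rightarrow> real" where
  "linear_const \<alpha> = onorm (linear_part \<alpha>)"

definition source_const :: "real \<Rightarrow> real" where
  "source_const \<alpha> = norm (source0 \<alpha>) + norm (source1 \<alpha>)"

lemma norm_linear_part_le: "norm (linear_part \<alpha> y) \<le> linear_const \<alpha> * norm y"
  unfolding linear_const_def by (rule onorm[OF bounded_linear_linear_part])

lemma linear_const_nonneg: "0 \<le> linear_const \<alpha>"
  unfolding linear_const_def by (rule onorm_pos_le[OF bounded_linear_linear_part])

locale kawahara_boundary = kawahara +
  fixes \<phi> :: "real \<Rightarrow> complex" and \<epsilon> :: real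
  assumes eps: "0 < \<epsilon>" "\<epsilon> \<le> 1"
    and phi_C1: "\<phi> C1_differentiable_on UNIV"
    and phi_norm: "C1_norm \<phi> \<le> ereal \<epsilon>"
begin

lemma phi_cont: "continuous_on UNIV \<phi>" "continuous_on UNIV (\<lambda>t. vector_derivative \<phi> (at t))"
  using phi_C1 C1_differentiable_imp_continuous_on by (auto simp: C1_differentiable_on_eq)

lemmas phi_le = C1_norm_bounds[OF phi_norm]

definition boundary :: "real \<Rightarrow>\<^sub>C H2I" where
  "boundary = Bcontfun (\<lambda>t. profile \<alpha> (\<phi> t))"

lemma norm_profile_phi: "norm (profile \<alpha> (\<phi> t)) \<le> profile_const \<alpha> * \<epsilon>"
  by (rule order_trans[OF norm_profile_le mult_left_mono[OF phi_le(1)]]) (simp add: profile_const_def)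

lemma apply_boundary: "apply_bcontfun boundary t = profile \<alpha> (\<phi> t)"
  unfolding boundary_def
  by (subst Bcontfun_inverse) (auto intro!: bcontfun_normI[OF _ norm_profile_phi] continuous_on_profile phi_cont)

lemma norm_boundary: "norm boundary \<le> profile_const \<alpha> * \<epsilon>"
  by (rule norm_bound) (simp add: apply_boundary norm_profile_phi)

lemma shifted_eq: "shifted \<alpha> \<phi> u = (\<lambda>t. of_H2 (apply_bcontfun (u + boundary) t))"
  using linear_add[OF bounded_linear.linear[OF bounded_linear_of_H2]]
  by (auto simp: fun_eq_iff shifted_def apply_boundary of_H2_profile mult.commute)

definition forced :: "(real \<Rightarrow>\<^sub>C H2I) \<Rightarrow> real \<Rightarrow> L2I" where
  "forced Y = forcing \<alpha> \<phi> (\<lambda>t. of_H2 (apply_bcontfun Y t))"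

lemma forced_eq: "forced Y s = - convection (apply_bcontfun Y s) (apply_bcontfun Y s) + scaleC_L2 (\<phi> s) (linear_part \<alpha> (apply_bcontfun Y s))
    + (scaleC_L2 (vector_derivative \<phi> (at s)) (source0 \<alpha>) - scaleC_L2 ((\<phi> s)\<^sup>2) (source1 \<alpha>))"
  unfolding forced_def by (rule forcing_eq) simp

lemma norm_forced_le: "norm (forced Y s) \<le> (2 * norm Y + linear_const \<alpha> * \<epsilon>) * norm Y + 2 * source_const \<alpha> * \<epsilon>"
proof -
  let ?y = "apply_bcontfun Y s"
  have y: "norm ?y \<le> norm Y" by (rule norm_bounded)
  have "norm (convection ?y ?y) \<le> 2 * norm ?y * norm ?y" by (rule norm_convection_le)
  also have "\<dots> \<le> 2 * norm Y * norm Y" using y by (intro mult_mono) auto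
  finally have 1: "norm (convection ?y ?y) \<le> 2 * norm Y * norm Y" .
  have "norm (scaleC_L2 (\<phi> s) (linear_part \<alpha> ?y)) \<le> \<epsilon> * (linear_const \<alpha> * norm Y)"
    unfolding norm_scaleC_L2 using eps linear_const_nonneg[of \<alpha>] phi_le(1)[of s] y norm_linear_part_le[of \<alpha> ?y]
    by (intro mult_mono order_trans[OF norm_linear_part_le] mult_left_mono) auto
  moreover have "norm (scaleC_L2 (vector_derivative \<phi> (at s)) (source0 \<alpha>)) \<le> \<epsilon> * source_const \<alpha>"
    unfolding norm_scaleC_L2 using eps phi_le(2)[of s] by (intro mult_mono) (auto simp: source_const_def)
  moreover have "norm (scaleC_L2 ((\<phi> s)\<^sup>2) (source1 \<alpha>)) \<le> \<epsilon> * source_const \<alpha>"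
  proof -
    \<comment> \<open>Here \<epsilon> <= 1 makes the quadratic source of size \<epsilon>, like the
      one with \<phi>'.\<close>
    have "norm (\<phi> s) * norm (\<phi> s) \<le> \<epsilon> * 1"
      using phi_le(1)[of s] eps by (intro mult_mono) auto
    then show ?thesis
      unfolding norm_scaleC_L2 using eps by (intro mult_mono) (auto simp: source_const_def norm_mult power2_eq_square)
  qed
  moreover have "norm (forced Y s) \<le> norm (convection ?y ?y) + norm (scaleC_L2 (\<phi> s) (linear_part \<alpha> ?y))
      + (norm (scaleC_L2 (vector_derivative \<phi> (at s)) (source0 \<alpha>)) + norm (scaleC_L2 ((\<phi> s)\<^sup>2) (source1 \<alpha>)))"
    unfolding forced_eq
    by (intro norm_triangle_mono norm_triangle_le_diff) auto
  ultimately show ?thesis using 1 by (simp add: algebra_simps)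
qed

lemma continuous_on_forced: "continuous_on UNIV (forced Y)"
  unfolding forced_eq[abs_def]
  by (intro continuous_intros bounded_bilinear.continuous_on[OF bounded_bilinear_convection]
      bounded_bilinear.continuous_on[OF bounded_bilinear_scaleC]
      bounded_linear.continuous_on[OF bounded_linear_linear_part] phi_cont) auto

definition Forced :: "(real \<Rightarrow>\<^sub>C H2I) \<Rightarrow> (real \<Rightarrow>\<^sub>C L2I)" where
  "Forced Y = Bcontfun (forced Y)"

lemma apply_Forced: "apply_bcontfun (Forced Y) = forced Y"
  unfolding Forced_def
  by (rule Bcontfun_inverse) (rule bcontfun_normI[OF continuous_on_forced norm_forced_le])

lemma norm_Forced_le: "norm (Forced Y) \<le> (2 * norm Y + linear_const \<alpha> * \<epsilon>) * norm Y + 2 * source_const \<alpha> * \<epsilon>"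
  by (rule norm_bound) (simp add: apply_Forced norm_forced_le)

lemma norm_Forced_diff_le:
  "norm (Forced Y - Forced Z) \<le> (2 * (norm Y + norm Z) + linear_const \<alpha> * \<epsilon>) * norm (Y - Z)"
proof (rule norm_bound)
  fix s
  let ?y = "apply_bcontfun Y s" and ?z = "apply_bcontfun Z s"
  have y: "norm ?y \<le> norm Y" "norm ?z \<le> norm Z" "norm (?y - ?z) \<le> norm (Y - Z)"
    using norm_bounded[of Y s] norm_bounded[of Z s] norm_bounded[of "Y - Z" s] by auto
  interpret M: bounded_bilinear convection by (rule bounded_bilinear_convection)
  interpret C: bounded_bilinear scaleC_L2 by (rule bounded_bilinear_scaleC)
  have "apply_bcontfun (Forced Y - Forced Z) s = forced Y s - forced Z s" by (simp add: apply_Forced)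
  \<comment> \<open>The sources cancel, and the quadratic term is split as B(y,y) - B(z,z) = B(y -
    z, y) + B(z, y - z).\<close>
  also have "\<dots> = - (convection (?y - ?z) ?y + convection ?z (?y - ?z)) + scaleC_L2 (\<phi> s) (linear_part \<alpha> (?y - ?z))"
    unfolding forced_eq linear_diff[OF bounded_linear.linear[OF bounded_linear_linear_part]]
    by (simp add: M.diff_left M.diff_right C.diff_right)
  also have "norm \<dots> \<le> 2 * norm (?y - ?z) * norm ?y + 2 * norm ?z * norm (?y - ?z) + norm (\<phi> s) * norm (linear_part \<alpha> (?y - ?z))"
  proof (rule norm_triangle_mono)
    show "norm (- (convection (?y - ?z) ?y + convection ?z (?y - ?z))) \<le> 2 * norm (?y - ?z) * norm ?y + 2 * norm ?z * norm (?y - ?z)"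
      unfolding norm_minus_cancel by (intro norm_triangle_mono norm_convection_le)
  qed (simp add: norm_scaleC_L2)
  also have "\<dots> \<le> 2 * norm (Y - Z) * norm Y + 2 * norm Z * norm (Y - Z) + \<epsilon> * (linear_const \<alpha> * norm (Y - Z))"
    using y eps phi_le(1)[of s] linear_const_nonneg[of \<alpha>]
    by (intro add_mono mult_mono order_trans[OF norm_linear_part_le]) auto
  also have "\<dots> = (2 * (norm Y + norm Z) + linear_const \<alpha> * \<epsilon>) * norm (Y - Z)" by (simp add: algebra_simps)
  finally show "norm (apply_bcontfun (Forced Y - Forced Z) s) \<le> (2 * (norm Y + norm Z) + linear_const \<alpha> * \<epsilon>) * norm (Y - Z)" .
qed

text \<open>Once \<open>u\<close> is given, its forcing is just a bounded continuous curve and the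
  integral equation is a linear one: \<open>Psi\<close> solves it, and by
  \<open>bounded_mild_unique\<close> nothing else bounded does.\<close>

lemma mild_solution_iff: "mild_solution S \<alpha> \<phi> u \<longleftrightarrow> u + boundary = Psi (Forced (u + boundary))"
proof -
  let ?Y = "u + boundary"
  have eq: "mild_solution S \<alpha> \<phi> u \<longleftrightarrow> (\<forall>r t. r \<le> t \<longrightarrow>
      (\<lambda>s. S (t - s) (apply_bcontfun (Forced ?Y) s)) integrable_on {r..t} \<and>
      of_H2 (apply_bcontfun ?Y t) = S (t - r) (of_H2 (apply_bcontfun ?Y r))
        + integral {r..t} (\<lambda>s. S (t - s) (apply_bcontfun (Forced ?Y) s)))"
    unfolding mild_solution_def Let_def shifted_eq apply_Forced forced_def ..
  show ?thesis
  proof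
    assume mild: "mild_solution S \<alpha> \<phi> u"
    show "?Y = Psi (Forced ?Y)"
    proof (rule bcontfun_eqI, rule of_H2_inject')
      fix t
      show "of_H2 (apply_bcontfun ?Y t) = of_H2 (apply_bcontfun (Psi (Forced ?Y)) t)"
      proof (rule bounded_mild_unique[of "\<lambda>t. of_H2 (apply_bcontfun ?Y t)"])
        show "norm (of_H2 (apply_bcontfun ?Y t)) \<le> norm ?Y" for t
          by (rule order_trans[OF norm_of_H2_le norm_bounded])
      qed (use mild eq in blast)
    qed
  next
    assume fp: "?Y = Psi (Forced ?Y)"
    show "mild_solution S \<alpha> \<phi> u"
      unfolding eq
    proof (intro allI impI conjI)
      fix r t :: real assume rt: "r \<le> t"
      show "(\<lambda>s. S (t - s) (apply_bcontfun (Forced ?Y) s)) integrable_on {r..t}"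
        by (rule mild_integrable) simp
      show "of_H2 (apply_bcontfun ?Y t) = S (t - r) (of_H2 (apply_bcontfun ?Y r))
          + integral {r..t} (\<lambda>s. S (t - s) (apply_bcontfun (Forced ?Y) s))"
        using Psi_mild[OF rt, of "Forced ?Y"] unfolding fp[symmetric] .
    qed
  qed
qed

text \<open>The contraction acts on y = u + boundary in the ball of radius D \<epsilon>. With p =
  \<open>profile_const\<close>, a competing \<open>u\<close> of size (D + p) \<epsilon> only gives y
  of size (D + 2 p) \<epsilon> = R \<epsilon>, so the Lipschitz bound is proved on this larger
  ball.\<close>

lemma unique_small_solution:
  assumes small: "smoothing_const * (4 * R + linear_const \<alpha>) * \<epsilon> \<le> 1 / 2"
    and R: "R = D + 2 * profile_const \<alpha>" and D: "D = 4 * smoothing_const * source_const \<alpha> + 1"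
  shows "\<exists>!u. mild_solution S \<alpha> \<phi> u \<and> norm u \<le> (D + profile_const \<alpha>) * \<epsilon>"
proof -
  have pN: "0 \<le> profile_const \<alpha>" by (simp add: profile_const_def)
  have sK: "0 \<le> source_const \<alpha>" by (simp add: source_const_def)
  then have D1: "1 \<le> D" unfolding D using smoothing_const_pos by simp
  have lip: "norm (Psi (Forced Y) - Psi (Forced Z)) \<le> 1 / 2 * norm (Y - Z)"
    if "norm Y \<le> R * \<epsilon>" "norm Z \<le> R * \<epsilon>" for Y Z
  proof -
    have "norm (Psi (Forced Y) - Psi (Forced Z)) \<le> smoothing_const * norm (Forced Y - Forced Z)"
      unfolding Psi_diff[symmetric] by (rule norm_Psi_le)
    also have "\<dots> \<le> smoothing_const * ((2 * (norm Y + norm Z) + linear_const \<alpha> * \<epsilon>) * norm (Y - Z))"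
      using smoothing_const_pos by (intro mult_left_mono norm_Forced_diff_le) auto
    also have "\<dots> \<le> smoothing_const * ((2 * (R * \<epsilon> + R * \<epsilon>) + linear_const \<alpha> * \<epsilon>) * norm (Y - Z))"
      using smoothing_const_pos that linear_const_nonneg[of \<alpha>] by (intro mult_left_mono mult_right_mono add_mono) auto
    also have "\<dots> = (smoothing_const * (4 * R + linear_const \<alpha>) * \<epsilon>) * norm (Y - Z)" by (simp add: algebra_simps)
    also have "\<dots> \<le> 1 / 2 * norm (Y - Z)" by (intro mult_right_mono small) simp
    finally show ?thesis .
  qed
  have RD: "D * \<epsilon> \<le> R * \<epsilon>" using pN eps unfolding R by (intro mult_right_mono) auto
  have "\<exists>!Y. Y \<in> cball 0 (D * \<epsilon>) \<and> Psi (Forced Y) = Y"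
  proof (rule Banach_fix)
    show "complete (cball (0 :: real \<Rightarrow>\<^sub>C H2I) (D * \<epsilon>))" by (simp add: complete_eq_closed)
    have "0 \<le> D * \<epsilon>" by (rule mult_nonneg_nonneg) (use D1 eps in auto)
    then show "cball (0 :: real \<Rightarrow>\<^sub>C H2I) (D * \<epsilon>) \<noteq> {}" by simp
    show "(\<lambda>Y. Psi (Forced Y)) ` cball 0 (D * \<epsilon>) \<subseteq> cball 0 (D * \<epsilon>)"
    proof (intro image_subsetI)
      fix Y :: "real \<Rightarrow>\<^sub>C H2I" assume "Y \<in> cball 0 (D * \<epsilon>)"
      then have Y: "norm Y \<le> D * \<epsilon>" by simp
      have "norm (Psi (Forced Y)) \<le> smoothing_const * ((2 * norm Y + linear_const \<alpha> * \<epsilon>) * norm Y + 2 * source_const \<alpha> * \<epsilon>)"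
        using norm_Psi_le[of "Forced Y"] mult_left_mono[OF norm_Forced_le[of Y], of smoothing_const] smoothing_const_pos by linarith
      also have "\<dots> \<le> smoothing_const * ((2 * (D * \<epsilon>) + linear_const \<alpha> * \<epsilon>) * (D * \<epsilon>) + 2 * source_const \<alpha> * \<epsilon>)"
        using Y smoothing_const_pos D1 eps linear_const_nonneg[of \<alpha>] sK by (intro mult_left_mono add_mono mult_mono) auto
      also have "\<dots> = (smoothing_const * (2 * D + linear_const \<alpha>) * \<epsilon>) * (D * \<epsilon>) + (2 * smoothing_const * source_const \<alpha>) * \<epsilon>"
        by (simp add: algebra_simps)
      \<comment> \<open>Half of the radius is for the nonlinear and variable-coefficient terms,
        through the smallness of \<epsilon>, and half for the source, through the summand 4
        \<open>smoothing_const\<close> \<open>source_const\<close> of \<open>D\<close>.\<close>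
      also have "\<dots> \<le> 1 / 2 * (D * \<epsilon>) + (D / 2) * \<epsilon>"
      proof (intro add_mono mult_right_mono)
        have "smoothing_const * (2 * D + linear_const \<alpha>) * \<epsilon> \<le> smoothing_const * (4 * R + linear_const \<alpha>) * \<epsilon>"
          using smoothing_const_pos eps pN D1 unfolding R by (intro mult_right_mono mult_left_mono add_mono) auto
        then show "smoothing_const * (2 * D + linear_const \<alpha>) * \<epsilon> \<le> 1 / 2" using small by linarith
      qed (use D D1 eps in auto)
      finally show "Psi (Forced Y) \<in> cball 0 (D * \<epsilon>)" by simp
    qed
    show "dist (Psi (Forced Y)) (Psi (Forced Z)) \<le> 1 / 2 * dist Y Z"
      if "Y \<in> cball 0 (D * \<epsilon>)" "Z \<in> cball 0 (D * \<epsilon>)" for Y Z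
      using lip[of Y Z] that RD by (simp add: dist_norm)
  qed auto
  then obtain Y where Y: "norm Y \<le> D * \<epsilon>" "Psi (Forced Y) = Y" by auto
  show ?thesis
  proof (rule ex1I[of _ "Y - boundary"])
    show "mild_solution S \<alpha> \<phi> (Y - boundary) \<and> norm (Y - boundary) \<le> (D + profile_const \<alpha>) * \<epsilon>"
      using Y norm_boundary norm_triangle_ineq4[of Y boundary] by (simp add: mild_solution_iff algebra_simps)
    fix u assume u: "mild_solution S \<alpha> \<phi> u \<and> norm u \<le> (D + profile_const \<alpha>) * \<epsilon>"
    let ?Z = "u + boundary"
    have "norm ?Z \<le> R * \<epsilon>"
      using u norm_boundary norm_triangle_ineq[of u boundary] by (simp add: R algebra_simps)
    moreover have "norm Y \<le> R * \<epsilon>" using Y RD by linarith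
    \<comment> \<open>The uniqueness part of Banach's theorem does not cover \<open>?Z\<close>,
      which may lie outside the small ball; the Lipschitz bound is applied directly.\<close>
    ultimately have "norm (Psi (Forced ?Z) - Psi (Forced Y)) \<le> 1 / 2 * norm (?Z - Y)" by (rule lip)
    moreover have "Psi (Forced ?Z) = ?Z" using u mild_solution_iff by simp
    ultimately have "norm (?Z - Y) \<le> 1 / 2 * norm (?Z - Y)" using Y(2) by simp
    then show "u = Y - boundary" by (simp add: eq_diff_eq)
  qed
qed

end

text \<open>The constant of the bound is \<open>D + profile_const \<alpha>\<close>, built from the
  smoothing, source and profile constants before the threshold is chosen; this is its independence
  of \<epsilon>.\<close>

theorem theorem1p2:
  fixes \<alpha> :: real and S :: "real \<Rightarrow> L2I \<Rightarrow> L2I"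
  assumes "\<bar>\<alpha>\<bar> < 1"
    and "C0_contraction_semigroup S" and "generator S = kawahara_op \<alpha>"
  shows "\<exists>C>0. \<exists>\<epsilon>\<^sub>0>0. \<forall>\<epsilon>. 0 < \<epsilon> \<and> \<epsilon> \<le> \<epsilon>\<^sub>0 \<longrightarrow>
    (\<forall>\<phi>. \<phi> C1_differentiable_on UNIV \<and> C1_norm \<phi> \<le> ereal \<epsilon> \<longrightarrow>
      (\<exists>!u :: real \<Rightarrow>\<^sub>C H2I. mild_solution S \<alpha> \<phi> u \<and> norm u \<le> C * \<epsilon>))"
proof -
  interpret kawahara \<alpha> S by (rule kawahara.intro) (rule assms)+
  define D where "D = 4 * smoothing_const * source_const \<alpha> + 1"
  define R where "R = D + 2 * profile_const \<alpha>"
  define q where "q = smoothing_const * (4 * R + linear_const \<alpha>)"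
  have "0 \<le> profile_const \<alpha>" "0 \<le> source_const \<alpha>" by (simp_all add: profile_const_def source_const_def)
  then have pos: "0 < D" "0 < D + profile_const \<alpha>" "0 < R"
    using smoothing_const_pos by (simp_all add: D_def R_def add_nonneg_pos add_pos_nonneg)
  then have q: "0 \<le> q" using smoothing_const_pos linear_const_nonneg[of \<alpha>] by (simp add: q_def)
  show ?thesis
  \<comment> \<open>The threshold makes q \<epsilon> at most 1/2, the smallness condition of
    \<open>unique_small_solution\<close>; the added 1 keeps the denominator positive when only 0 <=
    q is known.\<close>
  proof (rule exI[of _ "D + profile_const \<alpha>"], rule conjI[OF pos(2)], rule exI[of _ "min 1 (1 / (2 * q + 1))"],
      intro conjI allI impI)
    show "0 < min 1 (1 / (2 * q + 1))" using q by simp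
    fix \<epsilon> :: real and \<phi> :: "real \<Rightarrow> complex"
    assume e: "0 < \<epsilon> \<and> \<epsilon> \<le> min 1 (1 / (2 * q + 1))"
      and p: "\<phi> C1_differentiable_on UNIV \<and> C1_norm \<phi> \<le> ereal \<epsilon>"
    interpret kawahara_boundary \<alpha> S \<phi> \<epsilon>
      by unfold_locales (use e p in auto)
    have "q * \<epsilon> \<le> q * (1 / (2 * q + 1))" using e q by (intro mult_left_mono) auto
    also have "\<dots> \<le> 1 / 2" using q by (simp add: field_simps)
    finally show "\<exists>!u. mild_solution S \<alpha> \<phi> u \<and> norm u \<le> (D + profile_const \<alpha>) * \<epsilon>"
      unfolding q_def by (rule unique_small_solution[OF _ R_def D_def])
  qed
qed

end
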